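(* Let $d\ge 2$ and $n\ge 2$ be integers. The subset $$\mathcal K_{d;\le n}=\{\mathbf c\in\mathfrak g_{\le n}(\mathbb R^d):\ c_i=0\ (1\le i\le d-1),\ c_{j(i+1)}=0\ (1\le j<i\le d-1),\ c_d>0,\ c_{i(i+1)}>0\ (1\le i\le d-1)\}$$ is a cross-section for the action of $O_d(\mathbb R)$ on $\mathcal U_{d;\le n}\subset\mathfrak g_{\le n}(\mathbb R^d)$. In particular $\mathcal K_{d;\le n}$ induces a moving frame $\rho_d:\mathcal U_{d;\le n}\to O_d(\mathbb R)$ (sending each element to the unique group element bringing it into $\mathcal K_{d;\le n}$).
   Context: Words are finite strings over the alphabet $\{1,\dots,d\}$; $T_{\le n}(\mathbb R^d)=\bigoplus_{k=0}^n(\mathbb R^d)^{\otimes k}$ is the truncated tensor algebra (spanned by words of length $\le n$, product = concatenation, truncated above length $n$), with commutator bracket $[x,y]=xy-yx$. The free step-$n$ nilpotent Lie algebra is $\mathfrak g_{\le n}(\mathbb R^d)=\bigoplus_{k=1}^n W_k\subset T_{\le n}(\mathbb R^d)$ with $W_1=\mathrm{span}\{1,\dots,d\}$ and $W_{k+1}=[W_1,W_k]$. A Lyndon word is a nonempty word strictly smaller (lexicographically) than each of its proper nonempty suffixes; for a Lyndon word $h$ of length $\ge2$ its standard factorization is $h=uv$ with $v$ the longest proper Lyndon suffix. The Lyndon basis is $b_i=i$ for letters and $b_h=[b_u,b_v]$ for the standard factorization; every $\mathbf c\in\mathfrak g_{\le n}(\mathbb R^d)$ is written $\mathbf c=\sum_{h\text{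 Lyndon},|h|\le n}c_h b_h$, defining coordinates $c_h$ (e.g. $c_i$, and $c_{ij}$ for $i<j$ with $b_{ij}=[i,j]$). A matrix $A=(a_{ij})\in O_d(\mathbb R)$ acts on $T_{\le n}(\mathbb R^d)$ by the algebra automorphism sending each letter $i$ to $\sum_j a_{ji}\, j$ (i.e. by $A^{\otimes k}$ on level $k$); this preserves $\mathfrak g_{\le n}(\mathbb R^d)$. Identifying the level-$\le2$ part of $\mathbf c$ with $(v,M)\in\mathbb R^d\oplus\mathfrak{so}(d,\mathbb R)$, $v=(c_1,\dots,c_d)^\top$, $M_{ij}=c_{ij}=-M_{ji}$ for $i<j$, the action on it is $(v,M)\mapsto(Av,AMA^\top)$. Definition of $\mathcal U_{d;\le n}$: On $V_{\mathbb C}=\mathbb C^d\oplus\mathfrak{so}(d,\mathbb C)$ (same coordinates, complex), with $O_d(\mathbb C)=\{A: AA^\top=I\}$ acting by $(Av,AMA^\top)$, let $L^{(1)}=\{c_1=\dots=c_{d-1}=0\}$ and for $2\le i\le d-1$, $L^{(i)}=\{(v,M)\in L^{(i-1)}: c_{k(d-i+2)}=0,\ 1\le k\le d-i\}$. Let $f_1=c_1^2+\dots+c_d^2$; for $2\le i\le d-1$ let $f_i$ be the $O_d(\mathbb C)$-invariant rational function on $V_{\mathbb C}$ whose restriction to $L^{(i-1)}$ is $c_{1(d-i+2)}^2+\dots+c_{(d-i+1)(d-i+2)}^2$; and let $f_d$ be the $O_d(\mathbb C)$-invariant rational function whose restriction to $L^{(d-1)}$ is $c_{12}^2$ (these exist,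 have real coefficients, and are uniquely determined by these restrictions). Then $\mathcal U_{d;\le n}$ is the set of $\mathbf c\in\mathfrak g_{\le n}(\mathbb R^d)$ whose level-$\le2$ part $(v,M)$ lies in the domain of each $f_k$ and satisfies $f_k(v,M)\ne0$ for all $1\le k\le d$. A cross-section for an action of a group $G$ on a manifold $X$ is a submanifold $\mathcal K\subset X$ intersecting each orbit transversally at a unique point. A moving frame is a smooth map $\rho:X\to G$ with $\rho(g\cdot z)=\rho(z)g^{-1}$. *)

theory Defs
  imports Complex_Main
begin

definition lex_less :: "nat list \<Rightarrow> nat list \<Rightarrow> bool" where
  "lex_less u v \<longleftrightarrow> (\<exists>t. t \<noteq> [] \<and> v = u @ t) \<or>
     (\<exists>p a b s t. u = p @ a # s \<and> v = p @ b # t \<and> a < b)"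

definition lyndon :: "nat list \<Rightarrow> bool" where
  "lyndon h \<longleftrightarrow> h \<noteq> [] \<and> (\<forall>k. 0 < k \<and> k < length h \<longrightarrow> lex_less h (drop k h))"

definition lyn_words :: "nat \<Rightarrow> nat \<Rightarrow> nat list set" where
  "lyn_words d n = {h. lyndon h \<and> set h \<subseteq> {1..d} \<and> length h \<le> n}"

text \<open>Standard factorization h = take k h @ drop k h, with drop k h the longest proper Lyndon suffix.\<close>
definition std_split :: "nat list \<Rightarrow> nat" where
  "std_split h = (LEAST k. 0 < k \<and> k < length h \<and> lyndon (drop k h))"

type_synonym tensor = "nat list \<Rightarrow> real"

definition tmul :: "nat \<Rightarrow> tensor \<Rightarrow> tensor \<Rightarrow> tensor" where
  "tmul n x y = (\<lambda>w. if length w \<le> n then (\<Sum>k\<le>length w. x (take k w) * y (drop k w)) else 0)"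

definition tbracket :: "nat \<Rightarrow> tensor \<Rightarrow> tensor \<Rightarrow> tensor" where
  "tbracket n x y = (\<lambda>w. tmul n x y w - tmul n y x w)"

definition letter :: "nat \<Rightarrow> tensor" where
  "letter i = (\<lambda>w. if w = [i] then 1 else 0)"

text \<open>Lyndon basis, computed with a fuel parameter (fuel = length of the word suffices).\<close>
fun lb :: "nat \<Rightarrow> nat \<Rightarrow> nat list \<Rightarrow> tensor" where
  "lb n 0 h = (\<lambda>w. 0)"
| "lb n (Suc m) h = (if length h = 1 then letter (hd h)
     else tbracket n (lb n m (take (std_split h) h)) (lb n m (drop (std_split h) h)))"

definition lyn_basis :: "nat \<Rightarrow> nat list \<Rightarrow> tensor" where
  "lyn_basis n h = lb n (length h) h"

text \<open>Lyndon coordinates: a point of g_{<=n}(R^d) is represented by its coordinate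
  vector c (c h = coefficient of b_h), supported on Lyndon words of length <= n.\<close>
definition cspace :: "nat \<Rightarrow> nat \<Rightarrow> (nat list \<Rightarrow> real) set" where
  "cspace d n = {c. \<forall>h. h \<notin> lyn_words d n \<longrightarrow> c h = 0}"

definition lembed :: "nat \<Rightarrow> nat \<Rightarrow> (nat list \<Rightarrow> real) \<Rightarrow> tensor" where
  "lembed d n c = (\<lambda>w. \<Sum>h\<in>lyn_words d n. c h * lyn_basis n h w)"

type_synonym rmat = "nat \<Rightarrow> nat \<Rightarrow> real"

definition Od :: "nat \<Rightarrow> rmat set" where
  "Od d = {A. (\<forall>i j. A i j \<noteq> 0 \<longrightarrow> i \<in> {1..d} \<and> j \<in> {1..d}) \<and>
     (\<forall>i\<in>{1..d}. \<forall>j\<in>{1..d}. (\<Sum>k=1..d. A i k * A j k) = (if i = j then 1 else 0))}"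

definition mmul :: "nat \<Rightarrow> rmat \<Rightarrow> rmat \<Rightarrow> rmat" where
  "mmul d A B = (\<lambda>i j. \<Sum>k=1..d. A i k * B k j)"

definition mtrans :: "rmat \<Rightarrow> rmat" where
  "mtrans A = (\<lambda>i j. A j i)"

text \<open>Algebra automorphism of the tensor algebra induced by letter i |-> sum_j a_ji j.\<close>
definition tact :: "nat \<Rightarrow> rmat \<Rightarrow> tensor \<Rightarrow> tensor" where
  "tact d A x = (\<lambda>w. \<Sum>u\<in>{u. length u = length w \<and> set u \<subseteq> {1..d}}.
       x u * (\<Prod>i<length w. A (w ! i) (u ! i)))"

definition act :: "nat \<Rightarrow> nat \<Rightarrow> rmat \<Rightarrow> (nat list \<Rightarrow> real) \<Rightarrow> (nat list \<Rightarrow> real)" where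
  "act d n A c = (THE c'. c' \<in> cspace d n \<and> lembed d n c' = tact d A (lembed d n c))"

definition VI :: "nat \<Rightarrow> nat list set" where
  "VI d = {[i] | i. i \<in> {1..d}} \<union> {[i, j] | i j. 1 \<le> i \<and> i < j \<and> j \<le> d}"

definition VC :: "nat \<Rightarrow> (nat list \<Rightarrow> complex) set" where
  "VC d = {x. \<forall>w. w \<notin> VI d \<longrightarrow> x w = 0}"

inductive_set cpoly :: "nat \<Rightarrow> ((nat list \<Rightarrow> complex) \<Rightarrow> complex) set" for d where
  cp_const: "(\<lambda>x. a) \<in> cpoly d"
| cp_var: "w \<in> VI d \<Longrightarrow> (\<lambda>x. x w) \<in> cpoly d"
| cp_add: "p \<in> cpoly d \<Longrightarrow> q \<in> cpoly d \<Longrightarrow> (\<lambda>x. p x + q x) \<in> cpoly d"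
| cp_mult: "p \<in> cpoly d \<Longrightarrow> q \<in> cpoly d \<Longrightarrow> (\<lambda>x. p x * q x) \<in> cpoly d"

type_synonym cmat = "nat \<Rightarrow> nat \<Rightarrow> complex"

definition OdC :: "nat \<Rightarrow> cmat set" where
  "OdC d = {A. (\<forall>i j. A i j \<noteq> 0 \<longrightarrow> i \<in> {1..d} \<and> j \<in> {1..d}) \<and>
     (\<forall>i\<in>{1..d}. \<forall>j\<in>{1..d}. (\<Sum>k=1..d. A i k * A j k) = (if i = j then 1 else 0))}"

definition skewC :: "(nat list \<Rightarrow> complex) \<Rightarrow> nat \<Rightarrow> nat \<Rightarrow> complex" where
  "skewC x k l = (if k < l then x [k, l] else if l < k then - x [l, k] else 0)"

text \<open>(v, M) |-> (A v, A M A^T).\<close>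
definition cact :: "nat \<Rightarrow> cmat \<Rightarrow> (nat list \<Rightarrow> complex) \<Rightarrow> (nat list \<Rightarrow> complex)" where
  "cact d A x = (\<lambda>w. if w \<in> VI d then
      (case w of [i] \<Rightarrow> (\<Sum>j=1..d. A i j * x [j])
       | [i, j] \<Rightarrow> (\<Sum>k=1..d. \<Sum>l=1..d. A i k * skewC x k l * A j l)
       | _ \<Rightarrow> 0)
    else 0)"

fun Lsub :: "nat \<Rightarrow> nat \<Rightarrow> (nat list \<Rightarrow> complex) set" where
  "Lsub d 0 = VC d"
| "Lsub d (Suc 0) = {x \<in> VC d. \<forall>k\<in>{1..d-1}. x [k] = 0}"
| "Lsub d (Suc (Suc j)) = {x \<in> Lsub d (Suc j). \<forall>k\<in>{1..d - (j+2)}. x [k, d - j] = 0}"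

text \<open>Prescribed restriction of f_i to L^(i-1), 2 <= i <= d
  (for i = d this is c_12^2).\<close>
definition frestr :: "nat \<Rightarrow> nat \<Rightarrow> (nat list \<Rightarrow> complex) \<Rightarrow> complex" where
  "frestr d i x = (\<Sum>k=1..d+1-i. (x [k, d+2-i])\<^sup>2)"

text \<open>y lies in the domain of f_i and f_i(y) \<noteq> 0: f_i = p/q is an O_d(C)-invariant
  rational function (p q polynomials) whose restriction to L^(i-1) is frestr, and
  p/q is a representation of it regular and nonzero at y.\<close>
definition fk_ok :: "nat \<Rightarrow> nat \<Rightarrow> (nat list \<Rightarrow> complex) \<Rightarrow> bool" where
  "fk_ok d i y \<longleftrightarrow> (\<exists>p q. p \<in> cpoly d \<and> q \<in> cpoly d \<and>
     (\<forall>A\<in>OdC d. \<forall>x\<in>VC d. p (cact d A x) * q x = p x * q (cact d A x)) \<and>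
     (\<exists>x\<in>Lsub d (i - 1). q x \<noteq> 0) \<and>
     (\<forall>x\<in>Lsub d (i - 1). p x = frestr d i x * q x) \<and>
     q y \<noteq> 0 \<and> p y \<noteq> 0)"

definition lvl2C :: "nat \<Rightarrow> (nat list \<Rightarrow> real) \<Rightarrow> (nat list \<Rightarrow> complex)" where
  "lvl2C d c = (\<lambda>w. if w \<in> VI d then complex_of_real (c w) else 0)"

definition U_set :: "nat \<Rightarrow> nat \<Rightarrow> (nat list \<Rightarrow> real) set" where
  "U_set d n = {c \<in> cspace d n. (\<Sum>i=1..d. (c [i])\<^sup>2) \<noteq> 0 \<and>
      (\<forall>i\<in>{2..d}. fk_ok d i (lvl2C d c))}"

definition K_set :: "nat \<Rightarrow> nat \<Rightarrow> (nat list \<Rightarrow> real) set" where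
  "K_set d n = {c \<in> cspace d n. (\<forall>i\<in>{1..d-1}. c [i] = 0) \<and>
      (\<forall>i j. 1 \<le> j \<and> j < i \<and> i \<le> d - 1 \<longrightarrow> c [j, i + 1] = 0) \<and>
      c [d] > 0 \<and> (\<forall>i\<in>{1..d-1}. c [i, i + 1] > 0)}"

definition fsp :: "'i set \<Rightarrow> ('i \<Rightarrow> real) set" where
  "fsp I = {x. \<forall>i. i \<notin> I \<longrightarrow> x i = 0}"

definition open_fsp :: "'i set \<Rightarrow> ('i \<Rightarrow> real) set \<Rightarrow> bool" where
  "open_fsp I S \<longleftrightarrow> S \<subseteq> fsp I \<and>
     (\<forall>x\<in>S. \<exists>e>0. \<forall>y\<in>fsp I. (\<forall>i\<in>I. \<bar>y i - x i\<bar> < e) \<longrightarrow> y \<in> S)"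

definition cont_on_fsp :: "'i set \<Rightarrow> ('i \<Rightarrow> real) set \<Rightarrow> (('i \<Rightarrow> real) \<Rightarrow> real) \<Rightarrow> bool" where
  "cont_on_fsp I S f \<longleftrightarrow> (\<forall>x\<in>S. \<forall>e>0. \<exists>\<delta>>0. \<forall>y\<in>S.
      (\<forall>i\<in>I. \<bar>y i - x i\<bar> < \<delta>) \<longrightarrow> \<bar>f y - f x\<bar> < e)"

definition pd :: "'i \<Rightarrow> (('i \<Rightarrow> real) \<Rightarrow> real) \<Rightarrow> ('i \<Rightarrow> real) \<Rightarrow> real" where
  "pd i f x = (THE D. ((\<lambda>t. f (x(i := x i + t))) has_real_derivative D) (at 0))"

fun ipd :: "'i list \<Rightarrow> (('i \<Rightarrow> real) \<Rightarrow> real) \<Rightarrow> ('i \<Rightarrow> real) \<Rightarrow> real" where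
  "ipd [] f = f"
| "ipd (i # ds) f = pd i (ipd ds f)"

definition smooth_on_fsp :: "'i set \<Rightarrow> ('i \<Rightarrow> real) set \<Rightarrow> (('i \<Rightarrow> real) \<Rightarrow> real) \<Rightarrow> bool" where
  "smooth_on_fsp I S f \<longleftrightarrow> (\<forall>ds. set ds \<subseteq> I \<longrightarrow>
      cont_on_fsp I S (ipd ds f) \<and>
      (\<forall>x\<in>S. \<forall>i\<in>I. (\<lambda>t. ipd ds f (x(i := x i + t))) differentiable (at 0)))"

definition smooth_map_fsp :: "'i set \<Rightarrow> 'j set \<Rightarrow> ('i \<Rightarrow> real) set \<Rightarrow>
    (('i \<Rightarrow> real) \<Rightarrow> ('j \<Rightarrow> real)) \<Rightarrow> bool" where
  "smooth_map_fsp I J S F \<longleftrightarrow> (\<forall>x\<in>S. F x \<in> fsp J) \<and> (\<forall>j\<in>J. smooth_on_fsp I S (\<lambda>x. F x j))"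

definition lin_subspace_fsp :: "'i set \<Rightarrow> ('i \<Rightarrow> real) set \<Rightarrow> bool" where
  "lin_subspace_fsp I L \<longleftrightarrow> L \<subseteq> fsp I \<and> (\<lambda>i. 0) \<in> L \<and>
     (\<forall>x\<in>L. \<forall>y\<in>L. (\<lambda>i. x i + y i) \<in> L) \<and> (\<forall>a. \<forall>x\<in>L. (\<lambda>i. a * x i) \<in> L)"

definition submanifold_fsp :: "'i set \<Rightarrow> ('i \<Rightarrow> real) set \<Rightarrow> bool" where
  "submanifold_fsp I K \<longleftrightarrow> K \<subseteq> fsp I \<and> (\<forall>p\<in>K. \<exists>V \<phi> \<psi> L.
      open_fsp I V \<and> p \<in> V \<and> open_fsp I (\<phi> ` V) \<and>
      smooth_map_fsp I I V \<phi> \<and> smooth_map_fsp I I (\<phi> ` V) \<psi> \<and>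
      (\<forall>x\<in>V. \<psi> (\<phi> x) = x) \<and> lin_subspace_fsp I L \<and> \<phi> ` (K \<inter> V) = \<phi> ` V \<inter> L)"

definition tangent_fsp :: "'i set \<Rightarrow> ('i \<Rightarrow> real) set \<Rightarrow> ('i \<Rightarrow> real) \<Rightarrow> ('i \<Rightarrow> real) set" where
  "tangent_fsp I S p = {v \<in> fsp I. \<exists>\<gamma>. (\<forall>t. \<gamma> t \<in> S) \<and> \<gamma> 0 = p \<and>
      (\<forall>i\<in>I. ((\<lambda>t. \<gamma> t i) has_real_derivative v i) (at 0))}"

definition orbit_of :: "'g set \<Rightarrow> ('g \<Rightarrow> 'x \<Rightarrow> 'x) \<Rightarrow> 'x \<Rightarrow> 'x set" where
  "orbit_of G a x = {a g x | g. g \<in> G}"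

definition cross_section :: "'i set \<Rightarrow> ('i \<Rightarrow> real) set \<Rightarrow> 'g set \<Rightarrow>
    ('g \<Rightarrow> ('i \<Rightarrow> real) \<Rightarrow> ('i \<Rightarrow> real)) \<Rightarrow> ('i \<Rightarrow> real) set \<Rightarrow> bool" where
  "cross_section I X G a K \<longleftrightarrow> K \<subseteq> X \<and> submanifold_fsp I K \<and>
     (\<forall>x\<in>X. \<exists>!k. k \<in> K \<and> k \<in> orbit_of G a x) \<and>
     (\<forall>k\<in>K. \<forall>v\<in>fsp I. \<exists>u\<in>tangent_fsp I K k. \<exists>w\<in>tangent_fsp I (orbit_of G a k) k.
        v = (\<lambda>i. u i + w i))"

definition moving_frame :: "nat \<Rightarrow> nat \<Rightarrow> (nat list \<Rightarrow> real) set \<Rightarrow>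
    ((nat list \<Rightarrow> real) \<Rightarrow> rmat) \<Rightarrow> bool" where
  "moving_frame d n X \<rho> \<longleftrightarrow> (\<forall>z\<in>X. \<rho> z \<in> Od d) \<and>
     (\<forall>i\<in>{1..d}. \<forall>j\<in>{1..d}. smooth_on_fsp (lyn_words d n) X (\<lambda>z. \<rho> z i j)) \<and>
     (\<forall>g\<in>Od d. \<forall>z\<in>X. \<rho> (act d n g z) = mmul d (\<rho> z) (mtrans g))"

end

theory Submission
  imports Defs "Jordan_Normal_Form.Determinant"
begin

text \<open>
  For a point with level-two part \<open>(v, M)\<close>, orthogonalise \<open>v, M v, M\<^sup>2 v, \<dots>\<close> without divisions:
  \<open>w\<^sub>0 = v\<close>, \<open>w\<^sub>1 = M v\<close>,
  \<open>w\<^sub>j\<^sub>+\<^sub>2 = |w\<^sub>j|\<^sup>2 M w\<^sub>j\<^sub>+\<^sub>1 - \<langle>M w\<^sub>j\<^sub>+\<^sub>1, w\<^sub>j\<rangle> w\<^sub>j\<close>. These vectors are polynomial and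
  equivariant, and on \<open>L\<^sup>(\<^sup>i\<^sup>)\<close> the vector \<open>w\<^sub>j\<close> is a multiple of \<open>e\<^sub>d\<^sub>-\<^sub>j\<close> for \<open>j < i\<close>. Hence
  \<open>f\<^sub>2 = |w\<^sub>1|\<^sup>2 / |w\<^sub>0|\<^sup>2\<close> and \<open>f\<^sub>i = |w\<^sub>i\<^sub>-\<^sub>1|\<^sup>2 / (|w\<^sub>i\<^sub>-\<^sub>3|\<^sup>4 |w\<^sub>i\<^sub>-\<^sub>2|\<^sup>2)\<close> for \<open>i > 2\<close>, the set \<open>\<U>\<close>
  is the open set where no \<open>w\<^sub>j\<close> with \<open>j < d\<close> vanishes, and the only group element that can carry a
  point into \<open>\<K>\<close> is the matrix whose row \<open>d - j\<close> is \<open>w\<^sub>j / |w\<^sub>j|\<close>; its entries are smooth. That a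
  point of \<open>\<U>\<close> does reach \<open>\<K>\<close> follows by applying one Householder reflection per column. The action
  on Lyndon coordinates is well defined because \<open>b\<^sub>h\<close> equals \<open>h\<close> plus larger words, and the span of the
  \<open>b\<^sub>h\<close> is closed under brackets.
\<close>

section \<open>Lyndon words\<close>

text \<open>Subtracting only the component along w_j is enough because M is skew: M w_{j+1} has no
  component along w_{j+1}, and on the slices M is tridiagonal in the columns already normalised, so
  no earlier vector enters. Clearing denominators makes the squared norms polynomials, as the parts
  of a rational function must be, and lets one recursion run over both the reals and the complex
  numbers. The delicate point is that f_i is accessible only through some representation p/q, which
  may change with the point and whose q may vanish at points of the slice. So U is described from
  two sides: nonvanishing norms give explicit representations, and conversely an arbitrary p/q
  forces the next column to be nonzero, so that the next reflection exists. The frame is then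
  governed by uniqueness: a group element carrying z into K must have the prescribed rows, hence the
  orthogonality of these rows is never computed. Transversality likewise avoids dimension counts and
  Lie algebras; the frame is differentiated along a line.\<close>

lemma lex_less_iff_lexord: "lex_less u v \<longleftrightarrow> (u, v) \<in> lexord {(a, b). a < b}"
proof -
  have "(\<exists>t. t \<noteq> [] \<and> v = u @ t) \<longleftrightarrow> (\<exists>a t. v = u @ a # t)"
    by (metis list.distinct(1) neq_Nil_conv)
  then show ?thesis
    unfolding lex_less_def lexord_def by auto blast+
qed

lemma lex_less_irrefl: "\<not> lex_less u u"
  by (simp add: lex_less_iff_lexord lexord_irreflexive)

lemma lex_less_trans: "lex_less u v \<Longrightarrow> lex_less v w \<Longrightarrow> lex_less u w"
  unfolding lex_less_iff_lexord by (rule lexord_trans) (auto simp: trans_def)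

lemma lex_less_linear: "lex_less u v \<or> u = v \<or> lex_less v u"
proof -
  have "total {(a, b). a < (b::nat)}" by (auto simp: total_on_def)
  then show ?thesis
    using total_lexord unfolding lex_less_iff_lexord total_on_def by blast
qed

lemma lex_less_append_right: "t \<noteq> [] \<Longrightarrow> lex_less u (u @ t)"
  unfolding lex_less_def by blast

lemma lex_less_append_left: "lex_less (p @ u) (p @ v) \<longleftrightarrow> lex_less u v"
  unfolding lex_less_iff_lexord by (simp add: lexord_same_pref_iff)

text \<open>The length bound excludes that \<open>u\<close> is a proper prefix of \<open>v\<close>,
  so the words differ at a first letter, and that letter decides whatever is appended.\<close>

lemma lex_less_append_both:
  assumes "lex_less u v" "length v \<le> length u"
  shows "lex_less (u @ s) (v @ t)"
proof -
  have "\<not> (\<exists>t. t \<noteq> [] \<and> v = u @ t)" using assms(2) by auto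
  then obtain p a b s' t' where "u = p @ a # s'" "v = p @ b # t'" "a < b"
    using assms(1) unfolding lex_less_def by blast
  then have "u @ s = p @ a # (s' @ s)" "v @ t = p @ b # (t' @ t)" "a < b" by auto
  then show ?thesis unfolding lex_less_def by blast
qed

lemma lyndon_nonempty: "lyndon h \<Longrightarrow> h \<noteq> []"
  by (simp add: lyndon_def)

lemma lyndon_less_suffix: "lyndon (u @ v) \<Longrightarrow> u \<noteq> [] \<Longrightarrow> v \<noteq> [] \<Longrightarrow> lex_less (u @ v) v"
  unfolding lyndon_def by (drule conjunct2, drule spec[of _ "length u"]) simp

lemma lyndonI:
  assumes "h \<noteq> []" "\<And>u v. h = u @ v \<Longrightarrow> u \<noteq> [] \<Longrightarrow> v \<noteq> [] \<Longrightarrow> lex_less h v"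
  shows "lyndon h"
  unfolding lyndon_def
proof (intro conjI allI impI)
  fix k assume k: "0 < k \<and> k < length h"
  show "lex_less h (drop k h)"
    by (rule assms(2)[of "take k h"]) (use k in auto)
qed (fact assms(1))

lemma lyndon_letter: "lyndon [a]"
  by (simp add: lyndon_def)

text \<open>The case to watch is \<open>v = u @ t\<close>: cancelling the common prefix
  \<open>u\<close> leaves the comparison of \<open>v\<close> with its suffix \<open>t\<close>, which
  the Lyndon property settles. Otherwise the first difference lies inside \<open>u\<close>.\<close>

lemma lyndon_append_less:
  assumes "lyndon v" "lex_less u v" "u \<noteq> []"
  shows "lex_less (u @ v) v"
proof (cases "\<exists>t. t \<noteq> [] \<and> v = u @ t")
  case True
  then obtain t where t: "t \<noteq> []" "v = u @ t" by blast
  then have "lex_less v t" using lyndon_less_suffix assms by metis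
  then show ?thesis using t lex_less_append_left by metis
next
  case False
  then obtain p a b s' t' where "u = p @ a # s'" "v = p @ b # t'" "a < b"
    using assms(2) unfolding lex_less_def by blast
  then have "u @ v = p @ a # (s' @ v)" "v = p @ b # t'" "a < b" by auto
  then show ?thesis unfolding lex_less_def by blast
qed

text \<open>A proper suffix begins inside \<open>u\<close>, at the seam, or inside \<open>v\<close>.
  Inside \<open>u\<close> the Lyndon property of \<open>u\<close> decides already within
  \<open>u\<close>; the other two cases pass through \<open>u @ v < v\<close>.\<close>

lemma lyndon_append:
  assumes u: "lyndon u" and v: "lyndon v" and uv: "lex_less u v"
  shows "lyndon (u @ v)"
proof (rule lyndonI)
  show "u @ v \<noteq> []" using lyndon_nonempty[OF u] by simp
next
  fix x y assume xy: "u @ v = x @ y" "x \<noteq> []" "y \<noteq> []"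
  have less: "lex_less (u @ v) v" using lyndon_append_less[OF v uv lyndon_nonempty[OF u]] .
  from xy(1) consider t where "u = x @ t" "t @ v = y" | t where "u @ t = x" "v = t @ y"
    by (auto simp: append_eq_append_conv2)
  then show "lex_less (u @ v) y"
  proof cases
    case 1
    show ?thesis
    proof (cases "t = []")
      case True then show ?thesis using less 1 by simp
    next
      case False
      then have "lex_less u t" using lyndon_less_suffix u 1 xy by blast
      then have "lex_less (u @ v) (t @ v)" using 1 by (intro lex_less_append_both) auto
      then show ?thesis using 1 by simp
    qed
  next
    case 2
    show ?thesis
    proof (cases "t = []")
      case True then show ?thesis using less 2 by simp
    next
      case False
      then have "lex_less v y" using lyndon_less_suffix v 2 xy by blast
      then show ?thesis using less lex_less_trans by blast
    qed
  qed
qed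

text \<open>While \<open>t\<close> is not Lyndon, some proper suffix is smaller than
  \<open>t\<close>, and the descent must stop. This takes the place of the full factorisation into
  Lyndon words in the arguments about \<open>std_split\<close>.\<close>

lemma lyndon_suffix_le_ex:
  assumes "t \<noteq> []"
  shows "\<exists>p s. t = p @ s \<and> lyndon s \<and> (s = t \<or> lex_less s t)"
  using assms
proof (induction "length t" arbitrary: t rule: less_induct)
  case less
  show ?case
  proof (cases "lyndon t")
    case True then show ?thesis by (intro exI[of _ "[]"] exI[of _ t]) simp
  next
    case False
    then obtain u v where uv: "t = u @ v" "u \<noteq> []" "v \<noteq> []" "\<not> lex_less t v"
      using lyndonI less.prems by blast
    then have "lex_less v t" using lex_less_linear by (metis append_self_conv2)
    moreover obtain p s where "v = p @ s" "lyndon s" "s = v \<or> lex_less s v"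
      using less.hyps[of v] uv by auto
    ultimately have "t = (u @ p) @ s" "lyndon s" "lex_less s t" using uv lex_less_trans by auto
    then show ?thesis by blast
  qed
qed

lemma std_split_bounds:
  assumes "2 \<le> length h"
  shows "0 < std_split h" "std_split h < length h" "lyndon (drop (std_split h) h)"
proof -
  have "drop (length h - 1) h = [last h]"
    using assms by (metis append_butlast_last_id append_eq_conv_conj length_butlast list.size(3) not_numeral_le_zero)
  then have "0 < length h - 1 \<and> length h - 1 < length h \<and> lyndon (drop (length h - 1) h)"
    using assms lyndon_letter by auto
  then have "0 < std_split h \<and> std_split h < length h \<and> lyndon (drop (std_split h) h)"
    unfolding std_split_def by (rule LeastI)
  then show "0 < std_split h" "std_split h < length h" "lyndon (drop (std_split h) h)" by auto
qed

lemma std_split_longest: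
  assumes "h = p @ s" "p \<noteq> []" "lyndon s"
  shows "std_split h \<le> length p"
  unfolding std_split_def using assms lyndon_nonempty by (intro Least_le) auto

text \<open>The left factor is Lyndon by maximality of \<open>v\<close>: a Lyndon suffix
  \<open>s < v\<close> of a proper suffix of \<open>u\<close> would make \<open>s @ v\<close> a
  longer proper Lyndon suffix of \<open>h\<close>. So each proper suffix of \<open>u\<close> is at
  least \<open>v\<close>, which exceeds \<open>u\<close>.\<close>

lemma std_factorE:
  assumes "lyndon h" "2 \<le> length h"
  obtains u v where "h = u @ v" "std_split h = length u" "lyndon u" "lyndon v" "lex_less u v"
proof -
  let ?k = "std_split h"
  define u v where "u = take ?k h" and "v = drop ?k h"
  have h: "h = u @ v" and lu: "length u = ?k" and u: "u \<noteq> []" and v: "v \<noteq> []" "lyndon v"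
    using std_split_bounds[OF assms(2)] unfolding u_def v_def by auto
  have hv: "lex_less h v" using lyndon_less_suffix assms(1) h u v by blast
  have uv: "lex_less u v" using lex_less_append_right[OF v(1)] hv h lex_less_trans by blast
  have "lyndon u"
  proof (rule lyndonI[OF u])
    fix x t assume xt: "u = x @ t" "x \<noteq> []" "t \<noteq> []"
    obtain p s where s: "t = p @ s" "lyndon s" "s = t \<or> lex_less s t"
      using lyndon_suffix_le_ex[OF xt(3)] by blast
    have "\<not> lex_less s v"
    proof
      assume "lex_less s v"
      then have "lyndon (s @ v)" using lyndon_append s v by blast
      then have "?k \<le> length (x @ p)"
        using std_split_longest[of h "x @ p" "s @ v"] h xt s by simp
      moreover have "0 < length s" using lyndon_nonempty[OF s(2)] by simp
      ultimately show False using lu xt(1) s(1)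
        by (metis add.assoc add_less_same_cancel1 length_append not_add_less1 le_neq_implies_less less_not_refl add_cancel_right_right)
    qed
    then have "s = v \<or> lex_less v s" using lex_less_linear by blast
    then show "lex_less u t" using uv s(3) lex_less_trans by metis
  qed
  then show thesis using that h lu v uv by metis
qed

text \<open>Suppose \<open>s @ v\<close> were a longer Lyndon suffix, with \<open>s\<close> a proper
  suffix of \<open>u\<close>. As \<open>u2\<close> is the longest proper Lyndon suffix of
  \<open>u\<close>, it is at most \<open>s\<close>; then v <= u2 <= s < s @ v, against s @ v <
  v.\<close>

lemma std_split_append:
  assumes u: "lyndon u" and v: "lyndon v"
    and le: "length u = 1 \<or> (\<exists>u1 u2. u = u1 @ u2 \<and> std_split u = length u1 \<and> \<not> lex_less u2 v)"
  shows "std_split (u @ v) = length u"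
proof (rule antisym)
  show "std_split (u @ v) \<le> length u"
    using std_split_longest lyndon_nonempty u v by blast
  show "length u \<le> std_split (u @ v)"
  proof (rule ccontr)
    assume *: "\<not> ?thesis"
    define k where "k = std_split (u @ v)"
    have len: "2 \<le> length (u @ v)"
      using lyndon_nonempty[OF u] lyndon_nonempty[OF v] by (cases u; cases v) auto
    have k: "0 < k" "k < length u" "lyndon (drop k u @ v)"
      using std_split_bounds[OF len] * unfolding k_def by auto
    then have "length u \<noteq> 1" by simp
    then obtain u1 u2 where u12: "u = u1 @ u2" "std_split u = length u1" "\<not> lex_less u2 v"
      using le by blast
    have len_u: "2 \<le> length u" using k by simp
    define s where "s = drop k u"
    have s: "s \<noteq> []" "u = take k u @ s" using k unfolding s_def by auto
    obtain p t where t: "s = p @ t" "lyndon t" "t = s \<or> lex_less t s"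
      using lyndon_suffix_le_ex[OF s(1)] by blast
    have ly2: "lyndon u2" using std_split_bounds[OF len_u] u12 by simp
    have eq: "u = (take k u @ p) @ t" using s(2) t(1) by simp
    have "take k u @ p \<noteq> []" using k by auto
    then have "length u1 \<le> length (take k u @ p)"
      using std_split_longest[OF eq _ t(2)] u12(2) by simp
    moreover have "u1 @ u2 = (take k u @ p) @ t" using eq unfolding u12(1) .
    ultimately obtain r where r: "u2 = r @ t"
      by (metis append_eq_append_conv_if append_take_drop_id append_assoc same_append_eq)
    have "u2 = t \<or> lex_less u2 t"
      using lyndon_less_suffix[of r t] ly2 r lyndon_nonempty[OF t(2)] by (cases "r = []") auto
    then have "u2 = s \<or> lex_less u2 s" using t(3) lex_less_trans by metis
    then have "s = v \<or> lex_less v s" using u12(3) lex_less_linear lex_less_trans by metis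
    moreover have "lex_less s (s @ v)" by (rule lex_less_append_right[OF lyndon_nonempty[OF v]])
    ultimately have "lex_less v (s @ v)" using lex_less_trans by metis
    moreover have "lex_less (s @ v) v"
      using lyndon_less_suffix[of s v] k s lyndon_nonempty[OF v] unfolding s_def by blast
    ultimately show False using lex_less_trans lex_less_irrefl by blast
  qed
qed

lemma finite_words: "finite {u. set u \<subseteq> {1..d::nat} \<and> length u \<le> n}"
  by (rule finite_lists_length_le) simp

lemma finite_lyn_words: "finite (lyn_words d n)"
  by (rule finite_subset[OF _ finite_words[of d n]]) (auto simp: lyn_words_def)

section \<open>The truncated tensor algebra\<close>

text \<open>The untruncated product; its recursion over the first letter makes associativity an easy induction.\<close>
definition cmul :: "tensor \<Rightarrow> tensor \<Rightarrow> tensor" where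
  "cmul x y w = (\<Sum>k\<le>length w. x (take k w) * y (drop k w))"

lemma tmul_eq_cmul: "tmul n x y w = (if length w \<le> n then cmul x y w else 0)"
  by (simp add: tmul_def cmul_def)

lemma cmul_Nil [simp]: "cmul x y [] = x [] * y []"
  by (simp add: cmul_def)

lemma cmul_Cons [simp]: "cmul x y (a # w) = x [] * y (a # w) + cmul (\<lambda>u. x (a # u)) y w"
  unfolding cmul_def by (simp add: sum.atMost_Suc_shift del: sum.atMost_Suc)

lemma cmul_add_left: "cmul (\<lambda>u. x u + x' u) y w = cmul x y w + cmul x' y w"
  by (simp add: cmul_def algebra_simps sum.distrib)

lemma cmul_add_right: "cmul x (\<lambda>u. y u + y' u) w = cmul x y w + cmul x y' w"
  by (simp add: cmul_def algebra_simps sum.distrib)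

lemma cmul_diff_left: "cmul (\<lambda>u. x u - x' u) y w = cmul x y w - cmul x' y w"
  by (simp add: cmul_def algebra_simps sum_subtractf)

lemma cmul_diff_right: "cmul x (\<lambda>u. y u - y' u) w = cmul x y w - cmul x y' w"
  by (simp add: cmul_def algebra_simps sum_subtractf)

lemma cmul_scale_left: "cmul (\<lambda>u. a * x u) y w = a * cmul x y w"
  by (simp add: cmul_def sum_distrib_left mult.assoc)

lemma cmul_scale_right: "cmul x (\<lambda>u. a * y u) w = a * cmul x y w"
  by (simp add: cmul_def sum_distrib_left algebra_simps)

lemma cmul_sum_left: "cmul (\<lambda>u. \<Sum>k\<in>K. f k u) y w = (\<Sum>k\<in>K. cmul (f k) y w)"
  unfolding cmul_def by (simp add: sum_distrib_right) (rule sum.swap)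

lemma cmul_assoc: "cmul (cmul x y) z w = cmul x (cmul y z) w"
proof (induction w arbitrary: x)
  case (Cons a w)
  have "cmul (cmul x y) z (a # w)
      = x [] * y [] * z (a # w) + cmul (\<lambda>u. x [] * y (a # u) + cmul (\<lambda>u. x (a # u)) y u) z w"
    by simp
  also have "\<dots> = x [] * (y [] * z (a # w) + cmul (\<lambda>u. y (a # u)) z w)
      + cmul (\<lambda>u. x (a # u)) (cmul y z) w"
    by (simp add: cmul_add_left cmul_scale_left Cons.IH algebra_simps)
  finally show ?case by simp
qed simp

lemma cmul_cong:
  assumes "\<And>k. k \<le> length w \<Longrightarrow> x (take k w) = x' (take k w)"
    "\<And>k. k \<le> length w \<Longrightarrow> y (drop k w) = y' (drop k w)"
  shows "cmul x y w = cmul x' y' w"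
  unfolding cmul_def using assms by (intro sum.cong) auto

lemma tbracket_eq_cmul:
  "tbracket n x y w = (if length w \<le> n then cmul x y w - cmul y x w else 0)"
  by (simp add: tbracket_def tmul_eq_cmul)

lemma cmul_tbracket_left:
  "length w \<le> n \<Longrightarrow> cmul (tbracket n x y) z w = cmul (cmul x y) z w - cmul (cmul y x) z w"
  by (subst cmul_diff_left[symmetric]) (rule cmul_cong; simp add: tbracket_eq_cmul)

lemma cmul_tbracket_right:
  "length w \<le> n \<Longrightarrow> cmul z (tbracket n x y) w = cmul z (cmul x y) w - cmul z (cmul y x) w"
  by (subst cmul_diff_right[symmetric]) (rule cmul_cong; simp add: tbracket_eq_cmul)

lemma tbracket_jacobi:
  "tbracket n (tbracket n x y) z
    = (\<lambda>w. tbracket n (tbracket n x z) y w + tbracket n x (tbracket n y z) w)"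
proof
  fix w
  show "tbracket n (tbracket n x y) z w
    = tbracket n (tbracket n x z) y w + tbracket n x (tbracket n y z) w"
  proof (cases "length w \<le> n")
    case True
    then show ?thesis
      unfolding tbracket_eq_cmul[of n _ _ w]
      by (simp add: cmul_tbracket_left cmul_tbracket_right cmul_assoc)
  next
    case False
    then show ?thesis by (simp add: tbracket_eq_cmul)
  qed
qed

lemma tbracket_antisym: "tbracket n x y = (\<lambda>w. (-1) * tbracket n y x w)"
  by (rule ext) (simp add: tbracket_eq_cmul)

lemma tbracket_self: "tbracket n x x = (\<lambda>w. 0)"
  by (rule ext) (simp add: tbracket_eq_cmul)

lemma tbracket_zero_left: "tbracket n (\<lambda>w. 0) y = (\<lambda>w. 0)"
  by (rule ext) (simp add: tbracket_eq_cmul cmul_def)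

lemma tbracket_add_left:
  "tbracket n (\<lambda>w. x w + x' w) y = (\<lambda>w. tbracket n x y w + tbracket n x' y w)"
  by (rule ext) (simp add: tbracket_eq_cmul cmul_add_left cmul_add_right)

lemma tbracket_scale_left: "tbracket n (\<lambda>w. a * x w) y = (\<lambda>w. a * tbracket n x y w)"
  by (rule ext) (simp add: tbracket_eq_cmul cmul_scale_left cmul_scale_right algebra_simps)

text \<open>Only the cut at position \<open>p\<close> can contribute, so the sum over all cuts
  collapses.\<close>

lemma cmul_homogeneous:
  assumes "\<And>w. x w \<noteq> 0 \<Longrightarrow> length w = p" "\<And>w. y w \<noteq> 0 \<Longrightarrow> length w = q"
  shows "cmul x y w = (if length w = p + q then x (take p w) * y (drop p w) else 0)"
proof -
  have *: "x (take k w) * y (drop k w)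
      = (if k = p then (if length w = p + q then x (take p w) * y (drop p w) else 0) else 0)"
    if "k \<le> length w" for k
    using assms(1)[of "take k w"] assms(2)[of "drop k w"] that
    by (cases "x (take k w) = 0"; cases "y (drop k w) = 0") auto
  have "cmul x y w = (\<Sum>k\<le>length w. if k = p
      then (if length w = p + q then x (take p w) * y (drop p w) else 0) else 0)"
    unfolding cmul_def by (rule sum.cong) (use * in auto)
  also have "\<dots> = (if length w = p + q then x (take p w) * y (drop p w) else 0)"
    by (subst sum.delta) auto
  finally show ?thesis .
qed

section \<open>Linear substitution of letters in tensors\<close>

lemma words_Suc:
  "{u. length u = Suc m \<and> set u \<subseteq> A} = (\<lambda>(k, u). k # u) ` (A \<times> {u. length u = m \<and> set u \<subseteq> A})"
  by (auto simp: image_iff length_Suc_conv)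

lemma tact_Nil [simp]: "tact d A x [] = x []"
proof -
  have "{u. length u = length [] \<and> set u \<subseteq> {1..d}} = {[]}" by auto
  then show ?thesis by (simp add: tact_def)
qed

text \<open>Peeling off the first letter matches the recursion of \<open>cmul\<close>, so
  multiplicativity and composition become inductions over the word.\<close>

lemma tact_Cons [simp]:
  "tact d A x (a # w) = (\<Sum>k=1..d. A a k * tact d A (\<lambda>u. x (k # u)) w)"
proof -
  let ?W = "{u. length u = length w \<and> set u \<subseteq> {1..d}}"
  have "tact d A x (a # w)
      = (\<Sum>u\<in>(\<lambda>(k, u). k # u) ` ({1..d} \<times> ?W). x u * (\<Prod>i<Suc (length w). A ((a # w) ! i) (u ! i)))"
    unfolding tact_def by (simp only: words_Suc[symmetric]) simp
  also have "\<dots> = (\<Sum>(k, u)\<in>{1..d} \<times> ?W. x (k # u) * (A a k * (\<Prod>i<length w. A (w ! i) (u ! i))))"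
    by (subst sum.reindex)
      (auto simp: inj_on_def prod.lessThan_Suc_shift split_def simp del: prod.lessThan_Suc)
  also have "\<dots> = (\<Sum>k=1..d. A a k * tact d A (\<lambda>u. x (k # u)) w)"
    unfolding tact_def sum.cartesian_product[symmetric] sum_distrib_left
    by (simp add: algebra_simps)
  finally show ?thesis .
qed

lemma tact_add: "tact d A (\<lambda>u. x u + y u) w = tact d A x w + tact d A y w"
  by (simp add: tact_def algebra_simps sum.distrib)

lemma tact_diff: "tact d A (\<lambda>u. x u - y u) w = tact d A x w - tact d A y w"
  by (simp add: tact_def algebra_simps sum_subtractf)

lemma tact_scale: "tact d A (\<lambda>u. a * x u) w = a * tact d A x w"
  by (simp add: tact_def sum_distrib_left algebra_simps)

lemma tact_zero: "tact d A (\<lambda>u. 0) w = 0"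
  by (simp add: tact_def)

lemma tact_sum: "tact d A (\<lambda>u. \<Sum>k\<in>K. f k u) w = (\<Sum>k\<in>K. tact d A (f k) w)"
  unfolding tact_def by (simp add: sum_distrib_right) (rule sum.swap)

lemma tact_cong: "(\<And>u. length u = length w \<Longrightarrow> x u = y u) \<Longrightarrow> tact d A x w = tact d A y w"
  unfolding tact_def by (intro sum.cong) auto

lemma tact_cmul: "tact d A (cmul x y) w = cmul (tact d A x) (tact d A y) w"
proof (induction w arbitrary: x)
  case (Cons a w)
  have "tact d A (cmul x y) (a # w)
      = (\<Sum>k=1..d. A a k * (x [] * tact d A (\<lambda>u. y (k # u)) w
          + cmul (tact d A (\<lambda>u. x (k # u))) (tact d A y) w))"
    by (simp add: tact_add tact_scale Cons.IH)
  also have "\<dots> = x [] * tact d A y (a # w)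
      + cmul (\<lambda>v. \<Sum>k=1..d. A a k * tact d A (\<lambda>u. x (k # u)) v) (tact d A y) w"
    by (simp add: cmul_sum_left cmul_scale_left algebra_simps sum.distrib sum_distrib_left)
  finally show ?case by simp
qed simp

text \<open>The substitution preserves word length, hence respects the truncation; below the cut it
  is multiplicative.\<close>

lemma tact_tbracket: "tact d A (tbracket n x y) = tbracket n (tact d A x) (tact d A y)"
proof
  fix w
  show "tact d A (tbracket n x y) w = tbracket n (tact d A x) (tact d A y) w"
  proof (cases "length w \<le> n")
    case True
    then have "tact d A (tbracket n x y) w = tact d A (\<lambda>u. cmul x y u - cmul y x u) w"
      by (intro tact_cong) (simp add: tbracket_eq_cmul)
    then show ?thesis using True by (simp add: tact_diff tact_cmul tbracket_eq_cmul)
  next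
    case False
    then have "tact d A (tbracket n x y) w = tact d A (\<lambda>u. 0) w"
      by (intro tact_cong) (simp add: tbracket_eq_cmul)
    then show ?thesis using False by (simp add: tact_zero tbracket_eq_cmul)
  qed
qed

lemma tact_mmul: "tact d A (tact d B x) w = tact d (mmul d A B) x w"
proof (induction w arbitrary: x)
  case (Cons a w)
  have "tact d A (tact d B x) (a # w)
      = (\<Sum>k=1..d. \<Sum>l=1..d. A a k * (B k l * tact d (mmul d A B) (\<lambda>u. x (l # u)) w))"
    by (simp add: tact_sum tact_scale Cons.IH sum_distrib_left)
  also have "\<dots> = (\<Sum>l=1..d. \<Sum>k=1..d. A a k * (B k l * tact d (mmul d A B) (\<lambda>u. x (l # u)) w))"
    by (rule sum.swap)
  also have "\<dots> = tact d (mmul d A B) x (a # w)"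
    by (simp add: mmul_def sum_distrib_right mult.assoc)
  finally show ?case .
qed simp

definition idm :: "nat \<Rightarrow> nat \<Rightarrow> nat \<Rightarrow> 'a::zero_neq_one" where
  "idm d = (\<lambda>i j. if i = j \<and> i \<in> {1..d} then 1 else 0)"

lemma tact_idm:
  assumes "\<And>u. x u \<noteq> 0 \<Longrightarrow> set u \<subseteq> {1..d}"
  shows "tact d (idm d) x w = x w"
  using assms
proof (induction w arbitrary: x)
  case (Cons a w)
  have "tact d (idm d) x (a # w) = (\<Sum>k=1..d. idm d a k * x (k # w))"
  proof -
    have "tact d (idm d) (\<lambda>u. x (k # u)) w = x (k # w)" for k
      by (rule Cons.IH) (use Cons.prems in force)
    then show ?thesis by simp
  qed
  also have "\<dots> = (\<Sum>k=1..d. if k = a then x (a # w) else 0)"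
    by (intro sum.cong) (auto simp: idm_def)
  also have "\<dots> = x (a # w)"
    using Cons.prems[of "a # w"] by (auto simp: sum.delta)
  finally show ?case .
qed simp

section \<open>The Lyndon basis and the action on coordinates\<close>

lemma sum_delta_mult:
  fixes f :: "'b \<Rightarrow> 'a::semiring_1"
  assumes "finite S" "a \<in> S"
  shows "(\<Sum>g\<in>S. (if g = a then 1 else 0) * f g) = f a"
proof -
  have "(\<Sum>g\<in>S. (if g = a then 1 else 0) * f g) = (\<Sum>g\<in>S. if g = a then f a else 0)"
    by (rule sum.cong) auto
  then show ?thesis using assms by simp
qed

text \<open>Both factors of the standard factorisation are strictly shorter, so all sufficient
  amounts of fuel agree and the parameter can be forgotten.\<close>

lemma lb_fuel: "h \<noteq> [] \<Longrightarrow> length h \<le> m \<Longrightarrow> lb n m h = lyn_basis n h"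
proof (induction "length h" arbitrary: h m rule: less_induct)
  case less
  show ?case
  proof (cases "length h = 1")
    case True
    then show ?thesis using less.prems by (cases m) (auto simp: lyn_basis_def)
  next
    case False
    with less.prems have len: "2 \<le> length h" by (cases h) (auto simp: Suc_le_eq)
    note k = std_split_bounds[OF len]
    have *: "lb n p h = tbracket n (lyn_basis n (take (std_split h) h)) (lyn_basis n (drop (std_split h) h))"
      if p: "length h \<le> p" for p
    proof -
      obtain q where q: "p = Suc q" using p len by (cases p) auto
      have "lb n q (take (std_split h) h) = lyn_basis n (take (std_split h) h)"
        "lb n q (drop (std_split h) h) = lyn_basis n (drop (std_split h) h)"
        using k p q by (auto intro!: less.hyps)
      then show ?thesis using q False by simp
    qed
    show ?thesis using *[OF less.prems(2)] *[OF order_refl] by (simp add: lyn_basis_def)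
  qed
qed

lemma lyn_basis_letter: "lyn_basis n [a] = letter a"
  by (simp add: lyn_basis_def)

lemma lyn_basis_append:
  assumes "std_split (u @ v) = length u" "u \<noteq> []" "v \<noteq> []"
  shows "lyn_basis n (u @ v) = tbracket n (lyn_basis n u) (lyn_basis n v)"
proof -
  obtain m where m: "length (u @ v) = Suc m" using assms(2) by (cases u) auto
  have "lb n m u = lyn_basis n u" "lb n m v = lyn_basis n v"
    using m assms(2,3) by (auto intro!: lb_fuel) (cases u; cases v; auto)+
  moreover have "length (u @ v) \<noteq> 1" using assms by (cases u; cases v) auto
  ultimately show ?thesis unfolding lyn_basis_def[of n "u @ v"]
    using assms(1) m by (simp del: length_append)
qed

lemma lyndon_induct [consumes 1, case_names letter append]:
  assumes "lyndon h"
    and "\<And>a. P [a]"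
    and "\<And>u v. std_split (u @ v) = length u \<Longrightarrow> lyndon u \<Longrightarrow> lyndon v \<Longrightarrow> lex_less u v \<Longrightarrow>
      P u \<Longrightarrow> P v \<Longrightarrow> P (u @ v)"
  shows "P h"
  using assms(1)
proof (induction "length h" arbitrary: h rule: less_induct)
  case less
  show ?case
  proof (cases "length h = 1")
    case True
    then show ?thesis using assms(2) by (auto simp: length_Suc_conv)
  next
    case False
    with lyndon_nonempty[OF less.prems] have "2 \<le> length h" by (cases h) (auto simp: Suc_le_eq)
    from less.prems this show ?thesis
    proof (rule std_factorE)
      fix u v assume uv: "h = u @ v" "std_split h = length u" "lyndon u" "lyndon v" "lex_less u v"
      then have "P u" "P v"
        using lyndon_nonempty by (auto intro!: less.hyps)
      then show ?thesis using uv assms(3) by metis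
    qed
  qed
qed

lemma lyn_basis_length_set:
  assumes "lyndon h" "lyn_basis n h w \<noteq> 0"
  shows "length w = length h \<and> set w \<subseteq> set h"
  using assms
proof (induction h arbitrary: w rule: lyndon_induct)
  case (letter a)
  then show ?case by (auto simp: lyn_basis_letter letter_def split: if_splits)
next
  case (append u v)
  have eq: "lyn_basis n (u @ v) = tbracket n (lyn_basis n u) (lyn_basis n v)"
    using append lyndon_nonempty by (intro lyn_basis_append) auto
  have hom: "cmul (lyn_basis n u) (lyn_basis n v) w
      = (if length w = length u + length v then lyn_basis n u (take (length u) w) * lyn_basis n v (drop (length u) w) else 0)"
    "cmul (lyn_basis n v) (lyn_basis n u) w
      = (if length w = length v + length u then lyn_basis n v (take (length v) w) * lyn_basis n u (drop (length v) w) else 0)"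
    by (rule cmul_homogeneous; use append.IH in blast)+
  have set_w: "set w = set (take k w) \<union> set (drop k w)" for k
    by (metis append_take_drop_id set_append)
  from append.prems have
    "cmul (lyn_basis n u) (lyn_basis n v) w \<noteq> 0 \<or> cmul (lyn_basis n v) (lyn_basis n u) w \<noteq> 0"
    by (auto simp: eq tbracket_eq_cmul split: if_splits)
  then show ?case
  proof
    assume "cmul (lyn_basis n u) (lyn_basis n v) w \<noteq> 0"
    then have "length w = length u + length v" "lyn_basis n u (take (length u) w) \<noteq> 0"
      "lyn_basis n v (drop (length u) w) \<noteq> 0"
      unfolding hom by (auto split: if_splits)
    then show ?thesis using append.IH set_w[of "length u"] by fastforce
  next
    assume "cmul (lyn_basis n v) (lyn_basis n u) w \<noteq> 0"
    then have "length w = length u + length v" "lyn_basis n v (take (length v) w) \<noteq> 0"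
      "lyn_basis n u (drop (length v) w) \<noteq> 0"
      unfolding hom by (auto split: if_splits)
    then show ?thesis using append.IH set_w[of "length v"] by fastforce
  qed
qed

lemma cmul_lyn_basis:
  assumes "lyndon u" "lyndon v"
  shows "cmul (lyn_basis n u) (lyn_basis n v) w
    = (if length w = length u + length v
       then lyn_basis n u (take (length u) w) * lyn_basis n v (drop (length u) w) else 0)"
  using assms lyn_basis_length_set by (intro cmul_homogeneous) blast+

text \<open>The product b_u b_v has least word \<open>u @ v\<close> with coefficient 1, while b_v
  b_u starts at \<open>v @ u\<close>, which is larger because u @ v < v < v @ u. The subtraction
  therefore leaves the leading term untouched.\<close>

lemma lyn_basis_triangular:
  assumes "lyndon h" "length h \<le> n"
  shows "lyn_basis n h h = 1 \<and> (\<forall>w. lyn_basis n h w \<noteq> 0 \<longrightarrow> w = h \<or> lex_less h w)"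
  using assms
proof (induction h rule: lyndon_induct)
  case (letter a)
  then show ?case by (auto simp: lyn_basis_letter letter_def split: if_splits)
next
  case (append u v)
  have len: "length u \<le> n" "length v \<le> n" using append.prems by auto
  note IHu = append.IH(1)[OF len(1)] and IHv = append.IH(2)[OF len(2)]
  have ne: "u \<noteq> []" "v \<noteq> []" using append lyndon_nonempty by auto
  have eq: "lyn_basis n (u @ v) w
      = (if length w \<le> n then cmul (lyn_basis n u) (lyn_basis n v) w - cmul (lyn_basis n v) (lyn_basis n u) w else 0)" for w
    using lyn_basis_append[OF append.hyps(1) ne] by (simp add: tbracket_eq_cmul)
  have vu: "lex_less (u @ v) (v @ u)"
    using lyndon_append_less[OF append.hyps(3,4) ne(1)] lex_less_append_right[OF ne(1)] lex_less_trans by blast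
  have first: "w = u @ v \<or> lex_less (u @ v) w" if "cmul (lyn_basis n u) (lyn_basis n v) w \<noteq> 0" for w
  proof -
    let ?a = "take (length u) w" and ?b = "drop (length u) w"
    have *: "lyn_basis n u ?a \<noteq> 0" "lyn_basis n v ?b \<noteq> 0" "length w = length u + length v"
      using that unfolding cmul_lyn_basis[OF append.hyps(2,3)] by (auto split: if_splits)
    then consider "?a = u" "?b = v" | "?a = u" "lex_less v ?b" | "lex_less u ?a"
      using IHu IHv by blast
    then have "?a @ ?b = u @ v \<or> lex_less (u @ v) (?a @ ?b)"
    proof cases
      case 3 then show ?thesis using *(3) by (intro disjI2 lex_less_append_both) auto
    qed (metis lex_less_append_left)+
    then show ?thesis by simp
  qed
  have second: "lex_less (u @ v) w" if "cmul (lyn_basis n v) (lyn_basis n u) w \<noteq> 0" for w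
  proof -
    let ?a = "take (length v) w" and ?b = "drop (length v) w"
    have *: "lyn_basis n v ?a \<noteq> 0" "lyn_basis n u ?b \<noteq> 0" "length w = length u + length v"
      using that unfolding cmul_lyn_basis[OF append.hyps(3,2)] by (auto split: if_splits)
    then consider "?a = v" "?b = u" | "?a = v" "lex_less u ?b" | "lex_less v ?a"
      using IHu IHv by blast
    then have "?a @ ?b = v @ u \<or> lex_less (v @ u) (?a @ ?b)"
    proof cases
      case 3 then show ?thesis using *(3) by (intro disjI2 lex_less_append_both) auto
    qed (metis lex_less_append_left)+
    then show ?thesis using vu lex_less_trans by (metis append_take_drop_id)
  qed
  have "cmul (lyn_basis n v) (lyn_basis n u) (u @ v) = 0"
    using second lex_less_irrefl by blast
  moreover have "cmul (lyn_basis n u) (lyn_basis n v) (u @ v) = 1"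
    using IHu IHv by (simp add: cmul_lyn_basis[OF append.hyps(2,3)])
  ultimately have "lyn_basis n (u @ v) (u @ v) = 1" using append.prems by (simp add: eq)
  moreover have "w = u @ v \<or> lex_less (u @ v) w" if "lyn_basis n (u @ v) w \<noteq> 0" for w
  proof -
    have "cmul (lyn_basis n u) (lyn_basis n v) w \<noteq> 0 \<or> cmul (lyn_basis n v) (lyn_basis n u) w \<noteq> 0"
      using that by (auto simp: eq split: if_splits)
    then show ?thesis using first second by blast
  qed
  ultimately show ?case by blast
qed

lemma lyn_wordsD: "h \<in> lyn_words d n \<Longrightarrow> lyndon h \<and> set h \<subseteq> {1..d} \<and> length h \<le> n"
  by (simp add: lyn_words_def)

text \<open>Evaluation at Lyndon words is a unitriangular system for the coordinates. It yields
  injectivity of \<open>lembed\<close> and, later, differentiability of the coordinates.\<close>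

lemma lembed_coord:
  assumes h: "h \<in> lyn_words d n"
  shows "lembed d n c h = c h + (\<Sum>g\<in>{g \<in> lyn_words d n. lex_less g h}. c g * lyn_basis n g h)"
proof -
  let ?S = "{g \<in> lyn_words d n. lex_less g h}"
  have zero: "lyn_basis n g h = 0" if "g \<in> lyn_words d n" "g \<notin> insert h ?S" for g
    using that lyn_basis_triangular[of g n] lyn_wordsD by fastforce
  have "lembed d n c h = (\<Sum>g\<in>insert h ?S. c g * lyn_basis n g h)"
    unfolding lembed_def
    by (rule sum.mono_neutral_right) (use h zero finite_lyn_words in auto)
  also have "\<dots> = c h * lyn_basis n h h + (\<Sum>g\<in>?S. c g * lyn_basis n g h)"
    by (rule sum.insert) (use lex_less_irrefl finite_lyn_words in auto)
  finally show ?thesis using lyn_basis_triangular[of h n] lyn_wordsD[OF h] by simp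
qed

text \<open>Lexicographic order on words is not well founded (\<open>[2]\<close>,
  \<open>[1,2]\<close>, \<open>[1,1,2]\<close>, ... descends forever), so the induction counts the
  finitely many Lyndon words below \<open>h\<close>.\<close>

lemma lyn_words_lex_induct [case_names less]:
  assumes "\<And>h. (\<And>g. g \<in> lyn_words d n \<Longrightarrow> lex_less g h \<Longrightarrow> P g) \<Longrightarrow> P h"
  shows "P h"
proof (induction "card {g \<in> lyn_words d n. lex_less g h}" arbitrary: h rule: less_induct)
  case less
  show ?case
  proof (rule assms)
    fix g assume g: "g \<in> lyn_words d n" "lex_less g h"
    have "{k \<in> lyn_words d n. lex_less k g} \<subset> {k \<in> lyn_words d n. lex_less k h}"
      using g lex_less_trans lex_less_irrefl by blast
    then show "P g" by (intro less.hyps psubset_card_mono) (auto simp: finite_lyn_words)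
  qed
qed

lemma lembed_inj:
  assumes "c \<in> cspace d n" "c' \<in> cspace d n" "lembed d n c = lembed d n c'"
  shows "c = c'"
proof
  fix h
  show "c h = c' h"
  proof (induction h rule: lyn_words_lex_induct[of d n])
    case (less h)
    show ?case
    proof (cases "h \<in> lyn_words d n")
      case True
      have "(\<Sum>g\<in>{g \<in> lyn_words d n. lex_less g h}. c g * lyn_basis n g h)
          = (\<Sum>g\<in>{g \<in> lyn_words d n. lex_less g h}. c' g * lyn_basis n g h)"
        by (rule sum.cong) (use less in auto)
      then show ?thesis
        using lembed_coord[OF True, of c] lembed_coord[OF True, of c'] assms(3) by simp
    next
      case False
      then show ?thesis using assms by (simp add: cspace_def)
    qed
  qed
qed

section \<open>Closure of the Lyndon span under brackets\<close>

inductive_set bspan :: "nat \<Rightarrow> nat list set \<Rightarrow> tensor set" for n H where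
  bspan_zero: "(\<lambda>w. 0) \<in> bspan n H"
| bspan_base: "h \<in> H \<Longrightarrow> lyn_basis n h \<in> bspan n H"
| bspan_add: "x \<in> bspan n H \<Longrightarrow> y \<in> bspan n H \<Longrightarrow> (\<lambda>w. x w + y w) \<in> bspan n H"
| bspan_scale: "x \<in> bspan n H \<Longrightarrow> (\<lambda>w. a * x w) \<in> bspan n H"

lemma bspan_mono: "x \<in> bspan n H \<Longrightarrow> H \<subseteq> H' \<Longrightarrow> x \<in> bspan n H'"
  by (induction rule: bspan.induct) (auto intro: bspan.intros)

lemma bspan_sum: "(\<And>k. k \<in> K \<Longrightarrow> f k \<in> bspan n H) \<Longrightarrow> (\<lambda>w. \<Sum>k\<in>K. f k w) \<in> bspan n H"
  by (induction K rule: infinite_finite_induct) (auto intro: bspan.intros)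

text \<open>Links the rule-based span, convenient for induction, with coordinate vectors, in terms
  of which \<open>act\<close> is defined.\<close>

lemma bspan_eq_lembed: "bspan n (lyn_words d n) = lembed d n ` cspace d n"
proof (intro equalityI subsetI)
  fix x assume "x \<in> bspan n (lyn_words d n)"
  then show "x \<in> lembed d n ` cspace d n"
  proof (induction rule: bspan.induct)
    case bspan_zero
    show ?case by (rule image_eqI[of _ _ "\<lambda>h. 0"]) (auto simp: lembed_def cspace_def)
  next
    case (bspan_base h)
    have "lyn_basis n h w = (\<Sum>g\<in>lyn_words d n. (if g = h then 1 else 0) * lyn_basis n g w)" for w
      by (simp add: sum_delta_mult[OF finite_lyn_words bspan_base])
    then show ?case using bspan_base
      by (intro image_eqI[of _ _ "\<lambda>g. if g = h then 1 else 0"]) (auto simp: lembed_def cspace_def)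
  next
    case (bspan_add x y)
    then obtain c c' where "x = lembed d n c" "c \<in> cspace d n" "y = lembed d n c'" "c' \<in> cspace d n"
      by blast
    then show ?case
      by (intro image_eqI[of _ _ "\<lambda>g. c g + c' g"])
        (auto simp: lembed_def cspace_def algebra_simps sum.distrib)
  next
    case (bspan_scale x a)
    then obtain c where "x = lembed d n c" "c \<in> cspace d n" by blast
    then show ?case
      by (intro image_eqI[of _ _ "\<lambda>g. a * c g"])
        (auto simp: lembed_def cspace_def sum_distrib_left mult.assoc)
  qed
next
  fix x assume "x \<in> lembed d n ` cspace d n"
  then obtain c where "x = (\<lambda>w. \<Sum>h\<in>lyn_words d n. c h * lyn_basis n h w)"
    by (auto simp: lembed_def)
  then show "x \<in> bspan n (lyn_words d n)"
    by (auto intro!: bspan_sum bspan.intros)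
qed

lemma tbracket_bspan_left:
  assumes "x \<in> bspan n H" "\<And>h. h \<in> H \<Longrightarrow> tbracket n (lyn_basis n h) y \<in> bspan n H'"
  shows "tbracket n x y \<in> bspan n H'"
  using assms(1)
  by (induction rule: bspan.induct)
    (auto simp: tbracket_zero_left tbracket_add_left tbracket_scale_left assms(2) intro: bspan.intros)

lemma tbracket_bspan_swap: "tbracket n x y \<in> bspan n H \<Longrightarrow> tbracket n y x \<in> bspan n H"
  by (subst tbracket_antisym) (rule bspan_scale)

text \<open>Induction on the total length and then on \<open>v\<close>: if \<open>u v\<close> is not the standard factorization, then
  \<open>u = u\<^sub>1 u\<^sub>2\<close> with \<open>u\<^sub>2 < v\<close>, and the Jacobi identity leads to brackets with smaller right factor.\<close>
lemma tbracket_lyn_basis_less: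
  assumes "u \<in> lyn_words d n" "v \<in> lyn_words d n" "length u + length v \<le> n" "lex_less u v"
  shows "tbracket n (lyn_basis n u) (lyn_basis n v)
    \<in> bspan n {w \<in> lyn_words d n. length w = length u + length v \<and> lex_less w v}"
  using assms
proof (induction "(u, v)" arbitrary: u v rule: wf_induct_rule[OF wf_measures[of
    "[\<lambda>(u, v). length u + length v, \<lambda>(u, v). card {w \<in> lyn_words d n. lex_less w v}]"]])
  case (1 u v)
  let ?b = "lyn_basis n"
  let ?H = "{w \<in> lyn_words d n. length w = length u + length v \<and> lex_less w v}"
  have u: "lyndon u" "set u \<subseteq> {1..d}" "u \<noteq> []" and v: "lyndon v" "set v \<subseteq> {1..d}" "v \<noteq> []"
    using 1 lyn_wordsD lyndon_nonempty by auto
  have IH_short: "tbracket n (?b u') (?b v') \<in> bspan n {w \<in> lyn_words d n. length w = length u' + length v' \<and> lex_less w v'}"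
    if "u' \<in> lyn_words d n" "v' \<in> lyn_words d n" "length u' + length v' < length u + length v" "lex_less u' v'" for u' v'
    using that 1(4) by (intro 1(1)) auto
  \<comment> \<open>Total length is unchanged and both words lie below \<open>v\<close>. Their
    mutual order is unknown, but after a possible swap the right-hand word is still below
    \<open>v\<close>, so the number of Lyndon words below it drops.\<close>
  have IH_small: "tbracket n (?b u') (?b v') \<in> bspan n ?H"
    if *: "u' \<in> lyn_words d n" "v' \<in> lyn_words d n" "length u' + length v' = length u + length v"
      "lex_less u' v" "lex_less v' v" for u' v'
  proof -
    have small: "tbracket n (?b x) (?b y) \<in> bspan n ?H"
      if xy: "x \<in> lyn_words d n" "y \<in> lyn_words d n" "length x + length y = length u + length v"
        "lex_less y v" "lex_less x y" for x y
    proof -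
      have "{w \<in> lyn_words d n. lex_less w y} \<subset> {w \<in> lyn_words d n. lex_less w v}"
        using xy lex_less_trans lex_less_irrefl by blast
      then have "card {w \<in> lyn_words d n. lex_less w y} < card {w \<in> lyn_words d n. lex_less w v}"
        by (intro psubset_card_mono) (auto simp: finite_lyn_words)
      then have "tbracket n (?b x) (?b y) \<in> bspan n {w \<in> lyn_words d n. length w = length x + length y \<and> lex_less w y}"
        using xy 1(4) by (intro 1(1)) auto
      then show ?thesis
        by (rule bspan_mono) (use xy lex_less_trans in auto)
    qed
    consider "lex_less u' v'" | "u' = v'" | "lex_less v' u'" using lex_less_linear by blast
    then show ?thesis
    proof cases
      case 1 then show ?thesis using small * by blast
    next
      case 2 then show ?thesis by (simp add: tbracket_self bspan_zero)
    next
      case 3 then show ?thesis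
        using small[of v' u'] * tbracket_bspan_swap by (simp add: add.commute)
    qed
  qed
  show ?case
  proof (cases "length u = 1 \<or> (\<exists>u1 u2. u = u1 @ u2 \<and> std_split u = length u1 \<and> \<not> lex_less u2 v)")
    case True
    have "?b (u @ v) = tbracket n (?b u) (?b v)"
      using std_split_append[OF u(1) v(1) True] u v by (intro lyn_basis_append) auto
    moreover have "u @ v \<in> ?H"
      using lyndon_append[OF u(1) v(1)] lyndon_append_less[OF v(1) _ u(3)] u v 1 by (auto simp: lyn_words_def)
    ultimately show ?thesis using bspan_base by metis
  next
    case False
    then have "2 \<le> length u" using u(3) by (cases u) (auto simp: Suc_le_eq)
    from u(1) this show ?thesis
    proof (rule std_factorE)
      fix u1 u2 assume split: "u = u1 @ u2" "std_split u = length u1" "lyndon u1" "lyndon u2" "lex_less u1 u2"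
      have ne: "u1 \<noteq> []" "u2 \<noteq> []" using split lyndon_nonempty by auto
      have u2v: "lex_less u2 v" using False split by blast
      have u1v: "lex_less u1 v" using split u2v lex_less_trans by blast
      have W: "u1 \<in> lyn_words d n" "u2 \<in> lyn_words d n"
        using split u 1(4) by (auto simp: lyn_words_def)
      have bu: "?b u = tbracket n (?b u1) (?b u2)"
        using split lyn_basis_append ne by metis
      \<comment> \<open>The inner bracket has smaller total length and expands in words below
        \<open>v\<close>; bracketing with \<open>u2 < v\<close> restores the length with both
        entries below \<open>v\<close>.\<close>
      have A: "tbracket n (tbracket n (?b u1) (?b v)) (?b u2) \<in> bspan n ?H"
      proof (rule tbracket_bspan_left)
        show "tbracket n (?b u1) (?b v) \<in> bspan n {w \<in> lyn_words d n. length w = length u1 + length v \<and> lex_less w v}"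
          using W 1 ne u1v split by (intro IH_short) auto
      next
        fix w assume "w \<in> {w \<in> lyn_words d n. length w = length u1 + length v \<and> lex_less w v}"
        then show "tbracket n (?b w) (?b u2) \<in> bspan n ?H"
          using W u2v split by (intro IH_small) auto
      qed
      have B: "tbracket n (tbracket n (?b u2) (?b v)) (?b u1) \<in> bspan n ?H"
      proof (rule tbracket_bspan_left)
        show "tbracket n (?b u2) (?b v) \<in> bspan n {w \<in> lyn_words d n. length w = length u2 + length v \<and> lex_less w v}"
          using W 1 ne u2v split by (intro IH_short) auto
      next
        fix w assume "w \<in> {w \<in> lyn_words d n. length w = length u2 + length v \<and> lex_less w v}"
        then show "tbracket n (?b w) (?b u1) \<in> bspan n ?H"
          using W u1v split by (intro IH_small) auto
      qed
      show ?thesis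
        unfolding bu tbracket_jacobi[of n "?b u1" "?b u2"]
        by (rule bspan_add[OF A tbracket_bspan_swap[OF B]])
    qed
  qed
qed

lemma tbracket_lyn_basis_bspan:
  assumes "u \<in> lyn_words d n" "v \<in> lyn_words d n"
  shows "tbracket n (lyn_basis n u) (lyn_basis n v) \<in> bspan n (lyn_words d n)"
proof (cases "length u + length v \<le> n")
  case True
  have less: "tbracket n (lyn_basis n x) (lyn_basis n y) \<in> bspan n (lyn_words d n)"
    if "x \<in> lyn_words d n" "y \<in> lyn_words d n" "length x + length y \<le> n" "lex_less x y" for x y
    by (rule bspan_mono[OF tbracket_lyn_basis_less[OF that]]) auto
  consider "lex_less u v" | "u = v" | "lex_less v u" using lex_less_linear by blast
  then show ?thesis
  proof cases
    case 1 then show ?thesis using less assms True by blast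
  next
    case 2 then show ?thesis by (simp add: tbracket_self bspan_zero)
  next
    case 3 then show ?thesis
      using less[of v u] assms True tbracket_bspan_swap by (simp add: add.commute)
  qed
next
  case False
  have "tbracket n (lyn_basis n u) (lyn_basis n v) = (\<lambda>w. 0)"
    using False assms lyn_wordsD
    by (intro ext) (auto simp: tbracket_eq_cmul cmul_lyn_basis)
  then show ?thesis by (simp add: bspan_zero)
qed

lemma tbracket_bspan:
  assumes "x \<in> bspan n (lyn_words d n)" "y \<in> bspan n (lyn_words d n)"
  shows "tbracket n x y \<in> bspan n (lyn_words d n)"
proof (rule tbracket_bspan_left[OF assms(1)])
  fix h assume h: "h \<in> lyn_words d n"
  show "tbracket n (lyn_basis n h) y \<in> bspan n (lyn_words d n)"
    by (rule tbracket_bspan_swap, rule tbracket_bspan_left[OF assms(2)])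
      (rule tbracket_lyn_basis_bspan[OF _ h])
qed

section \<open>The group action in Lyndon coordinates\<close>

definition msupp :: "nat \<Rightarrow> (nat \<Rightarrow> nat \<Rightarrow> 'a::zero) \<Rightarrow> bool" where
  "msupp d A \<longleftrightarrow> (\<forall>i j. A i j \<noteq> 0 \<longrightarrow> i \<in> {1..d} \<and> j \<in> {1..d})"

lemma tact_letter:
  assumes "msupp d A" "i \<in> {1..d}"
  shows "tact d A (letter i) = (\<lambda>w. \<Sum>j=1..d. A j i * letter j w)"
proof
  fix w
  show "tact d A (letter i) w = (\<Sum>j=1..d. A j i * letter j w)"
  proof (cases "length w = 1")
    case True
    then obtain a where w: "w = [a]" by (auto simp: length_Suc_conv)
    have "tact d A (letter i) w = (\<Sum>k=1..d. if k = i then A a i else 0)"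
      unfolding w tact_Cons by (rule sum.cong) (auto simp: letter_def)
    also have "\<dots> = A a i" using assms(2) by simp
    also have "\<dots> = (\<Sum>j=1..d. if j = a then A a i else 0)"
      using assms(1) by (auto simp: msupp_def sum.delta)
    also have "\<dots> = (\<Sum>j=1..d. A j i * letter j w)"
      by (rule sum.cong) (auto simp: w letter_def)
    finally show ?thesis .
  next
    case False
    then have "tact d A (letter i) w = tact d A (\<lambda>u. 0) w"
      by (intro tact_cong) (auto simp: letter_def)
    moreover have "letter j w = 0" for j using False by (auto simp: letter_def)
    ultimately show ?thesis by (simp add: tact_zero)
  qed
qed

text \<open>The support condition keeps images of letters inside \<open>{1..d}\<close>; longer words
  follow because the substitution respects brackets and the span is closed under them.\<close>

lemma tact_lyn_basis_bspan:
  assumes "msupp d A" "lyndon h" "set h \<subseteq> {1..d}" "length h \<le> n"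
  shows "tact d A (lyn_basis n h) \<in> bspan n (lyn_words d n)"
  using assms(2,3,4)
proof (induction h rule: lyndon_induct)
  case (letter a)
  have "(\<lambda>w. A j a * letter j w) \<in> bspan n (lyn_words d n)" if "j \<in> {1..d}" for j
    using that letter lyndon_letter[of j] bspan_base[of "[j]" "lyn_words d n" n]
    by (intro bspan_scale) (auto simp: lyn_words_def lyn_basis_letter)
  then show ?case using letter by (auto simp: lyn_basis_letter tact_letter[OF assms(1)] intro!: bspan_sum)
next
  case (append u v)
  then have "lyn_basis n (u @ v) = tbracket n (lyn_basis n u) (lyn_basis n v)"
    using lyndon_nonempty by (intro lyn_basis_append) auto
  then show ?case using append by (auto simp: tact_tbracket intro!: tbracket_bspan)
qed

lemma tact_lembed_bspan:
  assumes "msupp d A"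
  shows "tact d A (lembed d n c) \<in> bspan n (lyn_words d n)"
proof -
  have "tact d A (lembed d n c) = (\<lambda>w. \<Sum>h\<in>lyn_words d n. c h * tact d A (lyn_basis n h) w)"
    unfolding lembed_def by (rule ext) (simp add: tact_sum tact_scale)
  also have "\<dots> \<in> bspan n (lyn_words d n)"
    using lyn_wordsD by (intro bspan_sum bspan_scale tact_lyn_basis_bspan[OF assms]) auto
  finally show ?thesis .
qed

text \<open>Existence comes from closure of the span under the substitution and uniqueness from
  \<open>lembed_inj\<close>, so the definite description in \<open>act\<close> denotes.\<close>

lemma act_spec:
  assumes "msupp d A"
  shows "act d n A c \<in> cspace d n" "lembed d n (act d n A c) = tact d A (lembed d n c)"
proof -
  obtain c' where c': "c' \<in> cspace d n" "lembed d n c' = tact d A (lembed d n c)"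
    using tact_lembed_bspan[OF assms] unfolding bspan_eq_lembed by (metis imageE)
  have "act d n A c \<in> cspace d n \<and> lembed d n (act d n A c) = tact d A (lembed d n c)"
    unfolding act_def by (rule theI[of _ c']) (use c' lembed_inj in auto)
  then show "act d n A c \<in> cspace d n" "lembed d n (act d n A c) = tact d A (lembed d n c)" by auto
qed

lemma act_eqI:
  assumes "msupp d A" "c' \<in> cspace d n" "lembed d n c' = tact d A (lembed d n c)"
  shows "act d n A c = c'"
  using act_spec[OF assms(1)] assms lembed_inj by metis

lemma msupp_mmul: "msupp d A \<Longrightarrow> msupp d B \<Longrightarrow> msupp d (mmul d A B)"
  unfolding msupp_def mmul_def
  by (metis (no_types, lifting) mult_eq_0_iff sum.neutral)

lemma act_mmul:
  assumes "msupp d A" "msupp d B"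
  shows "act d n A (act d n B c) = act d n (mmul d A B) c"
  by (rule act_eqI[OF assms(1)])
    (simp_all add: act_spec msupp_mmul assms tact_mmul[abs_def, symmetric] fun_eq_iff)

lemma lembed_set: "lembed d n c w \<noteq> 0 \<Longrightarrow> set w \<subseteq> {1..d}"
proof -
  assume "lembed d n c w \<noteq> 0"
  then obtain h where "h \<in> lyn_words d n" "lyn_basis n h w \<noteq> 0"
    unfolding lembed_def by (metis (no_types, lifting) mult_eq_0_iff sum.neutral)
  then show ?thesis using lyn_basis_length_set lyn_wordsD by blast
qed

lemma msupp_idm: "msupp d (idm d)"
  by (auto simp: msupp_def idm_def)

lemma act_idm: "c \<in> cspace d n \<Longrightarrow> act d n (idm d) c = c"
  by (rule act_eqI[OF msupp_idm]) (auto simp: tact_idm[OF lembed_set])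

definition unit_coord :: "nat list \<Rightarrow> nat list \<Rightarrow> real" where
  "unit_coord g = (\<lambda>h. if h = g then 1 else 0)"

lemma lembed_unit_coord: "g \<in> lyn_words d n \<Longrightarrow> lembed d n (unit_coord g) = lyn_basis n g"
  unfolding lembed_def unit_coord_def
  by (rule ext) (simp add: sum_delta_mult finite_lyn_words)

text \<open>Linearity in matrix form, with coefficients depending on \<open>A\<close> alone. This is
  what makes the product rule applicable when both the group element and the point move.\<close>

lemma act_expand:
  assumes "msupp d A" "c \<in> cspace d n"
  shows "act d n A c = (\<lambda>h. \<Sum>g\<in>lyn_words d n. act d n A (unit_coord g) h * c g)"
proof (rule act_eqI[OF assms(1)])
  show "(\<lambda>h. \<Sum>g\<in>lyn_words d n. act d n A (unit_coord g) h * c g) \<in> cspace d n"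
    using act_spec(1)[OF assms(1), of n] by (auto simp: cspace_def)
  show "lembed d n (\<lambda>h. \<Sum>g\<in>lyn_words d n. act d n A (unit_coord g) h * c g) = tact d A (lembed d n c)"
  proof
    fix w
    have "lembed d n (\<lambda>h. \<Sum>g\<in>lyn_words d n. act d n A (unit_coord g) h * c g) w
        = (\<Sum>g\<in>lyn_words d n. c g * lembed d n (act d n A (unit_coord g)) w)"
      unfolding lembed_def sum_distrib_left sum_distrib_right
      by (subst sum.swap) (simp add: algebra_simps)
    also have "\<dots> = (\<Sum>g\<in>lyn_words d n. c g * tact d A (lyn_basis n g) w)"
      by (rule sum.cong) (auto simp: act_spec(2)[OF assms(1)] lembed_unit_coord)
    also have "\<dots> = tact d A (lembed d n c) w"
      unfolding lembed_def by (simp add: tact_sum tact_scale)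
    finally show "lembed d n (\<lambda>h. \<Sum>g\<in>lyn_words d n. act d n A (unit_coord g) h * c g) w = tact d A (lembed d n c) w" .
  qed
qed

section \<open>Smooth functions of finitely many coordinates\<close>

text \<open>Nearness is measured only in the coordinates from \<open>I\<close>. Packaged as a
  filter, it lets continuity inherit the limit rules for sums, products and square roots.\<close>

definition fsp_filter :: "'i set \<Rightarrow> ('i \<Rightarrow> real) set \<Rightarrow> ('i \<Rightarrow> real) \<Rightarrow> ('i \<Rightarrow> real) filter" where
  "fsp_filter I S x = (INF e\<in>{0<..}. principal {y \<in> S. \<forall>i\<in>I. \<bar>y i - x i\<bar> < e})"

lemma eventually_fsp_filter:
  "eventually P (fsp_filter I S x) \<longleftrightarrow> (\<exists>e>0. \<forall>y\<in>S. (\<forall>i\<in>I. \<bar>y i - x i\<bar> < e) \<longrightarrow> P y)"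
proof -
  have "eventually P (fsp_filter I S x)
      \<longleftrightarrow> (\<exists>e\<in>{0<..}. eventually P (principal {y \<in> S. \<forall>i\<in>I. \<bar>y i - x i\<bar> < e}))"
    unfolding fsp_filter_def
  proof (rule eventually_INF_base)
    fix a b :: real assume "a \<in> {0<..}" "b \<in> {0<..}"
    then show "\<exists>c\<in>{0<..}. principal {y \<in> S. \<forall>i\<in>I. \<bar>y i - x i\<bar> < c}
        \<le> inf (principal {y \<in> S. \<forall>i\<in>I. \<bar>y i - x i\<bar> < a}) (principal {y \<in> S. \<forall>i\<in>I. \<bar>y i - x i\<bar> < b})"
      by (intro bexI[of _ "min a b"]) auto
  qed auto
  also have "\<dots> \<longleftrightarrow> (\<exists>e>0. \<forall>y\<in>S. (\<forall>i\<in>I. \<bar>y i - x i\<bar> < e) \<longrightarrow> P y)"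
    unfolding eventually_principal Bex_def greaterThan_iff by blast
  finally show ?thesis .
qed

lemma cont_on_fsp_tendsto: "cont_on_fsp I S f \<longleftrightarrow> (\<forall>x\<in>S. (f \<longlongrightarrow> f x) (fsp_filter I S x))"
  by (simp add: cont_on_fsp_def tendsto_iff eventually_fsp_filter dist_real_def)

text \<open>\<open>Ck\<close> differentiates innermost first; unlike iterated \<^const>\<open>ipd\<close> this allows induction with the product rule.\<close>
fun Ck :: "nat \<Rightarrow> 'i set \<Rightarrow> ('i \<Rightarrow> real) set \<Rightarrow> (('i \<Rightarrow> real) \<Rightarrow> real) \<Rightarrow> bool" where
  "Ck 0 I S f \<longleftrightarrow> cont_on_fsp I S f"
| "Ck (Suc k) I S f \<longleftrightarrow> cont_on_fsp I S f \<and>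
    (\<forall>i\<in>I. (\<forall>x\<in>S. (\<lambda>t. f (x(i := x i + t))) differentiable (at 0)) \<and> Ck k I S (pd i f))"

lemma Ck_cont: "Ck k I S f \<Longrightarrow> cont_on_fsp I S f"
  by (cases k) auto

lemma Ck_Suc_D: "Ck (Suc k) I S f \<Longrightarrow> Ck k I S f"
  by (induction k arbitrary: f) (auto dest: Ck_cont)

text \<open>Having all orders at once makes the hypothesis stable under \<open>pd\<close>, since
  each partial derivative costs one order; hence it is stable under every
  \<open>ipd ds\<close>.\<close>

lemma smooth_on_fspI:
  assumes "\<And>k. Ck k I S f"
  shows "smooth_on_fsp I S f"
proof -
  have *: "\<forall>k. Ck k I S (ipd ds f)" if "set ds \<subseteq> I" for ds
    using that
  proof (induction ds)
    case (Cons i ds)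
    then have "Ck (Suc k) I S (ipd ds f)" for k by auto
    then show ?case using Cons.prems by auto
  qed (use assms in simp)
  show ?thesis
    unfolding smooth_on_fsp_def
  proof (intro allI impI)
    fix ds assume "set ds \<subseteq> I"
    from *[OF this] have "Ck (Suc 0) I S (ipd ds f)" by blast
    then show "cont_on_fsp I S (ipd ds f) \<and>
      (\<forall>x\<in>S. \<forall>i\<in>I. (\<lambda>t. ipd ds f (x(i := x i + t))) differentiable (at 0))" by auto
  qed
qed

lemma cont_on_fsp_subset: "cont_on_fsp I S f \<Longrightarrow> T \<subseteq> S \<Longrightarrow> cont_on_fsp I T f"
  unfolding cont_on_fsp_def by (meson subsetD)

lemma Ck_subset: "Ck k I S f \<Longrightarrow> T \<subseteq> S \<Longrightarrow> Ck k I T f"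
  by (induction k arbitrary: f) (auto intro: cont_on_fsp_subset)

lemma open_fsp_line:
  assumes "open_fsp I S" "x \<in> S" "i \<in> I"
  shows "eventually (\<lambda>t. x(i := x i + t) \<in> S) (nhds 0)"
proof -
  obtain e where e: "e > 0" "\<And>y. y \<in> fsp I \<Longrightarrow> (\<forall>i\<in>I. \<bar>y i - x i\<bar> < e) \<Longrightarrow> y \<in> S"
    using assms unfolding open_fsp_def by blast
  have "x \<in> fsp I" using assms unfolding open_fsp_def by blast
  then have "x(i := x i + t) \<in> S" if "dist t 0 < e" for t
    using e(1) that assms(3) by (intro e(2)) (auto simp: fsp_def)
  then show "eventually (\<lambda>t. x(i := x i + t) \<in> S) (nhds 0)"
    using e(1) unfolding eventually_nhds_metric by blast
qed

definition has_pd :: "'i \<Rightarrow> (('i \<Rightarrow> real) \<Rightarrow> real) \<Rightarrow> ('i \<Rightarrow> real) \<Rightarrow> real \<Rightarrow> bool" where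
  "has_pd i f x D \<longleftrightarrow> ((\<lambda>t. f (x(i := x i + t))) has_real_derivative D) (at 0)"

lemma has_pd_imp_pd: "has_pd i f x D \<Longrightarrow> pd i f x = D"
  unfolding pd_def has_pd_def by (rule the_equality) (auto dest: DERIV_unique)

lemma differentiable_imp_has_pd:
  "(\<lambda>t. f (x(i := x i + t))) differentiable (at 0) \<Longrightarrow> has_pd i f x (pd i f x)"
  by (metis has_pd_def has_pd_imp_pd real_differentiable_def)

text \<open>The congruence rule appears as a hypothesis because its own proof \<open>Ck_cong\<close>
  uses this lemma, with the rule supplied at lower order by induction. It is discharged afterwards
  in \<open>Ck_SucI'\<close>.\<close>

lemma Ck_SucI:
  assumes "open_fsp I S" "cont_on_fsp I S f"
    and pd: "\<And>i x. i \<in> I \<Longrightarrow> x \<in> S \<Longrightarrow> has_pd i f x (g i x)"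
    and ck: "\<And>i. i \<in> I \<Longrightarrow> Ck k I S (g i)"
    and cong: "\<And>f g. (\<And>x. x \<in> S \<Longrightarrow> f x = g x) \<Longrightarrow> Ck k I S f \<Longrightarrow> Ck k I S g"
  shows "Ck (Suc k) I S f"
proof -
  have "Ck k I S (pd i f)" if "i \<in> I" for i
    by (rule cong[OF _ ck[OF that]]) (simp add: has_pd_imp_pd[OF pd[OF that]])
  then show ?thesis
    using assms(2) pd by (auto simp: has_pd_def real_differentiable_def)
qed

text \<open>Openness matters because a partial derivative looks at nearby points of a coordinate
  line, where the two functions must still agree.\<close>

lemma Ck_cong:
  assumes S: "open_fsp I S" and eq: "\<And>x. x \<in> S \<Longrightarrow> f x = g x" and f: "Ck k I S f"
  shows "Ck k I S g"
  using eq f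
proof (induction k arbitrary: f g)
  case 0
  then show ?case by (auto simp: cont_on_fsp_def)
next
  case (Suc k)
  have cont: "cont_on_fsp I S g" using Suc.prems by (auto simp: cont_on_fsp_def)
  show ?case
  proof (rule Ck_SucI[OF S cont, of "\<lambda>i. pd i f"])
    fix i x assume ix: "i \<in> I" "x \<in> S"
    have "has_pd i f x (pd i f x)" using Suc.prems(2) ix by (intro differentiable_imp_has_pd) auto
    then show "has_pd i g x (pd i f x)"
      unfolding has_pd_def
      by (subst DERIV_cong_ev[OF refl _ refl, of _ "\<lambda>t. f (x(i := x i + t))"])
        (use open_fsp_line[OF S ix(2,1)] Suc.prems(1) in \<open>auto elim!: eventually_mono simp del: fun_upd_apply\<close>)
  qed (use Suc in auto)
qed

lemmas Ck_SucI' = Ck_SucI[OF _ _ _ _ Ck_cong]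

lemma Ck_has_pd: "Ck (Suc k) I S f \<Longrightarrow> i \<in> I \<Longrightarrow> x \<in> S \<Longrightarrow> has_pd i f x (pd i f x)"
  by (intro differentiable_imp_has_pd) auto

lemma Ck_const: "open_fsp I S \<Longrightarrow> Ck k I S (\<lambda>x. a)"
proof (induction k arbitrary: a)
  case 0 then show ?case by (simp add: cont_on_fsp_tendsto)
next
  case (Suc k)
  show ?case
    by (rule Ck_SucI'[of I S _ "\<lambda>i x. 0"])
      (use Suc in \<open>auto simp: cont_on_fsp_tendsto has_pd_def\<close>)
qed

lemma cont_on_fsp_coord: "j \<in> I \<Longrightarrow> cont_on_fsp I S (\<lambda>x. x j)"
  unfolding cont_on_fsp_def by blast

lemma Ck_coord:
  assumes "open_fsp I S" "j \<in> I"
  shows "Ck k I S (\<lambda>x. x j)"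
proof (cases k)
  case 0 then show ?thesis using assms by (simp add: cont_on_fsp_coord)
next
  case (Suc m)
  have "((\<lambda>t. (x(i := x i + t)) j) has_real_derivative (if i = j then 1 else 0)) (at 0)" for i x
    by (auto intro!: derivative_eq_intros)
  then show ?thesis unfolding Suc
    by (intro Ck_SucI'[of I S _ "\<lambda>i x. if i = j then 1 else 0"] Ck_const cont_on_fsp_coord assms)
      (auto simp: has_pd_def assms)
qed

lemma Ck_add:
  assumes S: "open_fsp I S" and "Ck k I S f" "Ck k I S g"
  shows "Ck k I S (\<lambda>x. f x + g x)"
  using assms(2,3)
proof (induction k arbitrary: f g)
  case 0
  then show ?case by (auto simp: cont_on_fsp_tendsto intro!: tendsto_add)
next
  case (Suc k)
  show ?case
  proof (rule Ck_SucI'[OF S, of _ "\<lambda>i x. pd i f x + pd i g x"])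
    show "cont_on_fsp I S (\<lambda>x. f x + g x)"
      using Suc.prems by (auto simp: cont_on_fsp_tendsto intro!: tendsto_add)
    show "has_pd i (\<lambda>x. f x + g x) x (pd i f x + pd i g x)" if "i \<in> I" "x \<in> S" for i x
      using Ck_has_pd[OF Suc.prems(1) that] Ck_has_pd[OF Suc.prems(2) that]
      unfolding has_pd_def by (rule DERIV_add)
  qed (use Suc S in auto)
qed

lemma Ck_mult:
  assumes S: "open_fsp I S" and "Ck k I S f" "Ck k I S g"
  shows "Ck k I S (\<lambda>x. f x * g x)"
  using assms(2,3)
proof (induction k arbitrary: f g)
  case 0
  then show ?case by (auto simp: cont_on_fsp_tendsto intro!: tendsto_mult)
next
  case (Suc k)
  show ?case
  proof (rule Ck_SucI'[OF S, of _ "\<lambda>i x. pd i f x * g x + pd i g x * f x"])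
    show "cont_on_fsp I S (\<lambda>x. f x * g x)"
      using Suc.prems by (auto simp: cont_on_fsp_tendsto intro!: tendsto_mult)
    show "has_pd i (\<lambda>x. f x * g x) x (pd i f x * g x + pd i g x * f x)" if "i \<in> I" "x \<in> S" for i x
      using DERIV_mult[OF Ck_has_pd[OF Suc.prems(1) that, unfolded has_pd_def]
          Ck_has_pd[OF Suc.prems(2) that, unfolded has_pd_def]]
      unfolding has_pd_def by simp
    show "Ck k I S (\<lambda>x. pd i f x * g x + pd i g x * f x)" if "i \<in> I" for i
      using Suc.prems that Ck_Suc_D[OF Suc.prems(1)] Ck_Suc_D[OF Suc.prems(2)]
      by (intro Ck_add[OF S] Suc.IH) auto
  qed (use S in auto)
qed

lemma Ck_sum:
  assumes S: "open_fsp I S" and "\<And>a. a \<in> T \<Longrightarrow> Ck k I S (f a)"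
  shows "Ck k I S (\<lambda>x. \<Sum>a\<in>T. f a x)"
  using assms(2) by (induction T rule: infinite_finite_induct) (auto intro: Ck_const[OF S] Ck_add[OF S])

lemma cont_rsqrt:
  assumes "cont_on_fsp I S f" "\<And>x. x \<in> S \<Longrightarrow> f x > 0"
  shows "cont_on_fsp I S (\<lambda>x. 1 / sqrt (f x))"
  unfolding cont_on_fsp_tendsto
proof
  fix x assume x: "x \<in> S"
  have "(f \<longlongrightarrow> f x) (fsp_filter I S x)" using assms(1) x by (simp add: cont_on_fsp_tendsto)
  moreover have "sqrt (f x) \<noteq> 0" using assms(2)[OF x] by simp
  ultimately show "((\<lambda>x. 1 / sqrt (f x)) \<longlongrightarrow> 1 / sqrt (f x)) (fsp_filter I S x)"
    by (intro tendsto_divide tendsto_const tendsto_real_sqrt)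
qed

text \<open>With g = 1 / sqrt f the derivative is -1/2 f' g^3, a product of f' and copies of g
  itself, so the induction on the order closes under \<open>Ck_mult\<close>.\<close>

lemma Ck_rsqrt:
  assumes S: "open_fsp I S" and "Ck k I S f" "\<And>x. x \<in> S \<Longrightarrow> f x > 0"
  shows "Ck k I S (\<lambda>x. 1 / sqrt (f x))"
  using assms(2)
proof (induction k)
  case 0
  then show ?case using cont_rsqrt[OF _ assms(3)] by simp
next
  case (Suc k)
  let ?g = "\<lambda>x. 1 / sqrt (f x)"
  show ?case
  proof (rule Ck_SucI'[OF S, of _ "\<lambda>i x. (-1/2) * pd i f x * (?g x * (?g x * ?g x))"])
    show "cont_on_fsp I S ?g"
      using cont_rsqrt[OF Ck_cont[OF Suc.prems] assms(3)] by simp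
    show "has_pd i ?g x ((-1/2) * pd i f x * (?g x * (?g x * ?g x)))" if "i \<in> I" "x \<in> S" for i x
    proof -
      have cube: "- (a * (b * (a / 2)) * a) = (-1/2) * b * (a * (a * a))" for a b :: real by simp
      have pos: "f x > 0" using assms(3) that by blast
      have "((\<lambda>t. inverse (sqrt (f (x(i := x i + t))))) has_real_derivative
          - (inverse (sqrt (f x)) * (pd i f x * (inverse (sqrt (f x)) / 2)) * inverse (sqrt (f x)))) (at 0)"
        using pos DERIV_inverse'[OF DERIV_chain2[OF DERIV_real_sqrt Ck_has_pd[OF Suc.prems that, unfolded has_pd_def]]]
        by (simp add: algebra_simps)
      then show ?thesis unfolding has_pd_def inverse_eq_divide
        by (rule DERIV_cong) (rule cube)
    qed
    show "Ck k I S (\<lambda>x. (-1/2) * pd i f x * (?g x * (?g x * ?g x)))" if "i \<in> I" for i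
      using Suc.prems that Suc.IH[OF Ck_Suc_D[OF Suc.prems]]
      by (intro Ck_mult[OF S] Ck_const[OF S]) auto
  qed (use S in auto)
qed

lemma open_fsp_UNIV: "open_fsp I (fsp I)"
  unfolding open_fsp_def by (auto intro: exI[of _ 1])

lemma open_fsp_Int:
  assumes "open_fsp I S" "open_fsp I T"
  shows "open_fsp I (S \<inter> T)"
  unfolding open_fsp_def
proof (intro conjI ballI)
  show "S \<inter> T \<subseteq> fsp I" using assms by (auto simp: open_fsp_def)
  fix x assume "x \<in> S \<inter> T"
  then obtain a b where "a > 0" "\<forall>y\<in>fsp I. (\<forall>i\<in>I. \<bar>y i - x i\<bar> < a) \<longrightarrow> y \<in> S"
    "b > 0" "\<forall>y\<in>fsp I. (\<forall>i\<in>I. \<bar>y i - x i\<bar> < b) \<longrightarrow> y \<in> T"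
    using assms unfolding open_fsp_def by (metis IntE)
  then show "\<exists>e>0. \<forall>y\<in>fsp I. (\<forall>i\<in>I. \<bar>y i - x i\<bar> < e) \<longrightarrow> y \<in> S \<inter> T"
    by (intro exI[of _ "min a b"]) auto
qed

lemma open_fsp_positive:
  assumes "cont_on_fsp I (fsp I) f"
  shows "open_fsp I {x \<in> fsp I. f x > 0}"
  unfolding open_fsp_def
proof (intro conjI ballI)
  fix x assume x: "x \<in> {x \<in> fsp I. f x > 0}"
  then obtain \<delta> where "\<delta> > 0" "\<forall>y\<in>fsp I. (\<forall>i\<in>I. \<bar>y i - x i\<bar> < \<delta>) \<longrightarrow> \<bar>f y - f x\<bar> < f x"
    using assms unfolding cont_on_fsp_def by blast
  then show "\<exists>e>0. \<forall>y\<in>fsp I. (\<forall>i\<in>I. \<bar>y i - x i\<bar> < e) \<longrightarrow> y \<in> {x \<in> fsp I. f x > 0}"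
    by (intro exI[of _ \<delta>]) fastforce
qed auto

lemma open_fsp_finite_positive:
  assumes "finite J" "\<And>j. j \<in> J \<Longrightarrow> cont_on_fsp I (fsp I) (f j)"
  shows "open_fsp I {x \<in> fsp I. \<forall>j\<in>J. f j x > 0}"
  using assms
proof (induction J rule: finite_induct)
  case empty then show ?case by (simp add: open_fsp_UNIV)
next
  case (insert j J)
  have "{x \<in> fsp I. \<forall>j\<in>insert j J. f j x > 0} = {x \<in> fsp I. f j x > 0} \<inter> {x \<in> fsp I. \<forall>j\<in>J. f j x > 0}"
    by auto
  then show ?case using insert by (auto intro!: open_fsp_Int open_fsp_positive)
qed

section \<open>Orthogonal matrices and the orthogonalised sequence\<close>

definition orth :: "nat \<Rightarrow> (nat \<Rightarrow> nat \<Rightarrow> 'a::comm_ring_1) \<Rightarrow> bool" where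
  "orth d A \<longleftrightarrow> msupp d A \<and>
    (\<forall>i\<in>{1..d}. \<forall>j\<in>{1..d}. (\<Sum>k=1..d. A i k * A j k) = (if i = j then 1 else 0))"

lemma Od_iff_orth: "A \<in> Od d \<longleftrightarrow> orth d A"
  by (simp add: Od_def orth_def msupp_def)

lemma OdC_iff_orth: "A \<in> OdC d \<longleftrightarrow> orth d A"
  by (simp add: OdC_def orth_def msupp_def)

lemma sum_atLeast1_shift: "(\<Sum>k=1..d. f k) = (\<Sum>k<d. f (Suc k))" for f :: "nat \<Rightarrow> 'a::comm_monoid_add"
  by (simp add: sum.atLeast1_atMost_eq lessThan_atLeast0)

text \<open>A one-sided inverse of a square matrix is two-sided. The shifts by \<open>Suc\<close>
  translate between indices \<open>1..d\<close> and zero-based matrix entries.\<close>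

lemma orth_columns:
  fixes A :: "nat \<Rightarrow> nat \<Rightarrow> 'a::field"
  assumes "orth d A" "i \<in> {1..d}" "j \<in> {1..d}"
  shows "(\<Sum>k=1..d. A k i * A k j) = (if i = j then 1 else 0)"
proof -
  define M where "M = Matrix.mat d d (\<lambda>(i, j). A (Suc i) (Suc j))"
  define N where "N = Matrix.mat d d (\<lambda>(i, j). A (Suc j) (Suc i))"
  have carrier: "M \<in> carrier_mat d d" "N \<in> carrier_mat d d" by (auto simp: M_def N_def)
  have "M * N = 1\<^sub>m d"
  proof (rule eq_matI)
    fix i j assume "i < dim_row (1\<^sub>m d)" "j < dim_col (1\<^sub>m d)"
    then have ij: "i < d" "j < d" by auto
    then have "(M * N) $$ (i, j) = (\<Sum>k<d. A (Suc i) (Suc k) * A (Suc j) (Suc k))"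
      by (auto simp: M_def N_def scalar_prod_def lessThan_atLeast0 intro!: sum.cong)
    also have "\<dots> = (if i = j then 1 else 0)"
      using assms(1) ij unfolding orth_def sum_atLeast1_shift by auto
    finally show "(M * N) $$ (i, j) = 1\<^sub>m d $$ (i, j)" using ij by simp
  qed (auto simp: M_def N_def)
  then have NM: "N * M = 1\<^sub>m d" using mat_mult_left_right_inverse carrier by blast
  obtain i' j' where ij: "i = Suc i'" "j = Suc j'" "i' < d" "j' < d"
    using assms(2,3) by (cases i; cases j) auto
  then have "(N * M) $$ (i', j') = (\<Sum>k<d. A (Suc k) i * A (Suc k) j)"
    by (auto simp: M_def N_def scalar_prod_def lessThan_atLeast0 intro!: sum.cong)
  then show ?thesis using NM ij unfolding sum_atLeast1_shift by simp
qed

lemma orth_transpose: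
  fixes A :: "nat \<Rightarrow> nat \<Rightarrow> 'a::field"
  shows "orth d A \<Longrightarrow> orth d (\<lambda>i j. A j i)"
  using orth_columns[of d A] by (auto simp: orth_def msupp_def)

lemma mtrans_Od: "A \<in> Od d \<Longrightarrow> mtrans A \<in> Od d"
  unfolding Od_iff_orth mtrans_def by (rule orth_transpose)

lemma mmul_mtrans_right: "A \<in> Od d \<Longrightarrow> mmul d A (mtrans A) = idm d"
proof (intro ext)
  fix i j assume A: "A \<in> Od d"
  show "mmul d A (mtrans A) i j = idm d i j"
  proof (cases "i \<in> {1..d} \<and> j \<in> {1..d}")
    case True
    then show ?thesis using A by (auto simp: Od_iff_orth orth_def mmul_def mtrans_def idm_def)
  next
    case False
    then have "A i k * A j k = 0" for k using A by (auto simp: Od_iff_orth orth_def msupp_def)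
    then have "mmul d A (mtrans A) i j = 0" unfolding mmul_def mtrans_def by (intro sum.neutral) blast
    then show ?thesis using False by (auto simp: idm_def)
  qed
qed

lemma mmul_mtrans_left: "A \<in> Od d \<Longrightarrow> mmul d (mtrans A) A = idm d"
  using mmul_mtrans_right[OF mtrans_Od] by (simp add: mtrans_def)

lemma orth_idm: "orth d (idm d :: nat \<Rightarrow> nat \<Rightarrow> 'a::comm_ring_1)"
  unfolding orth_def
proof (intro conjI ballI)
  fix i j assume ij: "i \<in> {1..d}" "j \<in> {1..d}"
  have "(\<Sum>k=1..d. idm d i k * idm d j k :: 'a) = (\<Sum>k=1..d. (if k = i then 1 else 0) * idm d j k)"
    using ij by (intro sum.cong) (auto simp: idm_def)
  also have "\<dots> = idm d j i" using ij by (intro sum_delta_mult) auto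
  finally show "(\<Sum>k=1..d. idm d i k * idm d j k :: 'a) = (if i = j then 1 else 0)"
    using ij by (auto simp: idm_def)
qed (rule msupp_idm)

lemma mmul_Od:
  assumes "A \<in> Od d" "B \<in> Od d"
  shows "mmul d A B \<in> Od d"
proof -
  have A: "orth d A" and B: "orth d B" using assms by (auto simp: Od_iff_orth)
  have "(\<Sum>k=1..d. mmul d A B i k * mmul d A B j k) = (if i = j then 1 else 0)"
    if ij: "i \<in> {1..d}" "j \<in> {1..d}" for i j
  proof -
    have "(\<Sum>k=1..d. mmul d A B i k * mmul d A B j k)
        = (\<Sum>k=1..d. \<Sum>l=1..d. \<Sum>m=1..d. A i l * A j m * (B l k * B m k))"
      unfolding mmul_def sum_product by (simp add: algebra_simps)
    also have "\<dots> = (\<Sum>l=1..d. \<Sum>k=1..d. \<Sum>m=1..d. A i l * A j m * (B l k * B m k))"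
      by (rule sum.swap)
    also have "\<dots> = (\<Sum>l=1..d. \<Sum>m=1..d. \<Sum>k=1..d. A i l * A j m * (B l k * B m k))"
      by (intro sum.cong refl sum.swap)
    also have "\<dots> = (\<Sum>l=1..d. \<Sum>m=1..d. (if m = l then 1 else 0) * (A i l * A j m))"
      using B unfolding sum_distrib_left[symmetric] orth_def by (intro sum.cong refl) auto
    also have "\<dots> = (\<Sum>l=1..d. A i l * A j l)"
      by (intro sum.cong refl) (subst sum_delta_mult, auto)
    finally show ?thesis using A ij by (simp add: orth_def)
  qed
  moreover have "msupp d (mmul d A B)" using A B by (auto simp: orth_def intro: msupp_mmul)
  ultimately show ?thesis unfolding Od_iff_orth orth_def by blast
qed

text \<open>The transpose undoes \<open>A\<close>. The relation between \<open>u\<close> and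
  \<open>u'\<close> is asked only on \<open>{1..d}\<close>, which is all that equivariance
  provides.\<close>

lemma orth_inverse:
  fixes A :: "nat \<Rightarrow> nat \<Rightarrow> 'a::field"
  assumes "orth d A" "\<And>i. i \<in> {1..d} \<Longrightarrow> u' i = (\<Sum>k=1..d. A i k * u k)" "l \<in> {1..d}"
  shows "(\<Sum>j=1..d. A j l * u' j) = u l"
proof -
  have "(\<Sum>j=1..d. A j l * u' j) = (\<Sum>j=1..d. \<Sum>k=1..d. A j l * A j k * u k)"
    by (rule sum.cong) (auto simp: assms(2) sum_distrib_left mult.assoc)
  also have "\<dots> = (\<Sum>k=1..d. (\<Sum>j=1..d. A j l * A j k) * u k)"
    by (subst sum.swap) (simp add: sum_distrib_right)
  also have "\<dots> = (\<Sum>k=1..d. (if k = l then 1 else 0) * u k)"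
    by (rule sum.cong) (auto simp: orth_columns[OF assms(1,3)] simp del: One_nat_def)
  finally show ?thesis using assms(3) by (simp add: sum_delta_mult)
qed

section \<open>Equivariant vectors built from a vector and a skew matrix\<close>

definition skew :: "(nat list \<Rightarrow> 'a::ring_1) \<Rightarrow> nat \<Rightarrow> nat \<Rightarrow> 'a" where
  "skew x k l = (if k < l then x [k, l] else if l < k then - x [l, k] else 0)"

lemma skewC_eq_skew: "skewC = skew"
  by (intro ext) (simp add: skewC_def skew_def)

lemma skew_antisym: "skew x l k = - skew x k l"
  by (simp add: skew_def)

text \<open>A relation instead of a map, so that one equivariance proof covers both
  \<open>cact\<close> on complex points and \<open>act\<close> on real Lyndon coordinates.\<close>

definition lvrel :: "nat \<Rightarrow> (nat \<Rightarrow> nat \<Rightarrow> 'a::field) \<Rightarrow> (nat list \<Rightarrow> 'a) \<Rightarrow> (nat list \<Rightarrow> 'a) \<Rightarrow> bool" where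
  "lvrel d A x x' \<longleftrightarrow> (\<forall>i\<in>{1..d}. x' [i] = (\<Sum>j=1..d. A i j * x [j])) \<and>
    (\<forall>i\<in>{1..d}. \<forall>j\<in>{1..d}. skew x' i j = (\<Sum>k=1..d. \<Sum>l=1..d. A i k * skew x k l * A j l))"

definition dot :: "nat \<Rightarrow> (nat \<Rightarrow> 'a::comm_ring_1) \<Rightarrow> (nat \<Rightarrow> 'a) \<Rightarrow> 'a" where
  "dot d u w = (\<Sum>i=1..d. u i * w i)"

definition mv :: "nat \<Rightarrow> (nat list \<Rightarrow> 'a::comm_ring_1) \<Rightarrow> (nat \<Rightarrow> 'a) \<Rightarrow> nat \<Rightarrow> 'a" where
  "mv d x u = (\<lambda>i. \<Sum>k=1..d. skew x i k * u k)"

text \<open>The vectors \<open>w\<^sub>j\<close> of the introduction.\<close>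
fun kv :: "nat \<Rightarrow> nat \<Rightarrow> (nat list \<Rightarrow> 'a::comm_ring_1) \<Rightarrow> nat \<Rightarrow> 'a" where
  "kv d 0 x = (\<lambda>i. x [i])"
| "kv d (Suc 0) x = mv d x (\<lambda>i. x [i])"
| "kv d (Suc (Suc j)) x = (\<lambda>i. dot d (kv d j x) (kv d j x) * mv d x (kv d (Suc j) x) i
      - dot d (mv d x (kv d (Suc j) x)) (kv d j x) * kv d j x i)"

definition nkv :: "nat \<Rightarrow> nat \<Rightarrow> (nat list \<Rightarrow> 'a::comm_ring_1) \<Rightarrow> 'a" where
  "nkv d j x = dot d (kv d j x) (kv d j x)"

lemma dot_equivariant:
  fixes A :: "nat \<Rightarrow> nat \<Rightarrow> 'a::field"
  assumes "orth d A" "\<And>i. i \<in> {1..d} \<Longrightarrow> u' i = (\<Sum>k=1..d. A i k * u k)"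
    "\<And>i. i \<in> {1..d} \<Longrightarrow> w' i = (\<Sum>k=1..d. A i k * w k)"
  shows "dot d u' w' = dot d u w"
proof -
  have "dot d u' w' = (\<Sum>i=1..d. \<Sum>k=1..d. u k * (A i k * w' i))"
    unfolding dot_def by (rule sum.cong) (auto simp: assms(2) sum_distrib_left sum_distrib_right algebra_simps simp del: One_nat_def)
  also have "\<dots> = (\<Sum>k=1..d. u k * (\<Sum>i=1..d. A i k * w' i))"
    by (subst sum.swap) (simp add: sum_distrib_left)
  also have "\<dots> = dot d u w"
    unfolding dot_def using orth_inverse[OF assms(1,3)] by (intro sum.cong refl) auto
  finally show ?thesis .
qed

text \<open>In (A M A^T)(A u) the middle factor A^T A cancels; reordering the sums brings it
  together.\<close>

lemma mv_equivariant:
  fixes A :: "nat \<Rightarrow> nat \<Rightarrow> 'a::field"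
  assumes "orth d A" "lvrel d A x x'" "\<And>i. i \<in> {1..d} \<Longrightarrow> u' i = (\<Sum>k=1..d. A i k * u k)" "i \<in> {1..d}"
  shows "mv d x' u' i = (\<Sum>k=1..d. A i k * mv d x u k)"
proof -
  have "mv d x' u' i = (\<Sum>j=1..d. \<Sum>k=1..d. \<Sum>l=1..d. A i k * skew x k l * (A j l * u' j))"
    unfolding mv_def using assms(2,4)
    by (intro sum.cong refl) (auto simp: lvrel_def sum_distrib_right mult.assoc)
  also have "\<dots> = (\<Sum>k=1..d. \<Sum>j=1..d. \<Sum>l=1..d. A i k * skew x k l * (A j l * u' j))"
    by (rule sum.swap)
  also have "\<dots> = (\<Sum>k=1..d. \<Sum>l=1..d. \<Sum>j=1..d. A i k * skew x k l * (A j l * u' j))"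
    by (intro sum.cong refl sum.swap)
  also have "\<dots> = (\<Sum>k=1..d. \<Sum>l=1..d. A i k * skew x k l * u l)"
    unfolding sum_distrib_left[symmetric] using orth_inverse[OF assms(1,3)] by (intro sum.cong refl) auto
  also have "\<dots> = (\<Sum>k=1..d. A i k * mv d x u k)"
    unfolding mv_def by (simp add: sum_distrib_left mult.assoc)
  finally show ?thesis .
qed

text \<open>The recursion uses only applications of M and linear combinations whose scalars are dot
  products, hence invariants.\<close>

lemma kv_equivariant:
  fixes A :: "nat \<Rightarrow> nat \<Rightarrow> 'a::field"
  assumes "orth d A" "lvrel d A x x'"
  shows "i \<in> {1..d} \<Longrightarrow> kv d j x' i = (\<Sum>k=1..d. A i k * kv d j x k)"
proof (induction j arbitrary: i rule: less_induct)
  case (less j)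
  note mv_eq = mv_equivariant[OF assms]
  consider "j = 0" | "j = 1" | m where "j = Suc (Suc m)"
    by (cases j; cases "j - 1") auto
  then show ?case
  proof cases
    case 1 then show ?thesis using assms(2) less.prems by (simp add: lvrel_def)
  next
    case 2
    have "x' [i] = (\<Sum>k=1..d. A i k * x [k])" if "i \<in> {1..d}" for i
      using assms(2) that by (simp add: lvrel_def)
    then show ?thesis using 2 less.prems mv_eq[of "\<lambda>i. x' [i]" "\<lambda>i. x [i]"] by simp
  next
    case 3
    have k0: "kv d m x' i = (\<Sum>k=1..d. A i k * kv d m x k)" if "i \<in> {1..d}" for i
      using less.IH[of m] that 3 by simp
    have k1: "kv d (Suc m) x' i = (\<Sum>k=1..d. A i k * kv d (Suc m) x k)" if "i \<in> {1..d}" for i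
      using less.IH[of "Suc m"] that 3 by simp
    have m1: "mv d x' (kv d (Suc m) x') i = (\<Sum>k=1..d. A i k * mv d x (kv d (Suc m) x) k)" if "i \<in> {1..d}" for i
      by (rule mv_eq[OF k1 that])
    have "dot d (kv d m x') (kv d m x') = dot d (kv d m x) (kv d m x)"
      by (rule dot_equivariant[OF assms(1) k0 k0])
    moreover have "dot d (mv d x' (kv d (Suc m) x')) (kv d m x') = dot d (mv d x (kv d (Suc m) x)) (kv d m x)"
      by (rule dot_equivariant[OF assms(1) m1 k0])
    ultimately show ?thesis
      unfolding 3 by (simp add: k0[OF less.prems] m1[OF less.prems] sum_distrib_left right_diff_distrib
          sum_subtractf mult.left_commute del: kv.simps(1,2))
  qed
qed

lemma nkv_invariant: "orth d A \<Longrightarrow> lvrel d A x x' \<Longrightarrow> nkv d j x' = nkv d j x"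
  unfolding nkv_def by (rule dot_equivariant[of d A]) (assumption | rule kv_equivariant)+

text \<open>For \<open>J < d\<close> this describes \<open>L\<^sup>(\<^sup>J\<^sup>+\<^sup>1\<^sup>)\<close>.\<close>
definition Lcond :: "nat \<Rightarrow> nat \<Rightarrow> (nat list \<Rightarrow> 'a::comm_ring_1) \<Rightarrow> bool" where
  "Lcond d J x \<longleftrightarrow> (\<forall>k\<in>{1..d-1}. x [k] = 0) \<and>
    (\<forall>k l. 1 \<le> k \<and> k + 1 < l \<and> l \<le> d \<and> d - J < l \<longrightarrow> x [k, l] = 0)"

section \<open>The vectors w_j on the slices\<close>

lemma Lcond_mono: "Lcond d J x \<Longrightarrow> J' \<le> J \<Longrightarrow> Lcond d J' x"
  unfolding Lcond_def by (meson diff_le_mono2 le_less_trans)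

lemma sum_single:
  fixes f :: "'b \<Rightarrow> 'a::comm_monoid_add"
  assumes "finite S" "a \<in> S" "\<And>i. i \<in> S \<Longrightarrow> i \<noteq> a \<Longrightarrow> f i = 0"
  shows "sum f S = f a"
  using assms by (metis sum.remove sum.neutral Diff_iff add.right_neutral singletonI)

text \<open>Put m = d - J - 1. Here w_{J+1} is a multiple of e_m, so M w_{J+1} is a multiple of
  column m. Entries in rows beyond m + 1 vanish by \<open>Lcond\<close>, the entry in row m + 1 is
  removed by the subtraction along w_J, and only the part above the diagonal survives.\<close>

lemma kv_next:
  assumes "Lcond d (Suc J) x" "Suc J < d"
    and diag: "\<And>j i. j \<le> Suc J \<Longrightarrow> i \<in> {1..d} \<Longrightarrow> i \<noteq> d - j \<Longrightarrow> kv d j x i = 0"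
    and i: "i \<in> {1..d}"
  shows "kv d (Suc (Suc J)) x i = (kv d J x (d - J))\<^sup>2 * kv d (Suc J) x (d - Suc J) *
    (if i < d - Suc J then x [i, d - Suc J] else 0)"
proof -
  define m where "m = d - Suc J"
  have m: "d - J = Suc m" "m \<in> {1..d}" "Suc m \<in> {1..d}" using assms(2) unfolding m_def by auto
  have mv_eq: "mv d x (kv d (Suc J) x) k = skew x k m * kv d (Suc J) x m" for k
    unfolding mv_def by (rule sum_single) (use m diag in \<open>auto simp: m_def[symmetric]\<close>)
  have dot1: "dot d (kv d J x) (kv d J x) = (kv d J x (Suc m))\<^sup>2"
    unfolding dot_def power2_eq_square by (rule sum_single) (use m diag[of J] in auto)
  have dot2: "dot d (mv d x (kv d (Suc J) x)) (kv d J x) = skew x (Suc m) m * kv d (Suc J) x m * kv d J x (Suc m)"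
    unfolding dot_def mv_eq by (rule sum_single) (use m diag[of J] in auto)
  have *: "kv d (Suc (Suc J)) x i = (kv d J x (Suc m))\<^sup>2 * (skew x i m * kv d (Suc J) x m)
      - skew x (Suc m) m * kv d (Suc J) x m * kv d J x (Suc m) * kv d J x i"
    by (simp add: dot1 dot2 mv_eq del: kv.simps(1,2))
  consider "i < m" | "i = m" | "i = Suc m" | "i > Suc m" by linarith
  then show ?thesis
  proof cases
    case 1
    then have "kv d J x i = 0" using diag[of J i] i m by auto
    then show ?thesis using 1 by (simp add: * m m_def[symmetric] skew_def del: kv.simps)
  next
    case 2
    then have "kv d J x i = 0" using diag[of J i] i m by auto
    then show ?thesis using 2 * by (simp add: m m_def[symmetric] skew_def del: kv.simps)
  next
    case 3
    then show ?thesis using * by (simp add: m m_def[symmetric] skew_def power2_eq_square algebra_simps del: kv.simps)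
  next
    case 4
    have "kv d J x i = 0" using diag[of J i] i m 4 by auto
    moreover have "x [m, i] = 0"
      using assms(1) 4 i m unfolding Lcond_def m_def by auto
    ultimately show ?thesis using 4 by (simp add: * m m_def[symmetric] skew_def del: kv.simps)
  qed
qed

lemma kv_one:
  assumes "Lcond d 0 x" "i \<in> {1..d}"
  shows "kv d (Suc 0) x i = x [d] * (if i < d then x [i, d] else 0)"
proof -
  have "kv d (Suc 0) x i = skew x i d * x [d]"
    unfolding kv.simps mv_def by (rule sum_single) (use assms in \<open>auto simp: Lcond_def\<close>)
  then show ?thesis using assms(2) by (auto simp: skew_def)
qed

text \<open>By \<open>kv_next\<close> the new vector is the part of a column above the diagonal, and
  \<open>Lcond\<close> clears that column except directly above the diagonal.\<close>

lemma kv_diag: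
  assumes "Lcond d J x" "J < d"
  shows "j \<le> J \<Longrightarrow> i \<in> {1..d} \<Longrightarrow> i \<noteq> d - j \<Longrightarrow> kv d j x i = 0"
proof (induction j arbitrary: i rule: less_induct)
  case (less j)
  consider "j = 0" | "j = 1" | m where "j = Suc (Suc m)"
    by (cases j; cases "j - 1") auto
  then show ?case
  proof cases
    case 1 then show ?thesis using assms(1) less.prems by (auto simp: Lcond_def)
  next
    case 2
    have "x [i, d] = 0" if "i < d"
      using assms less.prems that 2 unfolding Lcond_def by auto
    then show ?thesis
      using kv_one[OF Lcond_mono[OF assms(1)], of i] less.prems 2 by auto
  next
    case 3
    have "x [i, d - Suc m] = 0" if "i < d - Suc m"
    proof -
      have "1 \<le> i \<and> i + 1 < d - Suc m \<and> d - Suc m \<le> d \<and> d - J < d - Suc m"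
        using assms(2) less.prems that 3 by auto
      then show ?thesis using assms(1) unfolding Lcond_def by blast
    qed
    moreover have "kv d (Suc (Suc m)) x i = (kv d m x (d - m))\<^sup>2 * kv d (Suc m) x (d - Suc m) *
        (if i < d - Suc m then x [i, d - Suc m] else 0)"
      by (rule kv_next) (use 3 less assms Lcond_mono[OF assms(1), of "Suc m"] in auto)
    ultimately show ?thesis using 3 by simp
  qed
qed

lemma nkv_diag:
  assumes "Lcond d J x" "J < d" "j \<le> J"
  shows "nkv d j x = (kv d j x (d - j))\<^sup>2"
  unfolding nkv_def dot_def power2_eq_square
  by (rule sum_single) (use kv_diag[OF assms] assms in auto)

text \<open>On this slice one column is still free, and w_{J+2} is a multiple of its part above the
  diagonal. Rewriting the multiple through norms makes it invariant, so the quotient is an invariant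
  function that restricts to the column sum.\<close>

lemma nkv_Suc_Suc:
  assumes "Lcond d (Suc J) x" "Suc J < d"
  shows "nkv d (Suc (Suc J)) x
    = (\<Sum>k=1..d - Suc (Suc J). (x [k, d - Suc J])\<^sup>2) * ((nkv d J x)\<^sup>2 * nkv d (Suc J) x)"
proof -
  define a where "a = (kv d J x (d - J))\<^sup>2 * kv d (Suc J) x (d - Suc J)"
  have next_eq: "kv d (Suc (Suc J)) x i = a * (if i < d - Suc J then x [i, d - Suc J] else 0)"
    if "i \<in> {1..d}" for i
    unfolding a_def using kv_diag[OF assms] that by (intro kv_next[OF assms]) blast+
  have "nkv d (Suc (Suc J)) x = (\<Sum>i=1..d. if i < d - Suc J then a\<^sup>2 * (x [i, d - Suc J])\<^sup>2 else 0)"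
    unfolding nkv_def dot_def
    by (rule sum.cong) (auto simp: next_eq a_def power2_eq_square algebra_simps simp del: kv.simps One_nat_def)
  also have "\<dots> = (\<Sum>i=1..d - Suc (Suc J). a\<^sup>2 * (x [i, d - Suc J])\<^sup>2)"
    by (rule sum.mono_neutral_cong_right) auto
  also have "\<dots> = (\<Sum>k=1..d - Suc (Suc J). (x [k, d - Suc J])\<^sup>2) * a\<^sup>2"
    by (simp add: sum_distrib_left mult.commute)
  also have "a\<^sup>2 = (nkv d J x)\<^sup>2 * nkv d (Suc J) x"
    by (simp add: a_def nkv_diag[OF assms] power_mult_distrib del: kv.simps)
  finally show ?thesis .
qed

text \<open>The start of the recursion has no earlier vector to subtract, hence the simpler
  factor.\<close>

lemma nkv_one:
  assumes "Lcond d 0 x" "0 < d"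
  shows "nkv d (Suc 0) x = (\<Sum>k=1..d - 1. (x [k, d])\<^sup>2) * nkv d 0 x"
proof -
  have "nkv d (Suc 0) x = (\<Sum>i=1..d. if i < d then (x [d])\<^sup>2 * (x [i, d])\<^sup>2 else 0)"
    unfolding nkv_def dot_def
    by (rule sum.cong) (auto simp: kv_one[OF assms(1)] power2_eq_square algebra_simps simp del: kv.simps One_nat_def)
  also have "\<dots> = (\<Sum>i=1..d - 1. (x [d])\<^sup>2 * (x [i, d])\<^sup>2)"
    by (rule sum.mono_neutral_cong_right) auto
  also have "\<dots> = (\<Sum>k=1..d - 1. (x [k, d])\<^sup>2) * nkv d 0 x"
    using nkv_diag[OF assms] by (simp add: sum_distrib_left mult.commute)
  finally show ?thesis .
qed

lemma kv_diag_Suc_Suc: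
  assumes "Lcond d (d - 1) x" "Suc (Suc J) < d"
  shows "kv d (Suc (Suc J)) x (d - Suc (Suc J)) = (kv d J x (d - J))\<^sup>2 * kv d (Suc J) x (d - Suc J) *
    x [d - Suc (Suc J), d - Suc J]"
proof -
  have L: "Lcond d (Suc J) x" by (rule Lcond_mono[OF assms(1)]) (use assms in auto)
  show ?thesis
    using kv_next[OF L _ kv_diag[OF L], of "d - Suc (Suc J)"] assms(2) by (auto simp del: kv.simps)
qed

lemma kv_diag_nonzero:
  fixes x :: "nat list \<Rightarrow> 'a::field"
  assumes "Lcond d (d - 1) x" "x [d] \<noteq> 0" "\<And>i. i \<in> {1..d-1} \<Longrightarrow> x [i, i + 1] \<noteq> 0"
  shows "j < d \<Longrightarrow> kv d j x (d - j) \<noteq> 0"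
proof (induction j rule: less_induct)
  case (less j)
  consider "j = 0" | "j = 1" | m where "j = Suc (Suc m)"
    by (cases j; cases "j - 1") auto
  then show ?case
  proof cases
    case 1 then show ?thesis using assms(2) by simp
  next
    case 2
    then show ?thesis using assms(2) assms(3)[of "d - 1"] less.prems
        kv_one[OF Lcond_mono[OF assms(1)], of "d - 1"] by (auto simp del: kv.simps)
  next
    case 3
    have "kv d m x (d - m) \<noteq> 0" "kv d (Suc m) x (d - Suc m) \<noteq> 0"
      using less.IH[of m] less.IH[of "Suc m"] less.prems 3 by auto
    moreover have "d - j \<in> {1..d-1}" "d - j + 1 = d - Suc m" using less.prems 3 by auto
    then have "x [d - j, d - Suc m] \<noteq> 0" using assms(3)[of "d - j"] by simp
    ultimately show ?thesis using kv_diag_Suc_Suc[OF assms(1), of m] less.prems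
      unfolding 3 by (simp del: kv.simps)
  qed
qed

text \<open>The sign conditions of \<open>K_set\<close> enter here: they make w_j a positive
  multiple of e_{d-j}, which later fixes the signs of the rows of the frame.\<close>

lemma kv_diag_positive:
  fixes x :: "nat list \<Rightarrow> real"
  assumes "Lcond d (d - 1) x" "x [d] > 0" "\<And>i. i \<in> {1..d-1} \<Longrightarrow> x [i, i + 1] > 0"
  shows "j < d \<Longrightarrow> kv d j x (d - j) > 0"
proof (induction j rule: less_induct)
  case (less j)
  consider "j = 0" | "j = 1" | m where "j = Suc (Suc m)"
    by (cases j; cases "j - 1") auto
  then show ?case
  proof cases
    case 1 then show ?thesis using assms(2) by simp
  next
    case 2
    then show ?thesis using assms(2) assms(3)[of "d - 1"] less.prems
        kv_one[OF Lcond_mono[OF assms(1)], of "d - 1"] by (auto simp del: kv.simps)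
  next
    case 3
    have "kv d m x (d - m) > 0" "kv d (Suc m) x (d - Suc m) > 0"
      using less.IH[of m] less.IH[of "Suc m"] less.prems 3 by auto
    moreover have "d - j \<in> {1..d-1}" "d - j + 1 = d - Suc m" using less.prems 3 by auto
    then have "x [d - j, d - Suc m] > 0" using assms(3)[of "d - j"] by simp
    ultimately show ?thesis using kv_diag_Suc_Suc[OF assms(1), of m] less.prems
      unfolding 3 by (simp del: kv.simps)
  qed
qed

section \<open>Invariant rational functions and reflections\<close>

lemma VI_single: "[i] \<in> VI d \<longleftrightarrow> i \<in> {1..d}"
  by (auto simp: VI_def)

lemma VI_pair: "[i, j] \<in> VI d \<longleftrightarrow> 1 \<le> i \<and> i < j \<and> j \<le> d"
  by (auto simp: VI_def)

lemma VI_cases: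
  assumes "w \<in> VI d"
  obtains i where "w = [i]" "i \<in> {1..d}" | i j where "w = [i, j]" "1 \<le> i" "i < j" "j \<le> d"
  using assms by (auto simp: VI_def)

lemma cact_single: "i \<in> {1..d} \<Longrightarrow> cact d A x [i] = (\<Sum>j=1..d. A i j * x [j])"
  by (simp add: cact_def VI_single)

lemma cact_pair: "1 \<le> i \<Longrightarrow> i < j \<Longrightarrow> j \<le> d \<Longrightarrow>
    cact d A x [i, j] = (\<Sum>k=1..d. \<Sum>l=1..d. A i k * skew x k l * A j l)"
  by (simp add: cact_def VI_pair skewC_eq_skew)

lemma conj_skew_antisym:
  "(\<Sum>k=1..d. \<Sum>l=1..d. A j k * skew x k l * A i l)
    = - (\<Sum>k=1..d. \<Sum>l=1..d. A i k * skew x k l * A j l)" for A :: "nat \<Rightarrow> nat \<Rightarrow> 'a::comm_ring_1"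
proof -
  have "A j k * skew x k l * A i l = - (A i l * skew x l k * A j k)" for k l
    by (subst skew_antisym) (simp add: mult_ac)
  then have "(\<Sum>k=1..d. \<Sum>l=1..d. A j k * skew x k l * A i l)
      = (\<Sum>k=1..d. \<Sum>l=1..d. - (A i l * skew x l k * A j k))"
    by simp
  also have "\<dots> = (\<Sum>l=1..d. \<Sum>k=1..d. - (A i l * skew x l k * A j k))" by (rule sum.swap)
  finally show ?thesis by (simp add: sum_negf)
qed

text \<open>Only entries with \<open>i < j\<close> are stored as coordinates; skewness of the
  conjugated matrix supplies the rest. On the diagonal s = -s forces s = 0 in characteristic
  zero.\<close>

lemma skew_eq_conj:
  fixes x x' :: "nat list \<Rightarrow> 'a::field_char_0"
  assumes "\<And>i j. 1 \<le> i \<Longrightarrow> i < j \<Longrightarrow> j \<le> d \<Longrightarrow> x' [i, j] = (\<Sum>k=1..d. \<Sum>l=1..d. A i k * skew x k l * A j l)"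
    "i \<in> {1..d}" "j \<in> {1..d}"
  shows "skew x' i j = (\<Sum>k=1..d. \<Sum>l=1..d. A i k * skew x k l * A j l)"
proof -
  consider "i < j" | "i = j" | "j < i" by linarith
  then show ?thesis
  proof cases
    case 1 then show ?thesis using assms(1)[of i j] assms(2,3) by (simp add: skew_def)
  next
    case 2
    have "(\<Sum>k=1..d. \<Sum>l=1..d. A i k * skew x k l * A i l) = 0"
      using conj_skew_antisym[where d = d and A = A and i = i and j = i and x = x] by (simp add: eq_neg_iff_add_eq_0 mult_2[symmetric])
    then show ?thesis using 2 by (simp add: skew_def)
  next
    case 3
    then show ?thesis
      using assms(1)[of j i] assms(2,3) conj_skew_antisym[where d = d and A = A and i = j and j = i and x = x] by (simp add: skew_def)
  qed
qed

lemma lvrel_cact: "lvrel d A x (cact d A x)"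
  unfolding lvrel_def
proof (intro conjI ballI)
  fix i j assume "i \<in> {1..d}" "j \<in> {1..d}"
  then show "skew (cact d A x) i j = (\<Sum>k=1..d. \<Sum>l=1..d. A i k * skew x k l * A j l)"
    by (intro skew_eq_conj) (rule cact_pair)
qed (rule cact_single)

section \<open>Levels one and two of the action on Lyndon coordinates\<close>

lemma lyn_basis_at_single: "lyndon g \<Longrightarrow> lyn_basis n g [i] = (if g = [i] then 1 else 0)"
proof (cases "length g = 1")
  case True
  then obtain a where "g = [a]" by (auto simp: length_Suc_conv)
  then show ?thesis by (simp add: lyn_basis_letter letter_def)
next
  case False
  assume "lyndon g"
  then show ?thesis using False lyn_basis_length_set[of g n "[i]"] by auto
qed

lemma lyndon_pair: "lyndon [a, b] \<longleftrightarrow> a < b"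
proof
  assume "lyndon [a, b]"
  then have "lex_less [a, b] [b]" using lyndon_less_suffix[of "[a]" "[b]"] by simp
  then show "a < b" by (auto simp: lex_less_iff_lexord)
next
  assume "a < b"
  then have "lex_less [a] [b]" by (auto simp: lex_less_iff_lexord)
  then show "lyndon [a, b]" using lyndon_append[OF lyndon_letter[of a] lyndon_letter[of b]] by simp
qed

text \<open>A two-letter word can be cut in only one place, so its basis element is ab - ba; basis
  elements of other lengths do not see \<open>[i, j]\<close>.\<close>

lemma lyn_basis_at_pair:
  assumes "lyndon g" "2 \<le> n"
  shows "lyn_basis n g [i, j] = (if g = [i, j] then 1 else 0) - (if g = [j, i] then 1 else 0)"
proof (cases "length g = 2")
  case True
  then obtain a b where g: "g = [a, b]" by (auto simp: length_Suc_conv numeral_2_eq_2)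
  have "std_split ([a] @ [b]) = length [a]"
    by (rule std_split_append[OF lyndon_letter lyndon_letter]) simp
  then have "lyn_basis n g = tbracket n (letter a) (letter b)"
    using lyn_basis_append[of "[a]" "[b]" n] g by (simp add: lyn_basis_letter)
  moreover have "cmul (letter x) (letter y) [i, j] = (if x = i \<and> y = j then 1 else 0)" for x y
    by (simp add: letter_def)
  ultimately show ?thesis using assms(2) g by (auto simp: tbracket_eq_cmul simp del: cmul_Cons)
next
  case False
  then have "g \<noteq> [i, j]" "g \<noteq> [j, i]" by auto
  moreover have "lyn_basis n g [i, j] = 0"
    using False assms(1) lyn_basis_length_set[of g n "[i, j]"] by force
  ultimately show ?thesis by simp
qed

lemma lyn_words_single: "1 \<le> n \<Longrightarrow> [i] \<in> lyn_words d n \<longleftrightarrow> i \<in> {1..d}"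
  by (auto simp: lyn_words_def lyndon_letter)

lemma lyn_words_pair: "2 \<le> n \<Longrightarrow> [i, j] \<in> lyn_words d n \<longleftrightarrow> 1 \<le> i \<and> i < j \<and> j \<le> d"
  by (auto simp: lyn_words_def lyndon_pair)

lemma cspaceD: "c \<in> cspace d n \<Longrightarrow> h \<notin> lyn_words d n \<Longrightarrow> c h = 0"
  by (simp add: cspace_def)

lemma sum_delta_cspace:
  assumes "c \<in> cspace d n"
  shows "(\<Sum>g\<in>lyn_words d n. c g * (if g = h then 1 else 0)) = c h"
proof (cases "h \<in> lyn_words d n")
  case True
  then show ?thesis using sum_delta_mult[OF finite_lyn_words True, of c] by (simp add: mult.commute)
next
  case False
  then have "(\<Sum>g\<in>lyn_words d n. c g * (if g = h then 1 else 0)) = 0" by (intro sum.neutral) auto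
  then show ?thesis using cspaceD[OF assms False] by simp
qed

lemma lembed_single:
  assumes "c \<in> cspace d n"
  shows "lembed d n c [i] = c [i]"
proof -
  have "lembed d n c [i] = (\<Sum>g\<in>lyn_words d n. c g * (if g = [i] then 1 else 0))"
    unfolding lembed_def by (rule sum.cong) (use lyn_wordsD lyn_basis_at_single in auto)
  then show ?thesis using sum_delta_cspace[OF assms] by simp
qed

lemma lembed_pair:
  assumes "c \<in> cspace d n" "2 \<le> n"
  shows "lembed d n c [i, j] = skew c i j"
proof -
  have "lembed d n c [i, j] = (\<Sum>g\<in>lyn_words d n. c g * (if g = [i, j] then 1 else 0) - c g * (if g = [j, i] then 1 else 0))"
    unfolding lembed_def
    by (rule sum.cong) (use lyn_wordsD lyn_basis_at_pair[OF _ assms(2)] in \<open>auto simp: right_diff_distrib\<close>)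
  also have "\<dots> = c [i, j] - c [j, i]"
    unfolding sum_subtractf sum_delta_cspace[OF assms(1)] ..
  also have "\<dots> = skew c i j"
    using cspaceD[OF assms(1), of "[i, j]"] cspaceD[OF assms(1), of "[j, i]"] lyn_words_pair[OF assms(2)]
    by (auto simp: skew_def)
  finally show ?thesis .
qed

text \<open>On the first two levels the tensor coefficients are the entries of v and of M, by
  \<open>lembed_single\<close> and \<open>lembed_pair\<close>, so the substitution can be read off
  directly.\<close>

lemma lvrel_act:
  assumes "msupp d A" "c \<in> cspace d n" "2 \<le> n"
  shows "lvrel d A c (act d n A c)"
  unfolding lvrel_def
proof (intro conjI ballI)
  note spec = act_spec[OF assms(1), of n c]
  fix i assume "i \<in> {1..d}"
  have "act d n A c [i] = tact d A (lembed d n c) [i]"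
    using lembed_single[OF spec(1)] spec(2) by simp
  then show "act d n A c [i] = (\<Sum>j=1..d. A i j * c [j])"
    by (simp add: lembed_single[OF assms(2)])
  fix j
  have "skew (act d n A c) i j = tact d A (lembed d n c) [i, j]"
    using lembed_pair[OF spec(1) assms(3)] spec(2) by simp
  then show "skew (act d n A c) i j = (\<Sum>k=1..d. \<Sum>l=1..d. A i k * skew c k l * A j l)"
    by (simp add: lembed_pair[OF assms(2,3)] sum_distrib_left algebra_simps)
qed

lemma skew_lvl2C: "i \<in> {1..d} \<Longrightarrow> j \<in> {1..d} \<Longrightarrow> skew (lvl2C d c) i j = complex_of_real (skew c i j)"
  by (auto simp: skew_def lvl2C_def VI_pair)

lemma lvl2C_single: "i \<in> {1..d} \<Longrightarrow> lvl2C d c [i] = complex_of_real (c [i])"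
  by (simp add: lvl2C_def VI_single)

lemma lvl2C_VC: "lvl2C d c \<in> VC d"
  by (simp add: VC_def lvl2C_def)

lemma orth_complex_of_real:
  assumes "orth d A"
  shows "orth d (\<lambda>i j. complex_of_real (A i j))"
proof -
  have "(\<Sum>k=1..d. complex_of_real (A i k) * complex_of_real (A j k)) = complex_of_real (\<Sum>k=1..d. A i k * A j k)" for i j
    by simp
  then show ?thesis using assms unfolding orth_def msupp_def by (auto simp del: of_real_sum)
qed

lemma lvl2C_act:
  assumes "msupp d A" "c \<in> cspace d n" "2 \<le> n"
  shows "lvl2C d (act d n A c) = cact d (\<lambda>i j. complex_of_real (A i j)) (lvl2C d c)"
proof
  fix w
  note rel = lvrel_act[OF assms]
  show "lvl2C d (act d n A c) w = cact d (\<lambda>i j. complex_of_real (A i j)) (lvl2C d c) w"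
  proof (cases "w \<in> VI d")
    case True
    then show ?thesis
    proof (cases rule: VI_cases)
      case (1 i)
      then show ?thesis using rel
        by (simp add: lvl2C_single cact_single lvrel_def del: One_nat_def)
    next
      case (2 i j)
      then have "act d n A c [i, j] = (\<Sum>k=1..d. \<Sum>l=1..d. A i k * skew c k l * A j l)"
      proof -
        have ij: "i \<in> {1..d}" "j \<in> {1..d}" using 2 by auto
        have a: "skew (act d n A c) i j = act d n A c [i, j]" using 2 by (simp add: skew_def)
        have b: "skew (act d n A c) i j = (\<Sum>k=1..d. \<Sum>l=1..d. A i k * skew c k l * A j l)"
          using rel ij unfolding lvrel_def by blast
        show ?thesis by (rule trans[OF a[symmetric] b])
      qed
      then show ?thesis using 2 
        by (simp add: lvl2C_def VI_pair cact_pair skew_lvl2C[unfolded lvl2C_def] del: One_nat_def)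
    qed
  next
    case False
    then show ?thesis by (simp add: lvl2C_def cact_def)
  qed
qed

lemma mv_lvl2C:
  assumes "\<And>k. k \<in> {1..d} \<Longrightarrow> u' k = complex_of_real (u k)" "i \<in> {1..d}"
  shows "mv d (lvl2C d c) u' i = complex_of_real (mv d c u i)"
  unfolding mv_def of_real_sum using assms by (intro sum.cong refl) (simp add: skew_lvl2C)

lemma dot_of_real:
  assumes "\<And>k. k \<in> {1..d} \<Longrightarrow> u' k = complex_of_real (u k)" "\<And>k. k \<in> {1..d} \<Longrightarrow> w' k = complex_of_real (w k)"
  shows "dot d u' w' = complex_of_real (dot d u w)"
  unfolding dot_def of_real_sum using assms by (intro sum.cong refl) simp

lemma kv_lvl2C: "i \<in> {1..d} \<Longrightarrow> kv d j (lvl2C d c) i = complex_of_real (kv d j c i)"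
proof (induction j arbitrary: i rule: less_induct)
  case (less j)
  consider "j = 0" | "j = 1" | m where "j = Suc (Suc m)"
    by (cases j; cases "j - 1") auto
  then show ?case
  proof cases
    case 1 then show ?thesis using less.prems by (simp add: lvl2C_single)
  next
    case 2 then show ?thesis using mv_lvl2C[of d "\<lambda>i. lvl2C d c [i]" "\<lambda>i. c [i]"] less.prems
      by (simp add: lvl2C_single)
  next
    case 3
    have k: "kv d m (lvl2C d c) i = complex_of_real (kv d m c i)"
      "kv d (Suc m) (lvl2C d c) i = complex_of_real (kv d (Suc m) c i)" if "i \<in> {1..d}" for i
      using less.IH that 3 by auto
    note m = mv_lvl2C[of d, OF k(2)]
    show ?thesis unfolding 3 kv.simps
      using dot_of_real[OF k(1) k(1)] dot_of_real[OF m k(1)] m k(1) less.prems by simp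
  qed
qed

lemma nkv_lvl2C: "nkv d j (lvl2C d c) = complex_of_real (nkv d j c)"
  unfolding nkv_def by (rule dot_of_real) (rule kv_lvl2C, assumption)+

section \<open>Polynomial invariants and the slices\<close>

lemma cpoly_sum: "(\<And>k. k \<in> S \<Longrightarrow> f k \<in> cpoly d) \<Longrightarrow> (\<lambda>x. \<Sum>k\<in>S. f k x) \<in> cpoly d"
  by (induction S rule: infinite_finite_induct) (auto intro: cpoly.intros)

lemma cpoly_uminus: "p \<in> cpoly d \<Longrightarrow> (\<lambda>x. - p x) \<in> cpoly d"
  using cp_mult[OF cp_const[of "-1" d]] by simp

lemma cpoly_diff: "p \<in> cpoly d \<Longrightarrow> q \<in> cpoly d \<Longrightarrow> (\<lambda>x. p x - q x) \<in> cpoly d"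
  using cp_add[OF _ cpoly_uminus] by simp

lemma cpoly_skew: "i \<in> {1..d} \<Longrightarrow> j \<in> {1..d} \<Longrightarrow> (\<lambda>x. skew x i j) \<in> cpoly d"
  unfolding skew_def
  by (cases "i < j"; cases "j < i") (auto intro!: cp_var cp_const cpoly_uminus simp: VI_pair)

lemma cpoly_mv:
  assumes "\<And>k. k \<in> {1..d} \<Longrightarrow> (\<lambda>x. u x k) \<in> cpoly d" "i \<in> {1..d}"
  shows "(\<lambda>x. mv d x (u x) i) \<in> cpoly d"
  unfolding mv_def using assms by (intro cpoly_sum cp_mult cpoly_skew) auto

lemma cpoly_dot:
  assumes "\<And>k. k \<in> {1..d} \<Longrightarrow> (\<lambda>x. u x k) \<in> cpoly d" "\<And>k. k \<in> {1..d} \<Longrightarrow> (\<lambda>x. w x k) \<in> cpoly d"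
  shows "(\<lambda>x. dot d (u x) (w x)) \<in> cpoly d"
  unfolding dot_def using assms by (intro cpoly_sum cp_mult) auto

lemma cpoly_kv: "i \<in> {1..d} \<Longrightarrow> (\<lambda>x. kv d j x i) \<in> cpoly d"
proof (induction j arbitrary: i rule: less_induct)
  case (less j)
  have v: "(\<lambda>x. x [k]) \<in> cpoly d" if "k \<in> {1..d}" for k
    using that by (intro cp_var) (simp add: VI_single)
  consider "j = 0" | "j = 1" | m where "j = Suc (Suc m)"
    by (cases j; cases "j - 1") auto
  then show ?case
  proof cases
    case 1 then show ?thesis using v less.prems by simp
  next
    case 2 then show ?thesis using cpoly_mv[of d "\<lambda>x i. x [i]"] v less.prems by simp
  next
    case 3
    then have k: "(\<lambda>x. kv d m x i) \<in> cpoly d" "(\<lambda>x. kv d (Suc m) x i) \<in> cpoly d" if "i \<in> {1..d}" for i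
      using less.IH that by auto
    show ?thesis unfolding 3 kv.simps
      by (intro cpoly_diff cp_mult cpoly_dot cpoly_mv k less.prems)
  qed
qed

lemma cpoly_nkv: "nkv d j \<in> cpoly d"
  unfolding nkv_def[abs_def] by (rule cpoly_dot) (rule cpoly_kv, assumption)+

text \<open>Each step of \<open>Lsub\<close> clears one more column, sparing the entry next to the
  diagonal; \<open>Lcond\<close> collects these conditions in closed form.\<close>

lemma Lsub_eq: "J < d \<Longrightarrow> Lsub d (Suc J) = {x \<in> VC d. Lcond d J x}"
proof (induction J)
  case 0
  then show ?case by (auto simp: Lcond_def)
next
  case (Suc J)
  have "(Lcond d J x \<and> (\<forall>k\<in>{1..d - (J+2)}. x [k, d - J] = 0)) \<longleftrightarrow> Lcond d (Suc J) x" for x :: "nat list \<Rightarrow> complex"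
  proof
    assume *: "Lcond d J x \<and> (\<forall>k\<in>{1..d - (J+2)}. x [k, d - J] = 0)"
    have "x [k, l] = 0" if "1 \<le> k \<and> k + 1 < l \<and> l \<le> d \<and> d - Suc J < l" for k l
    proof (cases "l = d - J")
      case True
      then have "k \<in> {1..d - (J+2)}" using that by auto
      then show ?thesis using * True by blast
    next
      case False
      then have "d - J < l" using that by linarith
      then show ?thesis using * that unfolding Lcond_def by blast
    qed
    then show "Lcond d (Suc J) x" using * unfolding Lcond_def by blast
  next
    assume *: "Lcond d (Suc J) x"
    have "x [k, d - J] = 0" if "k \<in> {1..d - (J+2)}" for k
    proof -
      have "1 \<le> k \<and> k + 1 < d - J \<and> d - J \<le> d \<and> d - Suc J < d - J" using that Suc.prems by auto
      then show ?thesis using * unfolding Lcond_def by blast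
    qed
    then show "Lcond d J x \<and> (\<forall>k\<in>{1..d - (J+2)}. x [k, d - J] = 0)"
      using Lcond_mono[OF *] by auto
  qed
  then show ?case using Suc by auto
qed

text \<open>The vector e_d with the tridiagonal skew matrix whose superdiagonal entries are 1. It
  lies in every slice and no w_j with j < d has zero norm there, so it shows that denominators do
  not vanish identically on a slice.\<close>

definition jacobi_point :: "nat \<Rightarrow> nat list \<Rightarrow> complex" where
  "jacobi_point d = (\<lambda>w. if w = [d] \<or> (\<exists>k\<in>{1..d-1}. w = [k, k + 1]) then 1 else 0)"

lemma jacobi_point_props:
  assumes "2 \<le> d"
  shows "jacobi_point d \<in> VC d" "Lcond d J (jacobi_point d)" "j < d \<Longrightarrow> nkv d j (jacobi_point d) \<noteq> 0"
proof -
  show "jacobi_point d \<in> VC d"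
    using assms by (auto simp: VC_def jacobi_point_def VI_def)
  have L: "Lcond d J (jacobi_point d)" for J
    by (auto simp: Lcond_def jacobi_point_def)
  then show "Lcond d J (jacobi_point d)" .
  assume "j < d"
  moreover have "kv d j (jacobi_point d) (d - j) \<noteq> 0"
    using \<open>j < d\<close> by (intro kv_diag_nonzero L) (auto simp: jacobi_point_def)
  ultimately show "nkv d j (jacobi_point d) \<noteq> 0"
    using nkv_diag[OF L[of "d - 1"], of j] by simp
qed

text \<open>Each squared norm is invariant by itself, so the cross-multiplied invariance of p/q is
  immediate. The restriction comes from \<open>nkv_one\<close> or
  \<open>nkv_Suc_Suc\<close>.\<close>

lemma fk_okI:
  assumes "2 \<le> d" "i \<in> {2..d}" "\<And>j. j < d \<Longrightarrow> nkv d j y \<noteq> 0"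
  shows "fk_ok d i y"
proof -
  note inv = nkv_invariant[OF _ lvrel_cact]
  consider "i = 2" | J where "i = Suc (Suc (Suc J))"
  proof -
    have "i = 2 \<or> i = Suc (Suc (Suc (i - 3)))" using assms(2) by auto
    then show thesis using that by blast
  qed
  then show ?thesis
  proof cases
    case 1
    have "\<forall>x\<in>Lsub d (i - 1). nkv d 1 x = frestr d i x * nkv d 0 x"
      using Lsub_eq[of 0 d] nkv_one[of d] assms(1) 1 by (auto simp: frestr_def simp del: Lsub.simps)
    moreover have "\<exists>x\<in>Lsub d (i - 1). nkv d 0 x \<noteq> 0"
      using Lsub_eq[of 0 d] jacobi_point_props[OF assms(1)] assms(1) 1 by (auto simp del: Lsub.simps)
    ultimately show ?thesis
      unfolding fk_ok_def
      by (intro exI[of _ "nkv d 1"] exI[of _ "nkv d 0"])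
        (use assms in \<open>auto simp: OdC_iff_orth inv intro: cpoly_nkv\<close>)
  next
    case 2
    let ?q = "\<lambda>x. (nkv d J x * nkv d J x) * nkv d (Suc J) x"
    have J: "Suc J < d" "Suc (Suc J) < d" using assms(2) 2 by auto
    have idx: "d + 1 - i = d - Suc (Suc J)" "d + 2 - i = d - Suc J" using 2 J by auto
    have L: "Lsub d (i - 1) = {x \<in> VC d. Lcond d (Suc J) x}" using Lsub_eq[OF J(1)] 2 by (simp del: Lsub.simps)
    have "\<forall>x\<in>Lsub d (i - 1). nkv d (Suc (Suc J)) x = frestr d i x * ?q x"
      unfolding L frestr_def idx using nkv_Suc_Suc[OF _ J(1)] by (auto simp: power2_eq_square)
    moreover have "\<exists>x\<in>Lsub d (i - 1). ?q x \<noteq> 0"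
      unfolding L using jacobi_point_props[OF assms(1)] J by (intro bexI[of _ "jacobi_point d"]) auto
    ultimately show ?thesis
      unfolding fk_ok_def
      by (intro exI[of _ "nkv d (Suc (Suc J))"] exI[of _ ?q])
        (use assms(3) J in \<open>auto simp: OdC_iff_orth inv intro!: cpoly_nkv cp_mult\<close>)
  qed
qed

text \<open>Along a line, cancelling a denominator becomes cancellation in the integral domain of
  one-variable polynomials.\<close>

lemma cpoly_line:
  assumes "p \<in> cpoly d"
  shows "\<exists>P. \<forall>t. p (\<lambda>w. a w + t * b w) = poly P t"
  using assms
proof (induction rule: cpoly.induct)
  case (cp_const c)
  show ?case by (intro exI[of _ "[:c:]"]) simp
next
  case (cp_var w)
  show ?case by (intro exI[of _ "[:a w, b w:]"]) simp
next
  case (cp_add p q)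
  then obtain P Q where "\<forall>t. p (\<lambda>w. a w + t * b w) = poly P t" "\<forall>t. q (\<lambda>w. a w + t * b w) = poly Q t" by blast
  then show ?case by (intro exI[of _ "P + Q"]) simp
next
  case (cp_mult p q)
  then obtain P Q where "\<forall>t. p (\<lambda>w. a w + t * b w) = poly P t" "\<forall>t. q (\<lambda>w. a w + t * b w) = poly Q t" by blast
  then show ?case by (intro exI[of _ "P * Q"]) simp
qed

lemma cact_line: "cact d A (\<lambda>w. a w + t * b w) = (\<lambda>w. cact d A a w + t * cact d A b w)"
proof
  fix w
  have skew_line: "skew (\<lambda>w. a w + t * b w) k l = skew a k l + t * skew b k l" for k l
    by (simp add: skew_def)
  show "cact d A (\<lambda>w. a w + t * b w) w = cact d A a w + t * cact d A b w"
  proof (cases "w \<in> VI d")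
    case True
    then show ?thesis
      by (cases rule: VI_cases)
        (simp_all add: cact_single cact_pair skew_line algebra_simps sum.distrib sum_distrib_left)
  qed (simp add: cact_def)
qed

lemma frestr_line: "\<exists>P. \<forall>t. frestr d i (\<lambda>w. a w + t * b w) = poly P t"
proof -
  have "frestr d i (\<lambda>w. a w + t * b w)
    = poly (\<Sum>k=1..d+1-i. [:a [k, d+2-i], b [k, d+2-i]:]\<^sup>2) t" for t
    by (simp add: frestr_def poly_sum)
  then show ?thesis by blast
qed

text \<open>The denominator \<open>q\<close> may vanish at \<open>x\<close> itself, so the restriction identity is transported to \<open>y\<close> along
  a line in \<open>L\<^sup>(\<^sup>i\<^sup>-\<^sup>1\<^sup>)\<close> on which \<open>q\<close> is not identically zero.\<close>
lemma fk_ok_frestr_nonzero: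
  assumes ok: "fk_ok d i y" and B: "B \<in> OdC d" and y: "y = cact d B x" and x: "x \<in> Lsub d (i - 1)"
    and convex: "\<And>x x' t. x \<in> Lsub d (i - 1) \<Longrightarrow> x' \<in> Lsub d (i - 1) \<Longrightarrow> (\<lambda>w. x w + t * (x' w - x w)) \<in> Lsub d (i - 1)"
    and sub: "Lsub d (i - 1) \<subseteq> VC d"
  shows "frestr d i x \<noteq> 0"
proof -
  obtain p q where pq: "p \<in> cpoly d" "q \<in> cpoly d"
    and inv: "\<forall>A\<in>OdC d. \<forall>x\<in>VC d. p (cact d A x) * q x = p x * q (cact d A x)"
    and ex: "\<exists>x\<in>Lsub d (i - 1). q x \<noteq> 0"
    and restr: "\<forall>x\<in>Lsub d (i - 1). p x = frestr d i x * q x"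
    and nz: "q y \<noteq> 0" "p y \<noteq> 0"
    using ok unfolding fk_ok_def by blast
  obtain x0 where x0: "x0 \<in> Lsub d (i - 1)" "q x0 \<noteq> 0" using ex by blast
  define b where "b = (\<lambda>w. x0 w - x w)"
  define xt where "xt t = (\<lambda>w. x w + t * b w)" for t
  define yt where "yt t = (\<lambda>w. y w + t * cact d B b w)" for t
  have xtL: "xt t \<in> Lsub d (i - 1)" for t unfolding xt_def b_def by (rule convex[OF x x0(1)])
  have yt: "yt t = cact d B (xt t)" for t unfolding xt_def yt_def y cact_line ..
  obtain Qx where Qx: "\<And>t. q (xt t) = poly Qx t" using cpoly_line[OF pq(2)] unfolding xt_def by metis
  obtain Qy where Qy: "\<And>t. q (yt t) = poly Qy t" using cpoly_line[OF pq(2)] unfolding yt_def by metis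
  obtain Py where Py: "\<And>t. p (yt t) = poly Py t" using cpoly_line[OF pq(1)] unfolding yt_def by metis
  obtain F where F: "\<And>t. frestr d i (xt t) = poly F t" using frestr_line unfolding xt_def by metis
  \<comment> \<open>Invariance under \<open>B\<close> gives p(y_t) q(x_t) = p(x_t) q(y_t), and on
    the slice p(x_t) is the prescribed restriction times q(x_t), so both sides carry the factor
    \<open>Qx\<close>.\<close>
  have "poly (Qx * (F * Qy - Py)) t = 0" for t
  proof -
    have "p (yt t) * q (xt t) = frestr d i (xt t) * q (xt t) * q (yt t)"
    proof -
      have "p (yt t) * q (xt t) = p (xt t) * q (yt t)"
        unfolding yt using inv B xtL[of t] sub by blast
      then show ?thesis using restr xtL[of t] by simp
    qed
    then show ?thesis by (auto simp: Qx Qy Py F algebra_simps)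
  qed
  then have "Qx * (F * Qy - Py) = 0" by (metis poly_all_0_iff_0)
  \<comment> \<open>At t = 1 the line passes through \<open>x0\<close>, where q is nonzero; t = 0,
    used next, is \<open>x\<close> itself.\<close>
  moreover have "Qx \<noteq> 0" using Qx[of 1] x0(2) by (auto simp: xt_def b_def)
  ultimately have "F * Qy = Py" by simp
  then have "frestr d i (xt 0) * q (yt 0) = p (yt 0)" by (simp add: F Qy Py flip: poly_mult)
  then show ?thesis using nz by (auto simp: xt_def yt_def)
qed

text \<open>Reflection in the hyperplane orthogonal to a - s e_r, restricted to the first r
  coordinates so that the remaining basis vectors stay fixed. It sends a to s e_r because s is the
  length of a.\<close>

lemma householder_ex:
  fixes a :: "nat \<Rightarrow> real"
  assumes "r \<in> {1..d}" "(\<Sum>k=1..r. (a k)\<^sup>2) \<noteq> 0"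
  obtains B s where "B \<in> Od d" "s > 0" "\<And>k p. r < k \<or> r < p \<Longrightarrow> B k p = idm d k p"
    "\<And>k. k \<in> {1..r} \<Longrightarrow> (\<Sum>p=1..r. B k p * a p) = (if k = r then s else 0)"
proof -
  define s where "s = sqrt (\<Sum>k=1..r. (a k)\<^sup>2)"
  have ss: "(\<Sum>k=1..r. (a k)\<^sup>2) = s\<^sup>2" unfolding s_def by (simp add: sum_nonneg)
  have s: "s > 0" unfolding s_def using assms(2) by (simp add: order_less_le sum_nonneg)
  define u where "u p = (if p \<in> {1..r} then a p - (if p = r then s else 0) else 0)" for p
  define N where "N = (\<Sum>p=1..d. (u p)\<^sup>2)"
  \<comment> \<open>If a already equals s e_r then \<open>N = 0\<close>, and division by zero gives
    \<kappa> = 0, so \<open>B\<close> is the identity, as it should be.\<close>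
  define \<kappa> where "\<kappa> = 2 / N"
  define B where "B i j = idm d i j - \<kappa> * (u i * u j)" for i j
  have u0: "u p = 0" if "p \<notin> {1..r}" for p using that unfolding u_def by (rule if_not_P)
  have r: "{1..r} \<subseteq> {1..d}" "r \<in> {1..r}" using assms(1) by auto
  have Nr: "N = (\<Sum>p=1..r. (u p)\<^sup>2)"
    unfolding N_def by (rule sum.mono_neutral_right) (use r u0 in auto)
  have ua: "(\<Sum>p=1..r. u p * a p) = s\<^sup>2 - s * a r"
  proof -
    have "(\<Sum>p=1..r. u p * a p) = (\<Sum>p=1..r. (a p)\<^sup>2 - (if p = r then 1 else 0) * (s * a p))"
      by (rule sum.cong) (auto simp: u_def power2_eq_square algebra_simps)
    then show ?thesis using sum_delta_mult[of "{1..r}" r "\<lambda>p. s * a p"] r(2) by (simp add: sum_subtractf ss del: One_nat_def)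
  qed
  \<comment> \<open>Because |a| = s, the square |a - s e_r|^2 is 2 (s^2 - s a_r), twice the product
    of u with a. Hence the reflection moves a by exactly -u.\<close>
  have N2: "N = 2 * (\<Sum>p=1..r. u p * a p)"
  proof -
    have "N = (\<Sum>p=1..r. (a p)\<^sup>2 + (if p = r then 1 else 0) * (s\<^sup>2 - 2 * s * a p))"
      unfolding Nr by (rule sum.cong) (auto simp: u_def power2_eq_square algebra_simps)
    then show ?thesis using sum_delta_mult[of "{1..r}" r "\<lambda>p. s\<^sup>2 - 2 * s * a p"] r(2)
      by (simp add: sum.distrib ss ua del: One_nat_def)
  qed
  have Nu: "\<kappa> * N * u k = 2 * u k" for k
  proof (cases "N = 0")
    case True
    then have "u p = 0" if "p \<in> {1..d}" for p
      using that unfolding N_def by (subst (asm) sum_nonneg_eq_0_iff) auto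
    then have "u k = 0" using u0 r by (cases "k \<in> {1..r}") auto
    then show ?thesis by simp
  qed (simp add: \<kappa>_def)
  have orth: "orth d B"
    unfolding orth_def
  proof (intro conjI ballI)
    show "msupp d B"
      unfolding msupp_def
    proof (intro allI impI)
      fix i j assume "B i j \<noteq> 0"
      then have "idm d i j \<noteq> (0::real) \<or> (u i \<noteq> 0 \<and> u j \<noteq> 0)" unfolding B_def by auto
      moreover have "k \<in> {1..d}" if "u k \<noteq> 0" for k using that u0[of k] r(1) by blast
      moreover have "i \<in> {1..d} \<and> j \<in> {1..d}" if "idm d i j \<noteq> (0::real)"
        using that by (simp add: idm_def split: if_splits)
      ultimately show "i \<in> {1..d} \<and> j \<in> {1..d}" by blast
    qed
  next
    fix i j assume ij: "i \<in> {1..d}" "j \<in> {1..d}"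
    have "(\<Sum>k=1..d. B i k * B j k) = (\<Sum>k=1..d. idm d i k * idm d j k)
        - (\<Sum>k=1..d. (if k = i then 1 else 0) * (\<kappa> * (u j * u k)))
        - (\<Sum>k=1..d. (if k = j then 1 else 0) * (\<kappa> * (u i * u k)))
        + (\<Sum>k=1..d. (\<kappa> * u i) * (\<kappa> * u j) * (u k)\<^sup>2)"
      unfolding sum_subtractf[symmetric] sum.distrib[symmetric]
      by (rule sum.cong) (use ij in \<open>auto simp: B_def idm_def power2_eq_square algebra_simps\<close>)
    also have "\<dots> = idm d i j - \<kappa> * (u j * u i) - \<kappa> * (u i * u j) + (\<kappa> * u i) * (\<kappa> * u j) * N"
    proof -
      have "(\<Sum>k=1..d. (\<kappa> * u i) * (\<kappa> * u j) * (u k)\<^sup>2) = (\<kappa> * u i) * (\<kappa> * u j) * N"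
        unfolding N_def[symmetric] sum_distrib_left[symmetric] ..
      moreover have "(\<Sum>k=1..d. idm d i k * idm d j k) = (idm d i j :: real)"
        using orth_idm[of d, where ?'a = real] ij unfolding orth_def by (auto simp: idm_def)
      ultimately show ?thesis using ij by (simp add: sum_delta_mult del: One_nat_def)
    qed
    also have "\<dots> = idm d i j"
    proof -
      have "(\<kappa> * u i) * (\<kappa> * u j) * N = (\<kappa> * u i) * (\<kappa> * N * u j)" by simp
      also have "\<dots> = (\<kappa> * u i) * (2 * u j)" unfolding Nu ..
      finally show ?thesis by simp
    qed
    finally show "(\<Sum>k=1..d. B i k * B j k) = (if i = j then 1 else 0)" using ij by (simp add: idm_def)
  qed
  have img: "(\<Sum>p=1..r. B k p * a p) = (if k = r then s else 0)" if k: "k \<in> {1..r}" for k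
  proof -
    have "(\<Sum>p=1..r. B k p * a p) = (\<Sum>p=1..r. (if p = k then 1 else 0) * a p) - (\<Sum>p=1..r. (\<kappa> * u k) * (u p * a p))"
      unfolding sum_subtractf[symmetric]
      by (rule sum.cong) (use k r in \<open>auto simp: B_def idm_def algebra_simps\<close>)
    also have "\<dots> = a k - \<kappa> * N * u k / 2"
      using k unfolding sum_distrib_left[symmetric] N2 by (simp add: sum_delta_mult del: One_nat_def)
    also have "\<dots> = a k - u k" unfolding Nu by simp
    finally show ?thesis using k by (auto simp: u_def)
  qed
  show thesis
    by (rule that[of B s]) (use orth s img u0 in \<open>auto simp: Od_iff_orth B_def\<close>)
qed

section \<open>Reaching the cross-section\<close>

text \<open>Intermediate stage on the way to \<open>K_set\<close>: v and the last \<open>J\<close>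
  columns are normalised. At \<open>J = 0\<close> the column conditions are empty, at
  \<open>J = d - 1\<close> they cover everything.\<close>

definition Kcond :: "nat \<Rightarrow> nat \<Rightarrow> (nat list \<Rightarrow> real) \<Rightarrow> bool" where
  "Kcond d J c \<longleftrightarrow> Lcond d J c \<and> c [d] > 0 \<and> (\<forall>l. 2 \<le> l \<and> d - J < l \<and> l \<le> d \<longrightarrow> c [l - 1, l] > 0)"

lemma K_set_iff:
  assumes "2 \<le> d"
  shows "c \<in> K_set d n \<longleftrightarrow> c \<in> cspace d n \<and> Kcond d (d - 1) c"
proof
  assume c: "c \<in> K_set d n"
  have "c [k, l] = 0" if "1 \<le> k \<and> k + 1 < l \<and> l \<le> d" for k l
  proof -
    have "1 \<le> k \<and> k < l - 1 \<and> l - 1 \<le> d - 1" "l - 1 + 1 = l" using that by auto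
    moreover have "c [k, l - 1 + 1] = 0" using c calculation(1) unfolding K_set_def by blast
    ultimately show ?thesis by simp
  qed
  moreover have "c [l - 1, l] > 0" if "2 \<le> l \<and> l \<le> d" for l
  proof -
    have "l - 1 \<in> {1..d-1}" "l - 1 + 1 = l" using that by auto
    moreover have "c [l - 1, l - 1 + 1] > 0" using c calculation(1) unfolding K_set_def by blast
    ultimately show ?thesis by simp
  qed
  ultimately show "c \<in> cspace d n \<and> Kcond d (d - 1) c"
    using c by (auto simp: Kcond_def Lcond_def K_set_def)
next
  assume c: "c \<in> cspace d n \<and> Kcond d (d - 1) c"
  have "c [j, i + 1] = 0" if "1 \<le> j \<and> j < i \<and> i \<le> d - 1" for i j
  proof -
    have "1 \<le> j \<and> j + 1 < i + 1 \<and> i + 1 \<le> d \<and> d - (d - 1) < i + 1" using that by auto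
    then show ?thesis using c unfolding Kcond_def Lcond_def by blast
  qed
  moreover have "c [i, i + 1] > 0" if "i \<in> {1..d-1}" for i
  proof -
    have "2 \<le> i + 1 \<and> d - (d - 1) < i + 1 \<and> i + 1 \<le> d" using that by auto
    then have "c [i + 1 - 1, i + 1] > 0" using c unfolding Kcond_def by blast
    then show ?thesis by simp
  qed
  ultimately show "c \<in> K_set d n"
    using c unfolding K_set_def Kcond_def Lcond_def by blast
qed

lemma Lcond_line:
  "Lcond d J x \<Longrightarrow> Lcond d J x' \<Longrightarrow> Lcond d J (\<lambda>w. x w + t * (x' w - x w))"
  unfolding Lcond_def by simp

lemma Lcond_lvl2C: "Lcond d J c \<Longrightarrow> Lcond d J (lvl2C d c)"
  unfolding Lcond_def lvl2C_def by auto

lemma Od_msupp: "A \<in> Od d \<Longrightarrow> msupp d A"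
  by (simp add: Od_iff_orth orth_def)

lemma act_mtrans_act: "A \<in> Od d \<Longrightarrow> c \<in> cspace d n \<Longrightarrow> act d n (mtrans A) (act d n A c) = c"
  by (simp add: act_mmul Od_msupp mtrans_Od mmul_mtrans_left act_idm)

text \<open>The invariant is known to be nonzero at \<open>z\<close>, while the column belongs to
  the moved point. The transpose of \<open>A\<close> carries that point, which lies in the slice,
  back to \<open>z\<close>.\<close>

lemma U_set_column_nonzero:
  assumes z: "z \<in> U_set d n" and A: "A \<in> Od d" and n: "2 \<le> n" and J: "Suc J < d"
    and L: "Lcond d J (act d n A z)"
  shows "(\<Sum>k=1..d - Suc J. (act d n A z [k, d - J])\<^sup>2) \<noteq> 0"
proof -
  let ?c = "act d n A z"
  let ?B = "\<lambda>i j. complex_of_real (mtrans A i j)"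
  have zc: "z \<in> cspace d n" using z by (simp add: U_set_def)
  have cc: "?c \<in> cspace d n" using act_spec(1)[OF Od_msupp[OF A]] .
  have Leq: "Lsub d (Suc J) = {x \<in> VC d. Lcond d J x}" using Lsub_eq J by simp
  have "frestr d (Suc (Suc J)) (lvl2C d ?c) \<noteq> 0"
  proof (rule fk_ok_frestr_nonzero)
    show "fk_ok d (Suc (Suc J)) (lvl2C d z)" using z J by (auto simp: U_set_def)
    show "?B \<in> OdC d" using orth_complex_of_real mtrans_Od[OF A] by (simp add: OdC_iff_orth Od_iff_orth)
    show "lvl2C d z = cact d ?B (lvl2C d ?c)"
      using lvl2C_act[OF Od_msupp[OF mtrans_Od[OF A]] cc n] act_mtrans_act[OF A zc] by simp
    show "lvl2C d ?c \<in> Lsub d (Suc (Suc J) - 1)"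
      using Leq L lvl2C_VC Lcond_lvl2C by (auto simp del: Lsub.simps)
    show "Lsub d (Suc (Suc J) - 1) \<subseteq> VC d" using Leq by (auto simp del: Lsub.simps)
    fix x x' :: "nat list \<Rightarrow> complex" and t
    assume "x \<in> Lsub d (Suc (Suc J) - 1)" "x' \<in> Lsub d (Suc (Suc J) - 1)"
    then show "(\<lambda>w. x w + t * (x' w - x w)) \<in> Lsub d (Suc (Suc J) - 1)"
      using Leq Lcond_line by (auto simp: VC_def simp del: Lsub.simps)
  qed
  moreover have "frestr d (Suc (Suc J)) (lvl2C d ?c)
      = complex_of_real (\<Sum>k=1..d - Suc J. (?c [k, d - J])\<^sup>2)"
    unfolding frestr_def of_real_sum
    by (rule sum.cong) (use J in \<open>auto simp: lvl2C_def VI_pair\<close>)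
  ultimately show ?thesis by (metis of_real_0)
qed

lemma U_set_reach_base:
  assumes z: "z \<in> U_set d n" and "2 \<le> d" "2 \<le> n"
  obtains A where "A \<in> Od d" "Kcond d 0 (act d n A z)"
proof -
  have "d \<in> {1..d}" "(\<Sum>k=1..d. (z [k])\<^sup>2) \<noteq> 0" using assms by (auto simp: U_set_def)
  then obtain B s where B: "B \<in> Od d" "s > 0"
    "\<And>k. k \<in> {1..d} \<Longrightarrow> (\<Sum>p=1..d. B k p * z [p]) = (if k = d then s else 0)"
    by (rule householder_ex[of d d "\<lambda>k. z [k]"]) blast
  have "act d n B z [k] = (if k = d then s else 0)" if "k \<in> {1..d}" for k
    using lvrel_act[OF Od_msupp[OF B(1)], of z n] B(3)[OF that] that assms
    by (auto simp: lvrel_def U_set_def)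
  then have "Kcond d 0 (act d n B z)"
    using B(2) assms(2) by (auto simp: Kcond_def Lcond_def)
  then show thesis using that B(1) by blast
qed

text \<open>The reflection fixes e_k for k > r. So it preserves v and the columns beyond
  \<open>m\<close>, and turns the part of column \<open>m\<close> above the diagonal into a positive
  multiple of e_r.\<close>

lemma U_set_reach_step:
  assumes z: "z \<in> U_set d n" and n: "2 \<le> n" and J: "Suc J < d"
    and A: "A \<in> Od d" "Kcond d J (act d n A z)"
  obtains A' where "A' \<in> Od d" "Kcond d (Suc J) (act d n A' z)"
proof -
  define c where "c = act d n A z"
  define m where "m = d - J"
  define r where "r = d - Suc J"
  have r: "r \<in> {1..d}" "m = Suc r" "m \<in> {1..d}" using J by (auto simp: r_def m_def)
  have L: "Lcond d J c" and pos: "c [d] > 0" "\<And>l. 2 \<le> l \<Longrightarrow> m < l \<Longrightarrow> l \<le> d \<Longrightarrow> c [l - 1, l] > 0"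
    using A(2) by (auto simp: Kcond_def c_def m_def)
  have cc: "c \<in> cspace d n" unfolding c_def using act_spec(1)[OF Od_msupp[OF A(1)]] .
  have "(\<Sum>k=1..r. (c [k, m])\<^sup>2) \<noteq> 0"
    using U_set_column_nonzero[OF z A(1) n J] A(2) by (simp add: c_def r_def m_def Kcond_def)
  from r(1) this obtain B s where B: "B \<in> Od d" "s > 0"
    and Bid: "\<And>k p. r < k \<or> r < p \<Longrightarrow> B k p = idm d k p"
    and Ba: "\<And>k. k \<in> {1..r} \<Longrightarrow> (\<Sum>p=1..r. B k p * c [p, m]) = (if k = r then s else 0)"
    by (rule householder_ex[of r d "\<lambda>k. c [k, m]"]) blast
  define c' where "c' = act d n B c"
  have rel: "lvrel d B c c'" unfolding c'_def by (rule lvrel_act[OF Od_msupp[OF B(1)] cc n])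
  have v: "c' [k] = idm d k d * c [d]" if "k \<in> {1..d}" for k
  proof -
    have "c' [k] = (\<Sum>j=1..d. B k j * c [j])" using rel that by (simp add: lvrel_def)
    also have "\<dots> = B k d * c [d]"
      by (rule sum_single) (use L J in \<open>auto simp: Lcond_def\<close>)
    finally show ?thesis using Bid[of k d] J r_def by simp
  qed
  \<comment> \<open>For \<open>l > r\<close> row \<open>l\<close> of \<open>B\<close> is a unit
    vector, so the right-hand factor of B M B^T does not affect column \<open>l\<close>.\<close>
  have col: "c' [k, l] = (\<Sum>p=1..d. B k p * skew c p l)" if "1 \<le> k" "k < l" "l \<le> d" "m \<le> l" for k l
  proof -
    have "c' [k, l] = skew c' k l" using that by (simp add: skew_def)
    also have "\<dots> = (\<Sum>p=1..d. \<Sum>q=1..d. B k p * skew c p q * B l q)"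
      using rel that unfolding lvrel_def by (simp del: One_nat_def)
    also have "\<dots> = (\<Sum>p=1..d. B k p * skew c p l)"
    proof (rule sum.cong[OF refl])
      fix p
      have "(\<Sum>q=1..d. B k p * skew c p q * B l q) = B k p * skew c p l * B l l"
        by (rule sum_single) (use that r Bid[of l] in \<open>auto simp: idm_def\<close>)
      also have "B l l = 1" using Bid[of l l] that r by (auto simp: idm_def)
      finally show "(\<Sum>q=1..d. B k p * skew c p q * B l q) = B k p * skew c p l" by simp
    qed
    finally show ?thesis .
  qed
  \<comment> \<open>A column beyond \<open>m\<close> is already zero in rows up to \<open>r\<close>,
    the only rows that \<open>B\<close> mixes.\<close>
  have keep: "c' [k, l] = c [k, l]" if kl: "1 \<le> k" "k < l" "l \<le> d" "m < l" for k l
  proof -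
    have eq: "B k p * skew c p l = (if p = k then 1 else 0) * skew c p l" if p: "p \<in> {1..d}" for p
    proof (cases "r < p")
      case True
      then show ?thesis using Bid[of k p] kl p by (auto simp: idm_def)
    next
      case False
      then have "1 \<le> p \<and> p + 1 < l \<and> l \<le> d \<and> d - J < l" using p kl r m_def by auto
      then have "c [p, l] = 0" using L unfolding Lcond_def by blast
      then show ?thesis using False kl r by (simp add: skew_def)
    qed
    have "c' [k, l] = (\<Sum>p=1..d. B k p * skew c p l)" by (rule col) (use kl in auto)
    also have "\<dots> = (\<Sum>p=1..d. (if p = k then 1 else 0) * skew c p l)"
      by (rule sum.cong[OF refl eq])
    also have "\<dots> = skew c k l" by (rule sum_delta_mult) (use kl in auto)
    finally show ?thesis using kl by (simp add: skew_def)
  qed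
  have new: "c' [k, m] = (if k = r then s else 0)" if k: "1 \<le> k" "k < m" for k
  proof -
    have "c' [k, m] = (\<Sum>p=1..d. B k p * skew c p m)" using col[of k m] k r by auto
    also have "\<dots> = (\<Sum>p=1..r. B k p * c [p, m])"
      by (rule sum.mono_neutral_cong_right)
        (use r k Bid in \<open>auto simp: idm_def skew_def\<close>)
    finally show ?thesis using Ba[of k] k r by auto
  qed
  have "Kcond d (Suc J) c'"
    unfolding Kcond_def Lcond_def
  proof (intro conjI ballI allI impI)
    show "c' [k] = 0" if "k \<in> {1..d - 1}" for k using v[of k] that by (auto simp: idm_def)
    show "c' [d] > 0" using v[of d] pos(1) J by (auto simp: idm_def)
    show "c' [k, l] = 0" if kl: "1 \<le> k \<and> k + 1 < l \<and> l \<le> d \<and> d - Suc J < l" for k l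
    proof (cases "l = m")
      case True
      then show ?thesis using new[of k] kl r by auto
    next
      case False
      then have "m < l" using kl r r_def by auto
      moreover have "c [k, l] = 0"
        using L kl \<open>m < l\<close> unfolding Lcond_def m_def by blast
      ultimately show ?thesis using keep[of k l] kl by auto
    qed
    show "c' [l - 1, l] > 0" if l: "2 \<le> l \<and> d - Suc J < l \<and> l \<le> d" for l
    proof (cases "l = m")
      case True
      then show ?thesis using new[of r] r B(2) by auto
    next
      case False
      then have "m < l" using l r r_def by auto
      then show ?thesis using keep[of "l - 1" l] pos(2)[of l] l by auto
    qed
  qed
  moreover have "c' = act d n (mmul d B A) z"
    unfolding c'_def c_def by (rule act_mmul[OF Od_msupp[OF B(1)] Od_msupp[OF A(1)]])
  ultimately show thesis using that mmul_Od[OF B(1) A(1)] by metis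
qed

lemma U_set_reach:
  assumes "z \<in> U_set d n" "2 \<le> d" "2 \<le> n"
  obtains A where "A \<in> Od d" "act d n A z \<in> K_set d n"
proof -
  have "J < d \<Longrightarrow> \<exists>A\<in>Od d. Kcond d J (act d n A z)" for J
  proof (induction J)
    case 0
    then show ?case using U_set_reach_base[OF assms] by blast
  next
    case (Suc J)
    then obtain A where "A \<in> Od d" "Kcond d J (act d n A z)" by auto
    then show ?case using U_set_reach_step[OF assms(1,3) Suc.prems] by blast
  qed
  from this[of "d - 1"] obtain A where A: "A \<in> Od d" "Kcond d (d - 1) (act d n A z)" using assms(2) by auto
  then have "act d n A z \<in> K_set d n"
    using K_set_iff[OF assms(2)] act_spec(1)[OF Od_msupp[OF A(1)]] by blast
  then show thesis using that A(1) by blast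
qed

lemma K_set_kv:
  assumes "c \<in> K_set d n" "2 \<le> d" "j < d"
  shows "kv d j c (d - j) > 0" "i \<in> {1..d} \<Longrightarrow> i \<noteq> d - j \<Longrightarrow> kv d j c i = 0"
    "nkv d j c = (kv d j c (d - j))\<^sup>2"
proof -
  have L: "Lcond d (d - 1) c" using assms K_set_iff by (auto simp: Kcond_def)
  show "kv d j c (d - j) > 0"
    by (rule kv_diag_positive[OF L _ _ assms(3)]) (use assms(1) in \<open>auto simp: K_set_def\<close>)
  show "i \<in> {1..d} \<Longrightarrow> i \<noteq> d - j \<Longrightarrow> kv d j c i = 0"
    using kv_diag[OF L, of j i] assms by auto
  show "nkv d j c = (kv d j c (d - j))\<^sup>2"
    using nkv_diag[OF L, of j] assms by auto
qed

lemma nkv_act: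
  "A \<in> Od d \<Longrightarrow> c \<in> cspace d n \<Longrightarrow> 2 \<le> n \<Longrightarrow> nkv d j (act d n A c) = nkv d j c"
  by (rule nkv_invariant[of d A]) (auto simp: Od_iff_orth Od_msupp intro: lvrel_act)

text \<open>From left to right the point is moved into \<open>K_set\<close>, where positivity is
  visible, and invariance carries it back. From right to left the norms supply representations of
  all f_i. The quantifier over representations disappears, which makes openness provable.\<close>

lemma U_set_iff:
  assumes "2 \<le> d" "2 \<le> n"
  shows "z \<in> U_set d n \<longleftrightarrow> z \<in> cspace d n \<and> (\<forall>j<d. nkv d j z > 0)"
proof
  assume z: "z \<in> U_set d n"
  then have zc: "z \<in> cspace d n" by (simp add: U_set_def)
  obtain A where A: "A \<in> Od d" "act d n A z \<in> K_set d n" using U_set_reach[OF z assms] .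
  have "nkv d j z > 0" if "j < d" for j
    using K_set_kv(1,3)[OF A(2) assms(1) that] nkv_act[OF A(1) zc assms(2), of j] by simp
  then show "z \<in> cspace d n \<and> (\<forall>j<d. nkv d j z > 0)" using zc by blast
next
  assume z: "z \<in> cspace d n \<and> (\<forall>j<d. nkv d j z > 0)"
  then have "fk_ok d i (lvl2C d z)" if "i \<in> {2..d}" for i
    using that assms(1) by (intro fk_okI) (auto simp: nkv_lvl2C)
  moreover have "nkv d 0 z \<noteq> 0" using z assms(1) by (metis less_irrefl less_le_trans pos2)
  then have "(\<Sum>i=1..d. (z [i])\<^sup>2) \<noteq> 0" by (simp add: nkv_def dot_def power2_eq_square)
  ultimately show "z \<in> U_set d n" using z by (simp add: U_set_def)
qed

lemma K_set_subset_U_set: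
  assumes "2 \<le> d" "2 \<le> n"
  shows "K_set d n \<subseteq> U_set d n"
proof
  fix c assume c: "c \<in> K_set d n"
  then have "nkv d j c > 0" if "j < d" for j
    using K_set_kv(1,3)[OF c assms(1) that] by simp
  then show "c \<in> U_set d n" using c U_set_iff[OF assms] by (auto simp: K_set_def)
qed

section \<open>The moving frame\<close>

definition frame :: "nat \<Rightarrow> (nat list \<Rightarrow> real) \<Rightarrow> rmat" where
  "frame d z = (\<lambda>i j. if i \<in> {1..d} \<and> j \<in> {1..d}
     then kv d (d - i) z j * (1 / sqrt (nkv d (d - i) z)) else 0)"

text \<open>At the moved point w_{d-i} is \<gamma> e_i with \<gamma> > 0. Pulling back by the
  transpose of \<open>g\<close> gives \<gamma> times row \<open>i\<close> of \<open>g\<close>, and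
  \<gamma> is the invariant norm.\<close>

lemma frame_unique:
  assumes "2 \<le> d" "2 \<le> n" "z \<in> cspace d n" "g \<in> Od d" "act d n g z \<in> K_set d n"
  shows "g = frame d z"
proof (intro ext)
  fix i j
  show "g i j = frame d z i j"
  proof (cases "i \<in> {1..d} \<and> j \<in> {1..d}")
    case True
    define y where "y = act d n g z"
    define \<gamma> where "\<gamma> = kv d (d - i) y i"
    have orth: "orth d g" using assms(4) by (simp add: Od_iff_orth)
    have rel: "lvrel d g z y" unfolding y_def by (rule lvrel_act[OF Od_msupp[OF assms(4)] assms(3,2)])
    have i: "d - i < d" "d - (d - i) = i" using True by auto
    have \<gamma>: "\<gamma> > 0" "nkv d (d - i) z = \<gamma>\<^sup>2"
      using K_set_kv(1,3)[OF assms(5,1) i(1)] nkv_act[OF assms(4,3,2), of "d - i"] i(2)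
      unfolding \<gamma>_def y_def by simp_all
    have "kv d (d - i) z j = (\<Sum>m=1..d. g m j * kv d (d - i) y m)"
      by (rule orth_inverse[symmetric, OF orth kv_equivariant[OF orth rel]]) (use True in auto)
    also have "\<dots> = g i j * \<gamma>"
      unfolding \<gamma>_def
      by (rule sum_single) (use True K_set_kv(2)[OF assms(5,1) i(1)] i(2) in \<open>auto simp: y_def\<close>)
    finally show ?thesis using True \<gamma> by (simp add: frame_def)
  next
    case False
    then show ?thesis using Od_msupp[OF assms(4)] by (auto simp: msupp_def frame_def)
  qed
qed

text \<open>Orthogonality is inherited from the group element produced by the reflections, which
  uniqueness identifies with the frame.\<close>

lemma frame_U_set:
  assumes "2 \<le> d" "2 \<le> n" "z \<in> U_set d n"
  shows "frame d z \<in> Od d" "act d n (frame d z) z \<in> K_set d n"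
proof -
  obtain A where A: "A \<in> Od d" "act d n A z \<in> K_set d n" using U_set_reach[OF assms(3,1,2)] .
  have "A = frame d z" by (rule frame_unique[OF assms(1,2) _ A]) (use assms(3) in \<open>simp add: U_set_def\<close>)
  then show "frame d z \<in> Od d" "act d n (frame d z) z \<in> K_set d n" using A by auto
qed

text \<open>The right-hand side carries the moved point where the frame carries \<open>z\<close>,
  hence into \<open>K_set\<close>; uniqueness does the rest.\<close>

lemma frame_equivariant:
  assumes "2 \<le> d" "2 \<le> n" "z \<in> U_set d n" "g \<in> Od d"
  shows "frame d (act d n g z) = mmul d (frame d z) (mtrans g)"
proof (rule frame_unique[symmetric, OF assms(1,2)])
  note f = frame_U_set[OF assms(1-3)]
  have zc: "z \<in> cspace d n" using assms(3) by (simp add: U_set_def)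
  show "act d n g z \<in> cspace d n" using act_spec(1)[OF Od_msupp[OF assms(4)]] .
  show "mmul d (frame d z) (mtrans g) \<in> Od d" using f(1) assms(4) by (intro mmul_Od mtrans_Od)
  have "act d n (mmul d (frame d z) (mtrans g)) (act d n g z) = act d n (frame d z) z"
    using act_mmul[OF Od_msupp[OF f(1)] Od_msupp[OF mtrans_Od[OF assms(4)]], symmetric]
      act_mtrans_act[OF assms(4) zc] by simp
  then show "act d n (mmul d (frame d z) (mtrans g)) (act d n g z) \<in> K_set d n" using f(2) by simp
qed

section \<open>Smoothness and transversality\<close>

lemma cspace_eq_fsp: "cspace d n = fsp (lyn_words d n)"
  by (simp add: cspace_def fsp_def)

lemma Ck_diff:
  assumes S: "open_fsp I S" and "Ck k I S f" "Ck k I S g"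
  shows "Ck k I S (\<lambda>x. f x - g x)"
  using Ck_add[OF S assms(2) Ck_mult[OF S Ck_const[OF S, where a = "-1"] assms(3)]] by simp

context
  fixes d n :: nat
  assumes n: "2 \<le> n"
begin

abbreviation (input) "Ckf k \<equiv> Ck k (lyn_words d n) (fsp (lyn_words d n))"

lemma Ck_skew:
  assumes "i \<in> {1..d}" "j \<in> {1..d}"
  shows "Ckf k (\<lambda>x. skew x i j)"
proof -
  note S = open_fsp_UNIV[of "lyn_words d n"]
  consider "i < j" | "i = j" | "j < i" by linarith
  then show ?thesis
  proof cases
    case 1
    then have "Ckf k (\<lambda>x. x [i, j])" using assms by (intro Ck_coord[OF S]) (simp add: lyn_words_pair[OF n])
    then show ?thesis using 1 by (simp add: skew_def)
  next
    case 2 then show ?thesis by (simp add: skew_def Ck_const[OF S])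
  next
    case 3
    then have "Ckf k (\<lambda>x. x [j, i])" using assms by (intro Ck_coord[OF S]) (simp add: lyn_words_pair[OF n])
    then have "Ckf k (\<lambda>x. - 1 * x [j, i])" by (intro Ck_mult[OF S] Ck_const[OF S])
    then show ?thesis using 3 by (simp add: skew_def)
  qed
qed

lemma Ck_mv:
  assumes "\<And>m. m \<in> {1..d} \<Longrightarrow> Ckf k (\<lambda>x. u x m)" "i \<in> {1..d}"
  shows "Ckf k (\<lambda>x. mv d x (u x) i)"
  unfolding mv_def using assms
  by (intro Ck_sum[OF open_fsp_UNIV] Ck_mult[OF open_fsp_UNIV] Ck_skew) auto

lemma Ck_dot:
  assumes "\<And>m. m \<in> {1..d} \<Longrightarrow> Ckf k (\<lambda>x. u x m)" "\<And>m. m \<in> {1..d} \<Longrightarrow> Ckf k (\<lambda>x. w x m)"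
  shows "Ckf k (\<lambda>x. dot d (u x) (w x))"
  unfolding dot_def using assms
  by (intro Ck_sum[OF open_fsp_UNIV] Ck_mult[OF open_fsp_UNIV]) auto

lemma Ck_kv: "i \<in> {1..d} \<Longrightarrow> Ckf k (\<lambda>x. kv d j x i)"
proof (induction j arbitrary: i rule: less_induct)
  case (less j)
  note S = open_fsp_UNIV[of "lyn_words d n"]
  have v: "Ckf k (\<lambda>x. x [m])" if "m \<in> {1..d}" for m
    using that n by (intro Ck_coord[OF S]) (simp add: lyn_words_single)
  consider "j = 0" | "j = 1" | m where "j = Suc (Suc m)"
    by (cases j; cases "j - 1") auto
  then show ?case
  proof cases
    case 1 then show ?thesis using v less.prems by simp
  next
    case 2 then show ?thesis using Ck_mv[of k "\<lambda>x i. x [i]"] v less.prems by simp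
  next
    case 3
    then have k: "Ckf k (\<lambda>x. kv d m x i)" "Ckf k (\<lambda>x. kv d (Suc m) x i)" if "i \<in> {1..d}" for i
      using less.IH that by auto
    show ?thesis unfolding 3 kv.simps
      by (intro Ck_diff[OF S] Ck_mult[OF S] Ck_dot Ck_mv k less.prems)
  qed
qed

lemma Ck_nkv: "Ckf k (nkv d j)"
  unfolding nkv_def[abs_def] by (rule Ck_dot) (rule Ck_kv, assumption)+

end

lemma U_set_eq_fsp:
  assumes "2 \<le> d" "2 \<le> n"
  shows "U_set d n = {x \<in> fsp (lyn_words d n). \<forall>j\<in>{..<d}. nkv d j x > 0}"
  using U_set_iff[OF assms] by (auto simp: cspace_eq_fsp)

lemma open_U_set:
  assumes "2 \<le> d" "2 \<le> n"
  shows "open_fsp (lyn_words d n) (U_set d n)"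
  unfolding U_set_eq_fsp[OF assms]
  by (rule open_fsp_finite_positive) (auto intro: Ck_cont[OF Ck_nkv[OF assms(2), of 0]])

lemma smooth_frame:
  assumes "2 \<le> d" "2 \<le> n" "i \<in> {1..d}" "j \<in> {1..d}"
  shows "smooth_on_fsp (lyn_words d n) (U_set d n) (\<lambda>z. frame d z i j)"
proof (rule smooth_on_fspI)
  fix k
  note S = open_U_set[OF assms(1,2)]
  have sub: "U_set d n \<subseteq> fsp (lyn_words d n)" using U_set_eq_fsp[OF assms(1,2)] by auto
  have "Ck k (lyn_words d n) (U_set d n) (\<lambda>z. kv d (d - i) z j * (1 / sqrt (nkv d (d - i) z)))"
  proof (intro Ck_mult[OF S] Ck_rsqrt[OF S])
    show "Ck k (lyn_words d n) (U_set d n) (\<lambda>z. kv d (d - i) z j)"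
      by (rule Ck_subset[OF Ck_kv[OF assms(2,4)] sub])
    show "Ck k (lyn_words d n) (U_set d n) (\<lambda>z. nkv d (d - i) z)"
      by (rule Ck_subset[OF Ck_nkv[OF assms(2)] sub])
    show "nkv d (d - i) z > 0" if "z \<in> U_set d n" for z
      using that U_set_eq_fsp[OF assms(1,2)] assms(3) by auto
  qed
  then show "Ck k (lyn_words d n) (U_set d n) (\<lambda>z. frame d z i j)"
    using assms(3,4) by (simp add: frame_def)
qed

lemma moving_frame_frame:
  assumes "2 \<le> d" "2 \<le> n"
  shows "moving_frame d n (U_set d n) (frame d)"
  unfolding moving_frame_def
  using frame_U_set(1)[OF assms] smooth_frame[OF assms] frame_equivariant[OF assms] by blast

text \<open>An open set cut by a coordinate subspace: the identity serves as one chart around every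
  point.\<close>

lemma submanifold_K_set:
  assumes "2 \<le> d" "2 \<le> n"
  shows "submanifold_fsp (lyn_words d n) (K_set d n)"
proof -
  let ?I = "lyn_words d n"
  let ?W = "insert [d] ((\<lambda>i. [i, i + 1]) ` {1..d-1})"
  let ?Z = "{[i] |i. i \<in> {1..d-1}} \<union> {[j, i + 1] |i j. 1 \<le> j \<and> j < i \<and> i \<le> d - 1}"
  define V where "V = {x \<in> fsp ?I. \<forall>w\<in>?W. x w > 0}"
  define L where "L = {x \<in> fsp ?I. \<forall>w\<in>?Z. x w = 0}"
  have "?W \<subseteq> ?I" using assms by (auto simp: lyn_words_single lyn_words_pair)
  then have V: "open_fsp ?I V"
    unfolding V_def by (intro open_fsp_finite_positive) (auto intro: cont_on_fsp_coord)
  have L: "lin_subspace_fsp ?I L"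
    unfolding lin_subspace_fsp_def L_def fsp_def by auto
  have K: "K_set d n = V \<inter> L"
    unfolding K_set_def V_def L_def cspace_eq_fsp by auto
  have id: "smooth_map_fsp ?I ?I V (\<lambda>x. x)"
    unfolding smooth_map_fsp_def using V
    by (auto simp: open_fsp_def intro!: smooth_on_fspI Ck_coord[OF V])
  have "\<exists>V \<phi> \<psi> L. open_fsp ?I V \<and> p \<in> V \<and> open_fsp ?I (\<phi> ` V) \<and>
      smooth_map_fsp ?I ?I V \<phi> \<and> smooth_map_fsp ?I ?I (\<phi> ` V) \<psi> \<and>
      (\<forall>x\<in>V. \<psi> (\<phi> x) = x) \<and> lin_subspace_fsp ?I L \<and> \<phi> ` (K_set d n \<inter> V) = \<phi> ` V \<inter> L"
    if "p \<in> K_set d n" for p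
    by (rule exI[of _ V], rule exI[of _ "\<lambda>x. x"], rule exI[of _ "\<lambda>x. x"], rule exI[of _ L])
      (use that K V L id in auto)
  moreover have "K_set d n \<subseteq> fsp ?I" by (auto simp: K_set_def cspace_eq_fsp)
  ultimately show ?thesis unfolding submanifold_fsp_def by blast
qed

section \<open>Differentiability along curves\<close>

lemma differentiable_mv:
  fixes c :: "real \<Rightarrow> nat list \<Rightarrow> real"
  assumes "\<And>w. (\<lambda>t. c t w) differentiable (at 0)" "\<And>m. (\<lambda>t. u t m) differentiable (at 0)"
  shows "(\<lambda>t. mv d (c t) (u t) i) differentiable (at 0)"
proof -
  have "(\<lambda>t. skew (c t) i m) differentiable (at 0)" for m
    unfolding skew_def by (cases "i < m"; cases "m < i") (auto intro!: differentiable_minus assms)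
  then show ?thesis
    unfolding mv_def
    by (intro differentiable_sum ballI differentiable_mult assms finite_atLeastAtMost)
qed

text \<open>\<open>smooth_on_fsp\<close> speaks of derivatives along coordinate lines, while
  transversality differentiates along other curves. These derivatives are obtained from the
  polynomial recursion itself, with no chain rule in several variables.\<close>

lemma differentiable_kv:
  fixes c :: "real \<Rightarrow> nat list \<Rightarrow> real"
  assumes "\<And>w. (\<lambda>t. c t w) differentiable (at 0)"
  shows "(\<lambda>t. kv d j (c t) i) differentiable (at 0)"
proof (induction j arbitrary: i rule: less_induct)
  case (less j)
  consider "j = 0" | "j = 1" | m where "j = Suc (Suc m)"
    by (cases j; cases "j - 1") auto
  then show ?case
  proof cases
    case 1 then show ?thesis using assms by simp
  next
    case 2 then show ?thesis using differentiable_mv[OF assms, of "\<lambda>t i. c t [i]"] assms by simp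
  next
    case 3
    then have k: "(\<lambda>t. kv d m (c t) i) differentiable (at 0)" "(\<lambda>t. kv d (Suc m) (c t) i) differentiable (at 0)" for i
      using less.IH by auto
    show ?thesis unfolding 3 kv.simps dot_def
      by (intro differentiable_diff differentiable_mult differentiable_sum ballI differentiable_mv k assms finite_atLeastAtMost)
  qed
qed

lemma differentiable_frame:
  fixes c :: "real \<Rightarrow> nat list \<Rightarrow> real"
  assumes c: "\<And>w. (\<lambda>t. c t w) differentiable (at 0)" and "2 \<le> d" "2 \<le> n" "c 0 \<in> U_set d n"
  shows "(\<lambda>t. frame d (c t) i j) differentiable (at 0)"
proof (cases "i \<in> {1..d} \<and> j \<in> {1..d}")
  case True
  have pos: "nkv d (d - i) (c 0) > 0" using U_set_iff[OF assms(2,3)] assms(4) True by auto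
  have "(\<lambda>t. nkv d (d - i) (c t)) differentiable (at 0)"
    unfolding nkv_def dot_def
    by (intro differentiable_mult differentiable_sum ballI differentiable_kv c finite_atLeastAtMost)
  then obtain D where "((\<lambda>t. nkv d (d - i) (c t)) has_real_derivative D) (at 0)"
    by (auto simp: real_differentiable_def)
  from DERIV_chain2[OF DERIV_real_sqrt[OF pos] this]
  have "(\<lambda>t. sqrt (nkv d (d - i) (c t))) differentiable (at 0)"
    by (auto simp: real_differentiable_def)
  then have "(\<lambda>t. kv d (d - i) (c t) j * (1 / sqrt (nkv d (d - i) (c t)))) differentiable (at 0)"
    using pos by (intro differentiable_mult differentiable_divide differentiable_kv c) auto
  then show ?thesis using True by (simp add: frame_def)
next
  case False
  then show ?thesis by (auto simp: frame_def)
qed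

lemma differentiable_tact:
  assumes "\<And>i j. (\<lambda>t::real. A t i j) differentiable (at 0)"
  shows "(\<lambda>t. tact d (A t) x w) differentiable (at 0)"
  by (induction w arbitrary: x)
    (auto intro!: differentiable_sum differentiable_mult assms)

text \<open>The unitriangular system is solved in lexicographic order: each coordinate is a tensor
  entry minus a combination of earlier coordinates.\<close>

lemma differentiable_coords:
  assumes "\<And>t. c t \<in> cspace d n" "\<And>w. (\<lambda>t::real. lembed d n (c t) w) differentiable (at 0)"
  shows "(\<lambda>t. c t h) differentiable (at 0)"
proof (induction h rule: lyn_words_lex_induct[of d n])
  case (less h)
  show ?case
  proof (cases "h \<in> lyn_words d n")
    case True
    have "c t h = lembed d n (c t) h - (\<Sum>g\<in>{g \<in> lyn_words d n. lex_less g h}. c t g * lyn_basis n g h)" for t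
      using lembed_coord[OF True, of "c t"] by simp
    moreover have "(\<lambda>t. lembed d n (c t) h - (\<Sum>g\<in>{g \<in> lyn_words d n. lex_less g h}. c t g * lyn_basis n g h)) differentiable (at 0)"
      by (intro differentiable_diff assms differentiable_sum ballI differentiable_mult differentiable_const)
        (use less finite_lyn_words in auto)
    ultimately show ?thesis by simp
  next
    case False
    then have "c t h = 0" for t using assms(1) by (simp add: cspace_def)
    then show ?thesis by simp
  qed
qed

lemma differentiable_act:
  assumes "\<And>i j. (\<lambda>t::real. A t i j) differentiable (at 0)" "\<And>t. msupp d (A t)"
  shows "(\<lambda>t. act d n (A t) c h) differentiable (at 0)"
proof (rule differentiable_coords)
  show "act d n (A t) c \<in> cspace d n" for t by (rule act_spec(1)[OF assms(2)])
  show "(\<lambda>t. lembed d n (act d n (A t) c) w) differentiable (at 0)" for w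
    unfolding act_spec(2)[OF assms(2)] by (rule differentiable_tact[OF assms(1)])
qed

lemma line_eventually_in_open:
  assumes "open_fsp I S" "finite I" "k \<in> S" "v \<in> fsp I"
  shows "eventually (\<lambda>t. (\<lambda>h. k h + t * v h) \<in> S) (nhds 0)"
proof -
  obtain e where e: "e > 0" "\<And>y. y \<in> fsp I \<Longrightarrow> (\<forall>i\<in>I. \<bar>y i - k i\<bar> < e) \<Longrightarrow> y \<in> S"
    using assms unfolding open_fsp_def by blast
  have kf: "k \<in> fsp I" using assms unfolding open_fsp_def by blast
  \<comment> \<open>The sum bounds all coordinates of \<open>v\<close> at once; adding 1 keeps
    \<open>M\<close> positive when \<open>v\<close> is zero.\<close>
  define M where "M = (\<Sum>i\<in>I. \<bar>v i\<bar>) + 1"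
  have M: "M > 0" "\<And>i. i \<in> I \<Longrightarrow> \<bar>v i\<bar> \<le> M"
    unfolding M_def using member_le_sum[of _ I "\<lambda>i. \<bar>v i\<bar>"] assms(2)
    by (auto simp: add_nonneg_pos sum_nonneg add_increasing2)
  have "(\<lambda>h. k h + t * v h) \<in> S" if "dist t 0 < e / M" for t
  proof (rule e(2))
    show "(\<lambda>h. k h + t * v h) \<in> fsp I" using kf assms(4) by (simp add: fsp_def)
    have t: "\<bar>t\<bar> * M < e" using that M(1) by (simp add: pos_less_divide_eq)
    have "\<bar>t\<bar> * \<bar>v i\<bar> < e" if "i \<in> I" for i
      using mult_left_mono[OF M(2)[OF that], of "\<bar>t\<bar>"] t by simp
    then show "\<forall>i\<in>I. \<bar>k i + t * v i - k i\<bar> < e" by (simp add: abs_mult)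
  qed
  then show ?thesis unfolding eventually_nhds_metric using e(1) M(1) by (meson divide_pos_pos)
qed

text \<open>Write \<open>k + t v = A(t) \<kappa>(t)\<close> with \<open>\<kappa>(t) \<in> \<K>\<close> and \<open>A(t)\<close> the inverse of the frame, and differentiate at
  \<open>t = 0\<close>: the two terms of the product rule are tangent to \<open>\<K>\<close> and to the orbit.\<close>
lemma transversal_K_set:
  assumes d: "2 \<le> d" and n: "2 \<le> n" and k: "k \<in> K_set d n" and v: "v \<in> fsp (lyn_words d n)"
  shows "\<exists>u\<in>tangent_fsp (lyn_words d n) (K_set d n) k.
    \<exists>w\<in>tangent_fsp (lyn_words d n) (orbit_of (Od d) (act d n) k) k. v = (\<lambda>i. u i + w i)"
proof -
  let ?I = "lyn_words d n"
  define \<gamma> where "\<gamma> t = (\<lambda>h. k h + t * v h)" for t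
  have kU: "k \<in> U_set d n" using K_set_subset_U_set[OF d n] k by blast
  have kc: "k \<in> cspace d n" using k by (simp add: K_set_def)
  have \<gamma>0: "\<gamma> 0 = k" by (simp add: \<gamma>_def)
  have \<gamma>c: "\<gamma> t \<in> cspace d n" for t using kc v by (simp add: \<gamma>_def cspace_def fsp_def)
  have ev: "eventually (\<lambda>t. \<gamma> t \<in> U_set d n) (nhds 0)"
    unfolding \<gamma>_def using line_eventually_in_open[OF open_U_set[OF d n] finite_lyn_words kU v] .
  have \<gamma>D: "((\<lambda>t. \<gamma> t h) has_real_derivative v h) (at 0)" for h
    unfolding \<gamma>_def by (auto intro!: derivative_eq_intros)
  have \<gamma>diff: "(\<lambda>t. \<gamma> t h) differentiable (at 0)" for h
    using \<gamma>D by (auto simp: real_differentiable_def)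
  \<comment> \<open>The identity already carries \<open>k\<close> into \<open>K_set\<close>, so by
    uniqueness it is the frame at \<open>k\<close>.\<close>
  have frame_k: "frame d k = idm d"
    using frame_unique[OF d n kc, of "idm d"] k act_idm[OF kc] orth_idm[of d, where ?'a = real]
    by (simp add: Od_iff_orth)
  \<comment> \<open>\<open>tangent_fsp\<close> asks for curves that stay in the set for all t. Where
    the line has left \<open>U_set\<close>, the identity, and below the point \<open>k\<close>, fill
    in; near 0 nothing changes.\<close>
  define C where "C t = (if \<gamma> t \<in> U_set d n then frame d (\<gamma> t) else idm d)" for t
  have C: "C t \<in> Od d" for t
    using frame_U_set(1)[OF d n] orth_idm[of d, where ?'a = real] by (simp add: C_def Od_iff_orth)
  have C0: "C 0 = idm d" by (simp add: C_def \<gamma>0 frame_k)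
  have Cdiff: "(\<lambda>t. C t i j) differentiable (at 0)" for i j
  proof -
    obtain D where D: "((\<lambda>t. frame d (\<gamma> t) i j) has_real_derivative D) (at 0)"
      using differentiable_frame[of \<gamma>, OF \<gamma>diff d n] kU \<gamma>0 by (auto simp: real_differentiable_def)
    have "((\<lambda>t. C t i j) has_real_derivative D) (at 0)"
      by (subst DERIV_cong_ev[OF refl _ refl, of _ "\<lambda>t. frame d (\<gamma> t) i j"])
        (use ev D in \<open>auto simp: C_def elim: eventually_mono\<close>)
    then show ?thesis by (auto simp: real_differentiable_def)
  qed
  define A where "A t = mtrans (C t)" for t
  have A: "A t \<in> Od d" for t unfolding A_def by (rule mtrans_Od[OF C])
  have A0: "A 0 = idm d" by (auto simp: A_def C0 mtrans_def idm_def fun_eq_iff)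
  have Adiff: "(\<lambda>t. A t i j) differentiable (at 0)" for i j
    unfolding A_def mtrans_def by (rule Cdiff)
  define \<kappa> where "\<kappa> t = (if \<gamma> t \<in> U_set d n then act d n (C t) (\<gamma> t) else k)" for t
  have \<kappa>K: "\<kappa> t \<in> K_set d n" for t using frame_U_set(2)[OF d n] k by (simp add: \<kappa>_def C_def)
  have \<kappa>c: "\<kappa> t \<in> cspace d n" for t using \<kappa>K by (simp add: K_set_def)
  have \<kappa>0: "\<kappa> 0 = k" by (simp add: \<kappa>_def \<gamma>0 C0 act_idm[OF kc])
  have \<kappa>\<gamma>: "act d n (A t) (\<kappa> t) = \<gamma> t" if "\<gamma> t \<in> U_set d n" for t
    using that act_mtrans_act[OF C \<gamma>c] by (simp add: \<kappa>_def A_def)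
  \<comment> \<open>Matrix entries of the action of \<open>A t\<close>; differentiating them
    separately from \<kappa> splits the derivative into an orbit part and a part in
    \<open>K_set\<close>.\<close>
  define P where "P t h g = act d n (A t) (unit_coord g) h" for t h g
  define P' where "P' h g = (SOME D. ((\<lambda>t. P t h g) has_real_derivative D) (at 0))" for h g
  have P': "((\<lambda>t. P t h g) has_real_derivative P' h g) (at 0)" for h g
    unfolding P'_def
    by (rule someI_ex) (use differentiable_act[of A d, OF Adiff Od_msupp[OF A]] in
        \<open>auto simp: P_def real_differentiable_def\<close>)
  define u where "u h = (SOME D. ((\<lambda>t. \<kappa> t h) has_real_derivative D) (at 0))" for h
  have u: "((\<lambda>t. \<kappa> t h) has_real_derivative u h) (at 0)" for h
  proof -
    \<comment> \<open>This expression agrees with \<kappa> only near 0, which is enough for the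
      derivative there.\<close>
    have "(\<lambda>t. \<Sum>g\<in>?I. act d n (C t) (unit_coord g) h * \<gamma> t g) differentiable (at 0)"
      using differentiable_act[of C d, OF Cdiff Od_msupp[OF C]] \<gamma>diff finite_lyn_words
      by (intro differentiable_sum differentiable_mult) auto
    then obtain D where D: "((\<lambda>t. \<Sum>g\<in>?I. act d n (C t) (unit_coord g) h * \<gamma> t g) has_real_derivative D) (at 0)"
      by (auto simp: real_differentiable_def)
    have "((\<lambda>t. \<kappa> t h) has_real_derivative D) (at 0)"
      by (subst DERIV_cong_ev[OF refl _ refl, of _ "\<lambda>t. \<Sum>g\<in>?I. act d n (C t) (unit_coord g) h * \<gamma> t g"])
        (use ev D act_expand[OF Od_msupp[OF C] \<gamma>c] in \<open>auto simp: \<kappa>_def elim!: eventually_mono\<close>)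
    then show ?thesis unfolding u_def by (rule someI)
  qed
  define w where "w h = (\<Sum>g\<in>?I. P' h g * k g)" for h
  have w: "((\<lambda>t. act d n (A t) k h) has_real_derivative w h) (at 0)" for h
    unfolding act_expand[OF Od_msupp[OF A] kc] P_def[symmetric] w_def
    by (intro DERIV_sum DERIV_cmult_right P')
  have u_fsp: "u \<in> fsp ?I"
  proof -
    have "u h = 0" if "h \<notin> ?I" for h
    proof -
      have "\<kappa> t h = 0" for t using cspaceD[OF \<kappa>c that] .
      then show ?thesis using u[of h] by (auto dest: DERIV_unique[OF _ DERIV_const])
    qed
    then show ?thesis by (simp add: fsp_def)
  qed
  have w_fsp: "w \<in> fsp ?I"
  proof -
    have "w h = 0" if "h \<notin> ?I" for h
    proof -
      have "act d n (A t) k h = 0" for t using cspaceD[OF act_spec(1)[OF Od_msupp[OF A]] that] .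
      then show ?thesis using w[of h] by (auto dest: DERIV_unique[OF _ DERIV_const])
    qed
    then show ?thesis by (simp add: fsp_def)
  qed
  have sum_eq: "v h = u h + w h" for h
  proof (cases "h \<in> ?I")
    case True
    \<comment> \<open>At t = 0 the matrix is the identity, so the term with the derivative of
      \<kappa> collapses to \<open>u h\<close>.\<close>
    have P0: "P 0 h g = unit_coord g h" if "g \<in> ?I" for g
    proof -
      have "unit_coord g \<in> cspace d n" using that by (auto simp: unit_coord_def cspace_def)
      then show ?thesis by (simp add: P_def A0 act_idm)
    qed
    have "((\<lambda>t. \<Sum>g\<in>?I. P t h g * \<kappa> t g) has_real_derivative (\<Sum>g\<in>?I. P' h g * \<kappa> 0 g + u g * P 0 h g)) (at 0)"
      by (intro DERIV_sum DERIV_mult P' u)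
    also have "(\<Sum>g\<in>?I. P' h g * \<kappa> 0 g + u g * P 0 h g) = w h + (\<Sum>g\<in>?I. (if g = h then 1 else 0) * u g)"
      unfolding sum.distrib w_def \<kappa>0 using P0
      by (intro arg_cong2[where f = "(+)"] refl sum.cong) (auto simp: unit_coord_def)
    also have "\<dots> = w h + u h" using sum_delta_mult[OF finite_lyn_words True, of u] by simp
    finally have D: "((\<lambda>t. \<Sum>g\<in>?I. P t h g * \<kappa> t g) has_real_derivative w h + u h) (at 0)" .
    have "((\<lambda>t. \<gamma> t h) has_real_derivative w h + u h) (at 0)"
    proof (subst DERIV_cong_ev[OF refl _ refl, of _ "\<lambda>t. \<Sum>g\<in>?I. P t h g * \<kappa> t g"])
      show "eventually (\<lambda>t. \<gamma> t h = (\<Sum>g\<in>?I. P t h g * \<kappa> t g)) (nhds 0)"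
        using ev
      proof (rule eventually_mono)
        fix t assume "\<gamma> t \<in> U_set d n"
        then show "\<gamma> t h = (\<Sum>g\<in>?I. P t h g * \<kappa> t g)"
          using fun_cong[OF act_expand[OF Od_msupp[OF A] \<kappa>c, of t t], of h] \<kappa>\<gamma>[of t]
          by (simp add: P_def)
      qed
    qed (fact D)
    then show ?thesis using DERIV_unique[OF \<gamma>D] by fastforce
  next
    case False
    then show ?thesis using v u_fsp w_fsp by (simp add: fsp_def)
  qed
  have "u \<in> tangent_fsp ?I (K_set d n) k"
    unfolding tangent_fsp_def using u_fsp \<kappa>K \<kappa>0 u by blast
  moreover have "w \<in> tangent_fsp ?I (orbit_of (Od d) (act d n) k) k"
    unfolding tangent_fsp_def
  proof (intro CollectI conjI exI[of _ "\<lambda>t. act d n (A t) k"] allI ballI w_fsp w)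
    show "act d n (A t) k \<in> orbit_of (Od d) (act d n) k" for t
      unfolding orbit_of_def using A by blast
    show "act d n (A 0) k = k" by (simp add: A0 act_idm[OF kc])
  qed
  ultimately show ?thesis using sum_eq by blast
qed

lemma cross_section_K_set:
  assumes "2 \<le> d" "2 \<le> n"
  shows "cross_section (lyn_words d n) (U_set d n) (Od d) (act d n) (K_set d n)"
  unfolding cross_section_def
proof (intro conjI ballI)
  fix x assume x: "x \<in> U_set d n"
  then have xc: "x \<in> cspace d n" by (simp add: U_set_def)
  show "\<exists>!k. k \<in> K_set d n \<and> k \<in> orbit_of (Od d) (act d n) x"
  proof (rule ex1I[of _ "act d n (frame d x) x"])
    show "act d n (frame d x) x \<in> K_set d n \<and> act d n (frame d x) x \<in> orbit_of (Od d) (act d n) x"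
      using frame_U_set[OF assms x] unfolding orbit_of_def by blast
    show "k = act d n (frame d x) x" if "k \<in> K_set d n \<and> k \<in> orbit_of (Od d) (act d n) x" for k
      using that frame_unique[OF assms xc] unfolding orbit_of_def by blast
  qed
qed (use K_set_subset_U_set[OF assms] submanifold_K_set[OF assms] transversal_K_set[OF assms] in auto)

theorem theorem4p3:
  fixes d n :: nat
  assumes "d \<ge> 2" and "n \<ge> 2"
  shows "cross_section (lyn_words d n) (U_set d n) (Od d) (act d n) (K_set d n) \<and>
    (\<exists>\<rho>. moving_frame d n (U_set d n) \<rho> \<and>
       (\<forall>z\<in>U_set d n. act d n (\<rho> z) z \<in> K_set d n \<and>
          (\<forall>g\<in>Od d. act d n g z \<in> K_set d n \<longrightarrow> g = \<rho> z)))"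
proof (intro conjI exI[of _ "frame d"] ballI impI)
  show "cross_section (lyn_words d n) (U_set d n) (Od d) (act d n) (K_set d n)"
    by (rule cross_section_K_set[OF assms])
  show "moving_frame d n (U_set d n) (frame d)"
    by (rule moving_frame_frame[OF assms])
  fix z assume z: "z \<in> U_set d n"
  show "act d n (frame d z) z \<in> K_set d n" by (rule frame_U_set(2)[OF assms z])
  fix g assume "g \<in> Od d" "act d n g z \<in> K_set d n"
  with z show "g = frame d z" by (intro frame_unique[OF assms]) (simp_all add: U_set_def)
qed

end
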